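(* Let $\alpha>1$, $\beta>\alpha/2+1$, $\gamma>1/2$ and $C_1>1$ be constants such that (i) $\mathrm{E}(\|Y\|^2)<\infty$, $\mathrm{E}(\|X\|^2)<\infty$, and $\mathrm{E}(\|\mathcal{E}\|^2\mid X)\le C_1$ almost surely; (ii) $\mathrm{E}(\xi_k^4)\le C_1\kappa_k^2$ for all $k\ge 1$; (iii) $\kappa_k\le C_1k^{-\alpha}$ and $\kappa_k-\kappa_{k+1}\ge C_1^{-1}k^{-\alpha-1}$ for all $k\ge 1$; (iv) $|b_{j,k}|\le C_1 j^{-\gamma}k^{-\beta}$ for all $j,k\ge 1$. Let $\hat b$ be the single-truncation estimator $$\hat b(s,t)=\sum_{k=1}^{m_n}\frac{n^{-1}\sum_{i=1}^n\hat\xi_{i,k}Y_i(s)}{\hat\kappa_k}\,\hat\phi_k(t),$$ where the positive integers $m_n$ satisfy $m_n\to\infty$ and $m_n=o\{n^{1/(2\alpha+2)}\}$ as $n\to\infty$. Then $$|||\hat b-b|||^2=O_{\mathrm{P}}\{n^{-1}m_n^{\alpha+1}+m_n^{-2\beta+1}\}\quad (n\to\infty).$$ Therefore, by choosing $m_n\sim n^{1/(\alpha+2\beta)}$, $$|||\hat b-b|||^2=O_{\mathrm{P}}\{n^{-(2\beta-1)/(\alpha+2\beta)}\}.$$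
   Context: Let $I=[0,1]$, $\|f\|=\{\int_I f^2(t)\,dt\}^{1/2}$ for $f\in L^2(I)$, $|||R|||=\{\iint_{I^2}R^2(s,t)\,ds\,dt\}^{1/2}$ for $R\in L^2(I^2)$, and $(f\otimes g)(s,t)=f(s)g(t)$. For positive sequences, $a_n\sim c_n$ means that $a_n/c_n$ is bounded and bounded away from zero. $X$ and $Y$ are $L^2(I)$-valued random variables on a probability space, with $\mathrm{E}(\|X\|^2)<\infty$, $\mathrm{E}(\|Y\|^2)<\infty$, satisfying the functional linear model $$\mathrm{E}(Y\mid X)(s)=\mathrm{E}\{Y(s)\}+\int_I b(s,t)[X(t)-\mathrm{E}\{X(t)\}]\,dt$$ (equality as $L^2(I)$-valued random variables), where $b\in L^2(I^2)$ is the unknown coefficient function. Put $\mathcal{E}=Y-\mathrm{E}(Y\mid X)$. Let $K(s,t)=\mathrm{Cov}\{X(s),X(t)\}$. The integral operator on $L^2(I)$ with kernel $K$ is assumed injective. Let $K(s,t)=\sum_{k=1}^\infty\kappa_k\phi_k(s)\phi_k(t)$ be its spectral expansion in $L^2(I^2)$, where $\kappa_1\ge\kappa_2\ge\cdots>0$ are the eigenvalues and $\{\phi_k\}_{k\ge1}$ is an orthonormal basis of $L^2(I)$ of corresponding eigenfunctions. Let $\xi_k=\int_I[X(t)-\mathrm{E}\{X(t)\}]\phi_k(t)\,dt$ and $b_{j,k}=\iint_{I^2}b(s,t)\phi_j(s)\phi_k(t)\,ds\,dt$, so that $b=\sum_{j,k}b_{j,k}\,\phi_j\otimes\phi_k$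 in $L^2(I^2)$. Let $(X_1,Y_1),\dots,(X_n,Y_n)$ be independent copies of $(X,Y)$, $\overline X=n^{-1}\sum_{i=1}^nX_i$, and $$\hat K(s,t)=\frac1n\sum_{i=1}^n\{X_i(s)-\overline X(s)\}\{X_i(t)-\overline X(t)\}.$$ Let $\hat K(s,t)=\sum_{k=1}^\infty\hat\kappa_k\hat\phi_k(s)\hat\phi_k(t)$ be its spectral expansion, where $\hat\kappa_1\ge\hat\kappa_2\ge\cdots\ge0$ are the eigenvalues of the integral operator with kernel $\hat K$ and $\{\hat\phi_k\}_{k\ge1}$ is an orthonormal basis of $L^2(I)$ of corresponding eigenfunctions. Let $\hat\xi_{i,k}=\int_I\{X_i(t)-\overline X(t)\}\hat\phi_k(t)\,dt$. If some $\hat\kappa_k$ in a denominator is zero, the corresponding term is given an arbitrary fixed value, e.g. $0$. *)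

theory Defs
  imports "HOL-Probability.Probability" "HOL-Library.Landau_Symbols"
begin

text \<open>
  Elements of \<open>L\<^sup>2\<close> are represented by (Borel) square-integrable functions; two functions
  represent the same element iff they agree almost everywhere, and all equalities between
  elements of \<open>L\<^sup>2\<close> are accordingly stated almost everywhere or as vanishing of a norm.
\<close>

abbreviation unit_I :: "real measure" where
  "unit_I \<equiv> restrict_space lborel {0..1}"

abbreviation unit_I2 :: "(real \<times> real) measure" where
  "unit_I2 \<equiv> unit_I \<Otimes>\<^sub>M unit_I"

definition L2 :: "'a measure \<Rightarrow> ('a \<Rightarrow> real) set" where
  "L2 M = {f \<in> borel_measurable M. integrable M (\<lambda>x. (f x)\<^sup>2)}"

definition L2_norm :: "'a measure \<Rightarrow> ('a \<Rightarrow> real) \<Rightarrow> real" where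
  "L2_norm M f = sqrt (\<integral>x. (f x)\<^sup>2 \<partial>M)"

definition L2_inner :: "'a measure \<Rightarrow> ('a \<Rightarrow> real) \<Rightarrow> ('a \<Rightarrow> real) \<Rightarrow> real" where
  "L2_inner M f g = (\<integral>x. f x * g x \<partial>M)"

definition L2_basis :: "(nat \<Rightarrow> real \<Rightarrow> real) \<Rightarrow> bool" where
  "L2_basis \<phi> \<longleftrightarrow>
     (\<forall>k\<ge>1. \<phi> k \<in> L2 unit_I) \<and>
     (\<forall>j\<ge>1. \<forall>k\<ge>1. L2_inner unit_I (\<phi> j) (\<phi> k) = (if j = k then 1 else 0)) \<and>
     (\<forall>f\<in>L2 unit_I.
        (\<lambda>N. L2_norm unit_I (\<lambda>t. f t - (\<Sum>k=1..N. L2_inner unit_I f (\<phi> k) * \<phi> k t)))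
          \<longlonglongrightarrow> 0)"


subsection \<open>Integral operators and spectral expansions\<close>

definition int_op :: "(real \<Rightarrow> real \<Rightarrow> real) \<Rightarrow> (real \<Rightarrow> real) \<Rightarrow> real \<Rightarrow> real" where
  "int_op R f s = (\<integral>t. R s t * f t \<partial>unit_I)"

definition injective_int_op :: "(real \<Rightarrow> real \<Rightarrow> real) \<Rightarrow> bool" where
  "injective_int_op R \<longleftrightarrow>
     (\<forall>f\<in>L2 unit_I. (AE s in unit_I. int_op R f s = 0) \<longrightarrow> (AE s in unit_I. f s = 0))"

text \<open>Eigenvalues and eigenfunctions are indexed by \<open>k \<ge> 1\<close>; the values at \<open>0\<close> are irrelevant.\<close>

definition spectral_expansion ::
    "(real \<Rightarrow> real \<Rightarrow> real) \<Rightarrow> (nat \<Rightarrow> real) \<Rightarrow> (nat \<Rightarrow> real \<Rightarrow> real) \<Rightarrow> bool" where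
  "spectral_expansion R \<kappa> \<phi> \<longleftrightarrow>
     L2_basis \<phi> \<and>
     (\<forall>k\<ge>1. AE s in unit_I. int_op R (\<phi> k) s = \<kappa> k * \<phi> k s) \<and>
     (\<forall>k\<ge>1. \<kappa> (Suc k) \<le> \<kappa> k \<and> 0 \<le> \<kappa> k) \<and>
     (\<lambda>N. L2_norm unit_I2 (\<lambda>(s, t). R s t - (\<Sum>k=1..N. \<kappa> k * \<phi> k s * \<phi> k t))) \<longlonglongrightarrow> 0"


subsection \<open>Random elements of \<open>L\<^sup>2(I)\<close>\<close>

text \<open>The Borel \<open>\<sigma>\<close>-algebra of \<open>L\<^sup>2(I)\<close>, i.e. the one generated by the norm-open sets.\<close>

definition L2_borel :: "(real \<Rightarrow> real) measure" where
  "L2_borel = sigma (L2 unit_I)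
     {U. U \<subseteq> L2 unit_I \<and>
         (\<forall>f\<in>U. \<exists>e>0. \<forall>g\<in>L2 unit_I. L2_norm unit_I (\<lambda>t. g t - f t) < e \<longrightarrow> g \<in> U)}"

text \<open>
  Every \<open>L\<^sup>2(I)\<close>-valued random variable has a jointly measurable version, and it is such a version
  that is used to represent it. This gives a meaning to \<open>X(t)\<close>, \<open>E{X(t)}\<close> and \<open>Cov{X(s), X(t)}\<close>,
  which then do not depend on the version, up to null sets of \<open>t\<close> or \<open>(s, t)\<close>.
\<close>

definition L2_random :: "'w measure \<Rightarrow> ('w \<Rightarrow> real \<Rightarrow> real) \<Rightarrow> bool" where
  "L2_random M X \<longleftrightarrow>
     X \<in> M \<rightarrow>\<^sub>M L2_borel \<and> (\<lambda>(\<omega>, t). X \<omega> t) \<in> borel_measurable (M \<Otimes>\<^sub>M unit_I)"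

definition mean_fun :: "'w measure \<Rightarrow> ('w \<Rightarrow> real \<Rightarrow> real) \<Rightarrow> real \<Rightarrow> real" where
  "mean_fun M X t = (\<integral>\<omega>. X \<omega> t \<partial>M)"

definition cov_kernel :: "'w measure \<Rightarrow> ('w \<Rightarrow> real \<Rightarrow> real) \<Rightarrow> real \<Rightarrow> real \<Rightarrow> real" where
  "cov_kernel M X s t = (\<integral>\<omega>. (X \<omega> s - mean_fun M X s) * (X \<omega> t - mean_fun M X t) \<partial>M)"

abbreviation sigma_gen :: "'w measure \<Rightarrow> ('w \<Rightarrow> real \<Rightarrow> real) \<Rightarrow> 'w measure" where
  "sigma_gen M X \<equiv> vimage_algebra (space M) X L2_borel"

text \<open>
  \<open>Z\<close> is a version of the \<open>L\<^sup>2(I)\<close>-valued conditional expectation of \<open>Y\<close> given \<open>F\<close>. The Bochner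
  integral of an integrable \<open>L\<^sup>2(I)\<close>-valued random variable over an event is represented by the
  function obtained by integrating pointwise in \<open>s\<close>.
\<close>

definition L2_cond_exp ::
    "'w measure \<Rightarrow> 'w measure \<Rightarrow> ('w \<Rightarrow> real \<Rightarrow> real) \<Rightarrow> ('w \<Rightarrow> real \<Rightarrow> real) \<Rightarrow> bool" where
  "L2_cond_exp M F Y Z \<longleftrightarrow>
     L2_random F Z \<and> integrable M (\<lambda>\<omega>. L2_norm unit_I (Z \<omega>)) \<and>
     (\<forall>A\<in>sets F. AE s in unit_I. (LINT \<omega>:A|M. Z \<omega> s) = (LINT \<omega>:A|M. Y \<omega> s))"

definition indep_copies ::
    "'w measure \<Rightarrow> ('w \<Rightarrow> real \<Rightarrow> real) \<Rightarrow> ('w \<Rightarrow> real \<Rightarrow> real) \<Rightarrow>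
     (nat \<Rightarrow> 'w \<Rightarrow> real \<Rightarrow> real) \<Rightarrow> (nat \<Rightarrow> 'w \<Rightarrow> real \<Rightarrow> real) \<Rightarrow> bool" where
  "indep_copies M X Y Xs Ys \<longleftrightarrow>
     (\<forall>i\<ge>1. L2_random M (Xs i) \<and> L2_random M (Ys i)) \<and>
     prob_space.indep_vars M (\<lambda>_. L2_borel \<Otimes>\<^sub>M L2_borel) (\<lambda>i \<omega>. (Xs i \<omega>, Ys i \<omega>)) {1..} \<and>
     (\<forall>i\<ge>1. distr M (L2_borel \<Otimes>\<^sub>M L2_borel) (\<lambda>\<omega>. (Xs i \<omega>, Ys i \<omega>)) =
             distr M (L2_borel \<Otimes>\<^sub>M L2_borel) (\<lambda>\<omega>. (X \<omega>, Y \<omega>)))"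


subsection \<open>Sample quantities\<close>

definition sample_mean ::
    "(nat \<Rightarrow> 'w \<Rightarrow> real \<Rightarrow> real) \<Rightarrow> nat \<Rightarrow> 'w \<Rightarrow> real \<Rightarrow> real" where
  "sample_mean Xs n \<omega> t = (\<Sum>i=1..n. Xs i \<omega> t) / real n"

definition sample_cov ::
    "(nat \<Rightarrow> 'w \<Rightarrow> real \<Rightarrow> real) \<Rightarrow> nat \<Rightarrow> 'w \<Rightarrow> real \<Rightarrow> real \<Rightarrow> real" where
  "sample_cov Xs n \<omega> s t =
     (\<Sum>i=1..n. (Xs i \<omega> s - sample_mean Xs n \<omega> s) * (Xs i \<omega> t - sample_mean Xs n \<omega> t)) / real n"

definition sample_score ::
    "(nat \<Rightarrow> 'w \<Rightarrow> real \<Rightarrow> real) \<Rightarrow> (nat \<Rightarrow> 'w \<Rightarrow> nat \<Rightarrow> real \<Rightarrow> real) \<Rightarrow>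
     nat \<Rightarrow> 'w \<Rightarrow> nat \<Rightarrow> nat \<Rightarrow> real" where
  "sample_score Xs \<phi>h n \<omega> i k =
     (\<integral>t. (Xs i \<omega> t - sample_mean Xs n \<omega> t) * \<phi>h n \<omega> k t \<partial>unit_I)"

text \<open>A summand with vanishing eigenvalue \<open>\<kappa>h n \<omega> k\<close> is \<open>0\<close>, by the convention \<open>x / 0 = 0\<close>.\<close>

definition b_hat ::
    "(nat \<Rightarrow> 'w \<Rightarrow> real \<Rightarrow> real) \<Rightarrow> (nat \<Rightarrow> 'w \<Rightarrow> real \<Rightarrow> real) \<Rightarrow>
     (nat \<Rightarrow> 'w \<Rightarrow> nat \<Rightarrow> real) \<Rightarrow> (nat \<Rightarrow> 'w \<Rightarrow> nat \<Rightarrow> real \<Rightarrow> real) \<Rightarrow>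
     (nat \<Rightarrow> nat) \<Rightarrow> nat \<Rightarrow> 'w \<Rightarrow> real \<Rightarrow> real \<Rightarrow> real" where
  "b_hat Xs Ys \<kappa>h \<phi>h m n \<omega> s t =
     (\<Sum>k=1..m n.
        ((\<Sum>i=1..n. sample_score Xs \<phi>h n \<omega> i k * Ys i \<omega> s) / real n) / \<kappa>h n \<omega> k * \<phi>h n \<omega> k t)"


subsection \<open>Stochastic boundedness\<close>

text \<open>
  \<open>Z n = O\<^sub>P(r n)\<close>, with outer probability in place of probability. The empirical
  eigenfunctions are arbitrary for every sample point, so that quantities built from them need not
  be measurable. For random variables the definition is the usual one, as shown below.
\<close>

definition bounded_in_prob :: "'w measure \<Rightarrow> (nat \<Rightarrow> 'w \<Rightarrow> real) \<Rightarrow> (nat \<Rightarrow> real) \<Rightarrow> bool" where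
  "bounded_in_prob M Z r \<longleftrightarrow>
     (\<forall>\<epsilon>>0. \<exists>C>0. \<forall>\<^sub>F n in sequentially.
        \<exists>A\<in>sets M. {\<omega>\<in>space M. \<bar>Z n \<omega>\<bar> > C * r n} \<subseteq> A \<and> measure M A \<le> \<epsilon>)"

lemma bounded_in_prob_random_variable:
  assumes "prob_space M" and "\<And>n. Z n \<in> borel_measurable M"
  shows "bounded_in_prob M Z r \<longleftrightarrow>
     (\<forall>\<epsilon>>0. \<exists>C>0. \<forall>\<^sub>F n in sequentially. measure M {\<omega>\<in>space M. \<bar>Z n \<omega>\<bar> > C * r n} \<le> \<epsilon>)"
proof -
  interpret prob_space M by fact
  have [measurable]: "\<And>n. Z n \<in> borel_measurable M" by fact
  have "(\<exists>A\<in>sets M. {\<omega>\<in>space M. \<bar>Z n \<omega>\<bar> > c} \<subseteq> A \<and> measure M A \<le> e) \<longleftrightarrow>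
        measure M {\<omega>\<in>space M. \<bar>Z n \<omega>\<bar> > c} \<le> e" (is "?L \<longleftrightarrow> ?R") for n c e
  proof
    assume ?L
    then show ?R by (meson finite_measure_mono order_trans)
  next
    have "{\<omega>\<in>space M. \<bar>Z n \<omega>\<bar> > c} \<in> sets M" by measurable
    moreover assume ?R
    ultimately show ?L by blast
  qed
  then show ?thesis by (simp add: bounded_in_prob_def)
qed

end

theory Submission
  imports Defs
begin

text \<open>
  Write \<open>c\<^sub>i = X\<^sub>i - \<close> (sample mean), let \<open>B\<close> be the integral operator with kernel \<open>b\<close>, and let \<open>e\<^sub>i\<close> be what
  is left of \<open>Y\<^sub>i\<close> after subtraction of \<open>E Y\<close> and \<open>B (X\<^sub>i - E X)\<close>. The \<open>c\<^sub>i\<close> sum to zero and the empirical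
  eigenvalues and eigenfunctions \<open>\<kappa>h\<close>, \<open>\<phi>h\<close> diagonalise the form \<open>n\<^bsup>-1\<^esup> \<Sum>\<^sub>i c\<^sub>i \<otimes> c\<^sub>i\<close>, so that
  substituting for \<open>Y\<^sub>i\<close> in the estimator cancels everything but the residuals: with
  \<open>N = n\<^bsup>-1\<^esup> \<Sum>\<^sub>i e\<^sub>i \<otimes> c\<^sub>i\<close>, the estimation error maps \<open>\<phi>h\<^sub>k\<close> to \<open>N \<phi>h\<^sub>k / \<kappa>h\<^sub>k\<close> if \<open>k \<le> m\<close> and to
  \<open>- B \<phi>h\<^sub>k\<close> if \<open>k > m\<close>, provided that \<open>\<kappa>h\<^sub>m > 0\<close>. By Parseval the loss is then exactly
  \<open>\<Sum>\<^bsub>k\<le>m\<^esub> \<parallel>N \<phi>h\<^sub>k\<parallel>\<^sup>2 / \<kappa>h\<^sub>k\<^sup>2 + \<Sum>\<^bsub>k>m\<^esub> \<parallel>B \<phi>h\<^sub>k\<parallel>\<^sup>2\<close>, a noise part plus a bias part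
  (\<open>estimation_error_coefficients\<close>).

  Both parts are compared with their population versions by deterministic inequalities for two
  symmetric forms whose difference has norm at most \<open>D\<close>. The fourth moments of the scores give
  \<open>D = O\<^sub>P(n\<^bsup>-1/2\<^esup>)\<close>, and the growth condition on \<open>m\<close> says precisely that \<open>n\<^bsup>-1/2\<^esup>\<close> is negligible
  against \<open>m\<^bsup>-\<alpha>-1\<^esup>\<close>, the order of the smallest eigenvalue gap in use; so \<open>D\<close> is eventually below half of
  that gap.

  For the noise (\<open>truncated_inverse_bound\<close>) the truncated empirical inverse is controlled in operator
  norm relative to the weights \<open>\<kappa>\<^sub>k + \<kappa>\<^sub>m\<close>, at the price of a factor \<open>8/\<kappa>\<^sub>m = O(m\<^sup>\<alpha>)\<close>. What remains is
  the weighted energy \<open>\<Sum>\<^sub>k \<parallel>N \<phi>\<^sub>k\<parallel>\<^sup>2 / (\<kappa>\<^sub>k + \<kappa>\<^sub>m)\<close> in the fixed basis \<open>\<phi>\<close>, with mean of the order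
  \<open>n\<^bsup>-1\<^esup> \<Sum>\<^sub>k \<kappa>\<^sub>k / (\<kappa>\<^sub>k + \<kappa>\<^sub>m) = O(m/n)\<close> (\<open>effective_dimension\<close>). The product is
  \<open>O\<^sub>P(n\<^bsup>-1\<^esup> m\<^bsup>\<alpha>+1\<^esup>)\<close>.

  For the bias (\<open>projection_tail_bound\<close>) the rows of \<open>b\<close> are split at index \<open>m\<close>. The tail has energy
  \<open>O(m\<^bsup>1-2\<beta>\<^esup>)\<close>. For \<open>l \<le> m\<close>, the part of \<open>\<phi>\<^sub>l\<close> outside the span of the first \<open>m\<close> empirical
  eigenfunctions has norm at most \<open>2 D / (\<kappa>\<^sub>l - \<kappa>\<^bsub>m+1\<^esub>)\<close>, and the sum of these bounds against the
  coefficients \<open>l\<^bsup>-\<beta>\<^esup>\<close> is \<open>O(D m\<^bsup>(\<alpha>+1)/2\<^esup>)\<close> because \<open>\<beta> > \<alpha>/2 + 1\<close> (\<open>weighted_reciprocal_sum\<close>).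

  The inequalities hold pointwise on an event of large probability that is defined through averages
  in the fixed basis \<open>\<phi>\<close> only (\<open>averages_within\<close>). Hence they hold for every choice of the
  empirical eigenfunctions at each sample point, as they must, since that choice may fail to be
  measurable. Everything is done in coordinates: functions are turned into vectors of an inner product
  space \<open>l2\<close>, and kernels into their coefficients in a tensor basis.
\<close>

section \<open>Orthonormal bases and forms that they diagonalise\<close>

lemma norm_add_square_le:
  fixes x y :: "'a::real_normed_vector"
  shows "(norm (x + y))\<^sup>2 \<le> 2 * (norm x)\<^sup>2 + 2 * (norm y)\<^sup>2"
proof -
  have "(norm (x + y))\<^sup>2 \<le> (norm x + norm y)\<^sup>2"
    by (intro power_mono norm_triangle_ineq) auto
  also have "\<dots> \<le> 2 * (norm x)\<^sup>2 + 2 * (norm y)\<^sup>2"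
    using zero_le_power2[of "norm x - norm y"] by (simp add: power2_eq_square algebra_simps)
  finally show ?thesis .
qed

text \<open>The index starts at 1, as for eigenvalues and eigenfunctions; the vector \<open>e 0\<close> is arbitrary.\<close>

definition orthonormal_basis :: "(nat \<Rightarrow> 'a::real_inner) \<Rightarrow> bool" where
  "orthonormal_basis e \<longleftrightarrow>
     (\<forall>j\<ge>1. \<forall>k\<ge>1. e j \<bullet> e k = (if j = k then 1 else 0)) \<and>
     (\<forall>x. (\<lambda>N. \<Sum>k=1..N. (x \<bullet> e k) *\<^sub>R e k) \<longlonglongrightarrow> x)"

lemma orthonormal_basis_inner:
  assumes "orthonormal_basis e" "j \<ge> 1" "k \<ge> 1"
  shows "e j \<bullet> e k = (if j = k then 1 else 0)"
  using assms by (simp add: orthonormal_basis_def)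

lemma inner_orthonormal_combination:
  assumes e: "orthonormal_basis e" and A: "finite A" "A \<subseteq> {1..}"
  shows "j \<in> A \<Longrightarrow> (\<Sum>k\<in>A. c k *\<^sub>R e k) \<bullet> e j = c j"
    and "j \<ge> 1 \<Longrightarrow> j \<notin> A \<Longrightarrow> (\<Sum>k\<in>A. c k *\<^sub>R e k) \<bullet> e j = 0"
    and "x \<bullet> (\<Sum>k\<in>A. c k *\<^sub>R e k) = (\<Sum>k\<in>A. c k * (x \<bullet> e k))"
    and "(norm (\<Sum>k\<in>A. c k *\<^sub>R e k))\<^sup>2 = (\<Sum>k\<in>A. (c k)\<^sup>2)"
proof -
  have *: "(\<Sum>k\<in>A. c k *\<^sub>R e k) \<bullet> e j = (\<Sum>k\<in>A. if k = j then c k else 0)" if "j \<ge> 1" for j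
    unfolding inner_sum_left using A that
    by (intro sum.cong) (auto simp: orthonormal_basis_inner[OF e] subset_iff)
  show 1: "(\<Sum>k\<in>A. c k *\<^sub>R e k) \<bullet> e j = c j" if "j \<in> A" for j
    using * A that by (auto simp: subset_iff)
  show "j \<ge> 1 \<Longrightarrow> j \<notin> A \<Longrightarrow> (\<Sum>k\<in>A. c k *\<^sub>R e k) \<bullet> e j = 0"
    using * A by simp
  show 2: "x \<bullet> (\<Sum>k\<in>A. c k *\<^sub>R e k) = (\<Sum>k\<in>A. c k * (x \<bullet> e k))" for x
    by (simp add: inner_sum_right)
  show "(norm (\<Sum>k\<in>A. c k *\<^sub>R e k))\<^sup>2 = (\<Sum>k\<in>A. (c k)\<^sup>2)"
    unfolding power2_norm_eq_inner 2 by (intro sum.cong) (auto simp: 1 power2_eq_square)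
qed

lemma parseval:
  assumes "orthonormal_basis e"
  shows "(\<lambda>N. \<Sum>k=1..N. (x \<bullet> e k) * (y \<bullet> e k)) \<longlonglongrightarrow> x \<bullet> y"
proof -
  have "(\<lambda>N. (\<Sum>k=1..N. (x \<bullet> e k) *\<^sub>R e k) \<bullet> y) \<longlonglongrightarrow> x \<bullet> y"
    using assms by (intro tendsto_inner tendsto_const) (auto simp: orthonormal_basis_def)
  then show ?thesis
    by (simp add: inner_sum_left inner_commute[of y])
qed

lemma parseval_norm:
  assumes "orthonormal_basis e"
  shows "(\<lambda>N. \<Sum>k=1..N. (x \<bullet> e k)\<^sup>2) \<longlonglongrightarrow> (norm x)\<^sup>2"
  using parseval[OF assms, of x x] by (simp add: power2_eq_square[symmetric] power2_norm_eq_inner)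

lemma bessel:
  assumes "orthonormal_basis e" "finite A" "A \<subseteq> {1..}"
  shows "(\<Sum>k\<in>A. (x \<bullet> e k)\<^sup>2) \<le> (norm x)\<^sup>2"
proof -
  have "(\<Sum>k=1..N. (x \<bullet> e k)\<^sup>2) \<le> (norm x)\<^sup>2" for N
    by (rule incseq_le[OF _ parseval_norm[OF assms(1)]])
       (auto intro!: incseq_SucI)
  moreover obtain N where "A \<subseteq> {1..N}"
    using assms(2,3) by (metis Icc_subset_Ici_iff atLeastAtMost_iff atLeast_iff finite_nat_set_iff_bounded_le subset_iff)
  ultimately show ?thesis
    by (smt (verit, best) finite_atLeastAtMost sum_mono2 zero_le_power2)
qed

text \<open>A covariance operator enters the argument only through its quadratic form. Asking for a basis in which
  the form is diagonal treats the population and the empirical covariance alike.\<close>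

definition diagonalised_by ::
    "('a::real_inner \<Rightarrow> 'a \<Rightarrow> real) \<Rightarrow> (nat \<Rightarrow> real) \<Rightarrow> (nat \<Rightarrow> 'a) \<Rightarrow> bool" where
  "diagonalised_by Q \<kappa> e \<longleftrightarrow> orthonormal_basis e \<and> (\<forall>k\<ge>1. 0 \<le> \<kappa> k) \<and>
     (\<forall>j\<ge>1. \<forall>k\<ge>j. \<kappa> k \<le> \<kappa> j) \<and>
     (\<forall>x y. (\<lambda>N. \<Sum>k=1..N. \<kappa> k * ((x \<bullet> e k) * (y \<bullet> e k))) \<longlonglongrightarrow> Q x y)"

lemma diagonalised_byD:
  assumes "diagonalised_by Q \<kappa> e"
  shows "orthonormal_basis e" and "k \<ge> 1 \<Longrightarrow> 0 \<le> \<kappa> k" and "j \<ge> 1 \<Longrightarrow> j \<le> k \<Longrightarrow> \<kappa> k \<le> \<kappa> j"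
    and "(\<lambda>N. \<Sum>k=1..N. \<kappa> k * ((x \<bullet> e k) * (y \<bullet> e k))) \<longlonglongrightarrow> Q x y"
  using assms by (auto simp: diagonalised_by_def)

lemma diagonalised_finite:
  assumes Q: "diagonalised_by Q \<kappa> e" and A: "finite A" "A \<subseteq> {1..}"
    and x: "\<And>k. k \<ge> 1 \<Longrightarrow> k \<notin> A \<Longrightarrow> x \<bullet> e k = 0"
  shows "Q x y = (\<Sum>k\<in>A. \<kappa> k * ((x \<bullet> e k) * (y \<bullet> e k)))"
proof -
  obtain N0 where N0: "A \<subseteq> {1..N0}"
    using A by (metis Icc_subset_Ici_iff atLeastAtMost_iff atLeast_iff finite_nat_set_iff_bounded_le subset_iff)
  have "(\<Sum>k=1..N. \<kappa> k * ((x \<bullet> e k) * (y \<bullet> e k))) = (\<Sum>k\<in>A. \<kappa> k * ((x \<bullet> e k) * (y \<bullet> e k)))"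
    if "N \<ge> N0" for N
    using N0 that x by (intro sum.mono_neutral_right) auto
  then have "(\<lambda>N. \<Sum>k=1..N. \<kappa> k * ((x \<bullet> e k) * (y \<bullet> e k)))
      \<longlonglongrightarrow> (\<Sum>k\<in>A. \<kappa> k * ((x \<bullet> e k) * (y \<bullet> e k)))"
    by (intro tendsto_eventually) (auto simp: eventually_sequentially)
  with diagonalised_byD(4)[OF Q] show ?thesis
    using LIMSEQ_unique by blast
qed

text \<open>The upper half of the Courant-Fischer principle. The second argument is allowed to have components
  along the first \<open>m\<close> eigenvectors, where \<open>x\<close> has none, because \<open>eigenvector_leakage\<close> pairs the residual
  of a projection with the projected vector itself.\<close>

lemma diagonalised_upper:
  assumes Q: "diagonalised_by Q \<kappa> e" 
    and x: "\<And>k. k \<ge> 1 \<Longrightarrow> k \<le> m \<Longrightarrow> x \<bullet> e k = 0"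
    and y: "\<And>k. k > m \<Longrightarrow> y \<bullet> e k = x \<bullet> e k"
  shows "Q x y \<le> \<kappa> (Suc m) * (norm x)\<^sup>2"
proof (rule LIMSEQ_le_const2[OF diagonalised_byD(4)[OF Q]])
  have "(\<Sum>k=1..N. \<kappa> k * ((x \<bullet> e k) * (y \<bullet> e k))) \<le> \<kappa> (Suc m) * (norm x)\<^sup>2" for N
  proof -
    have "\<kappa> k * ((x \<bullet> e k) * (y \<bullet> e k)) \<le> \<kappa> (Suc m) * (x \<bullet> e k)\<^sup>2" if "k \<in> {1..N}" for k
    proof (cases "k \<le> m")
      case True
      then show ?thesis using x that by simp
    next
      case False
      then have "\<kappa> k \<le> \<kappa> (Suc m)" by (intro diagonalised_byD(3)[OF Q]) auto
      then show ?thesis using y False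
        by (simp add: power2_eq_square mult_right_mono)
    qed
    then have "(\<Sum>k=1..N. \<kappa> k * ((x \<bullet> e k) * (y \<bullet> e k))) \<le> (\<Sum>k=1..N. \<kappa> (Suc m) * (x \<bullet> e k)\<^sup>2)"
      by (rule sum_mono)
    also have "\<dots> \<le> \<kappa> (Suc m) * (norm x)\<^sup>2"
      unfolding sum_distrib_left[symmetric] using diagonalised_byD(2)[OF Q]
      by (intro mult_left_mono bessel diagonalised_byD(1)[OF Q]) auto
    finally show ?thesis .
  qed
  then show "\<exists>N0. \<forall>N\<ge>N0. (\<Sum>k=1..N. \<kappa> k * ((x \<bullet> e k) * (y \<bullet> e k))) \<le> \<kappa> (Suc m) * (norm x)\<^sup>2"
    by blast
qed

section \<open>Perturbation of eigenvalues and spectral projections\<close>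

text \<open>Otherwise the projection onto the first \<open>m\<close> vectors of \<open>e\<close> would be injective on the
  \<open>(m + 1)\<close>-dimensional span of \<open>e' 1, \<dots>, e' (m + 1)\<close>.\<close>

lemma nonzero_combination_orthogonal_to:
  fixes e e' :: "nat \<Rightarrow> 'a::real_inner"
  assumes e: "orthonormal_basis e" and e': "orthonormal_basis e'"
  shows "\<exists>c. (\<Sum>j=1..Suc m. c j *\<^sub>R e' j) \<noteq> 0 \<and> (\<forall>k\<in>{1..m}. (\<Sum>j=1..Suc m. c j *\<^sub>R e' j) \<bullet> e k = 0)"
proof (rule ccontr)
  assume neg: "\<not> ?thesis"
  define S where "S = e' ` {1..Suc m}"
  define T where "T w = (\<Sum>k=1..m. (w \<bullet> e k) *\<^sub>R e k)" for w
  have lin: "linear T"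
    by (rule linearI) (auto simp: T_def inner_add_left scaleR_add_left sum.distrib scaleR_sum_right)
  have inj: "inj_on e' {1..Suc m}"
  proof (rule inj_onI)
    fix i j assume "i \<in> {1..Suc m}" "j \<in> {1..Suc m}" "e' i = e' j"
    then show "i = j"
      using orthonormal_basis_inner[OF e', of i j] orthonormal_basis_inner[OF e', of j j] by (auto split: if_splits)
  qed
  have span: "\<exists>c. w = (\<Sum>j=1..Suc m. c j *\<^sub>R e' j)" if "w \<in> span S" for w
  proof -
    have "finite S" by (simp add: S_def)
    then have "w \<in> range (\<lambda>u. \<Sum>v\<in>S. u v *\<^sub>R v)"
      using that by (simp add: span_finite)
    then obtain u where "w = (\<Sum>v\<in>S. u v *\<^sub>R v)" by blast
    then have "w = (\<Sum>j=1..Suc m. u (e' j) *\<^sub>R e' j)"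
      unfolding S_def using inj by (simp add: sum.reindex del: sum.cl_ivl_Suc)
    then show ?thesis by (intro exI[of _ "\<lambda>j. u (e' j)"])
  qed
  have "pairwise orthogonal S"
    unfolding S_def pairwise_def orthogonal_def
    by (auto simp: orthonormal_basis_inner[OF e'])
  moreover have "0 \<notin> S"
    unfolding S_def using orthonormal_basis_inner[OF e', of j j for j] by fastforce
  ultimately have ind: "independent S"
    by (rule pairwise_orthogonal_independent)
  have "inj_on T (span S)"
  proof (subst linear_inj_on_iff_eq_0)
    show "linear T" by fact
    show "\<forall>w\<in>span S. T w = 0 \<longrightarrow> w = 0"
    proof (intro ballI impI)
      fix w assume w: "w \<in> span S" "T w = 0"
      have "w \<bullet> e k = 0" if "k \<in> {1..m}" for k
        using inner_orthonormal_combination(1)[OF e, of "{1..m}" k "\<lambda>k. w \<bullet> e k"] that w(2)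
        by (auto simp: T_def)
      with span[OF w(1)] neg show "w = 0" by blast
    qed
  qed (rule subspace_span)
  then have "independent (T ` S)" "card (T ` S) = card S"
    using linear_independent_injective_image[OF lin ind]
    by (auto intro!: card_image inj_on_subset[OF _ span_superset])
  moreover have "card S = Suc m"
    using inj by (simp add: S_def card_image)
  moreover have "T ` S \<subseteq> span (e ` {1..m})"
    unfolding T_def by (intro image_subsetI span_sum span_scale span_base imageI)
  ultimately have "Suc m \<le> card (e ` {1..m})"
    using independent_span_bound[of "e ` {1..m}" "T ` S"] by auto
  also have "\<dots> \<le> m"
    using card_image_le[of "{1..m}" e] by simp
  finally show False by simp
qed

text \<open>Weyl's inequality. On a vector in the span of \<open>e' 1, \<dots>, e' j\<close> that is orthogonal to
  \<open>e 1, \<dots>, e (j - 1)\<close>, the form \<open>Q'\<close> is at least \<open>\<kappa>' j\<close> and the form \<open>Q\<close> at most \<open>\<kappa> j\<close>. Exchanging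
  the two forms gives the other inequality.\<close>

theorem eigenvalue_perturbation:
  assumes Q: "diagonalised_by Q \<kappa> e" and Q': "diagonalised_by Q' \<kappa>' e'"
    and D: "\<And>x. \<bar>Q x x - Q' x x\<bar> \<le> D * (norm x)\<^sup>2" and j: "j \<ge> 1"
  shows "\<kappa>' j \<le> \<kappa> j + D"
proof -
  obtain m where m: "j = Suc m" using j by (cases j) auto
  note e = diagonalised_byD(1)[OF Q] and e' = diagonalised_byD(1)[OF Q']
  obtain c where nz: "(\<Sum>j=1..Suc m. c j *\<^sub>R e' j) \<noteq> 0" 
    and orth: "\<forall>k\<in>{1..m}. (\<Sum>j=1..Suc m. c j *\<^sub>R e' j) \<bullet> e k = 0"
    using nonzero_combination_orthogonal_to[OF e e'] by blast
  define w where "w = (\<Sum>j=1..Suc m. c j *\<^sub>R e' j)"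
  note w = inner_orthonormal_combination[OF e', of "{1..Suc m}", folded w_def]
  have "\<kappa>' j * (norm w)\<^sup>2 = (\<Sum>k=1..Suc m. \<kappa>' j * (c k)\<^sup>2)"
    using w(4)[of c] by (simp add: w_def sum_distrib_left del: sum.cl_ivl_Suc)
  also have "\<dots> \<le> (\<Sum>k=1..Suc m. \<kappa>' k * (c k)\<^sup>2)"
    using diagonalised_byD(3)[OF Q'] m by (intro sum_mono mult_right_mono) auto
  also have "\<dots> = (\<Sum>k=1..Suc m. \<kappa>' k * ((w \<bullet> e' k) * (w \<bullet> e' k)))"
    using w(1)[of _ c] by (intro sum.cong) (auto simp: w_def power2_eq_square)
  also have "\<dots> = Q' w w"
    using w(2)[of _ c] by (intro diagonalised_finite[OF Q', symmetric]) (auto simp: w_def)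
  also have "\<dots> \<le> Q w w + D * (norm w)\<^sup>2"
    using D[of w] by (simp add: abs_le_iff)
  also have "Q w w \<le> \<kappa> (Suc m) * (norm w)\<^sup>2"
    using orth by (intro diagonalised_upper[OF Q]) (auto simp: w_def)
  finally have "\<kappa>' j * (norm w)\<^sup>2 \<le> (\<kappa> j + D) * (norm w)\<^sup>2"
    by (simp add: m algebra_simps)
  moreover have "0 < (norm w)\<^sup>2"
    using nz by (simp add: w_def)
  ultimately show ?thesis
    using mult_le_cancel_right_pos by blast
qed

text \<open>Let \<open>u\<close> be the truncated inverse of \<open>Q'\<close> applied to \<open>g\<close>, and \<open>v\<close> the truncated inverse applied to \<open>u\<close>.
  Then \<open>\<parallel>u\<parallel>\<^sup>2 = g \<bullet> v\<close>, and the Cauchy-Schwarz inequality with weights \<open>\<kappa> k + \<kappa> m\<close> separates the energy of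
  \<open>g\<close>, measured in the basis \<open>e\<close>, from \<open>Q v v + \<kappa> m \<parallel>v\<parallel>\<^sup>2\<close>. The latter is compared with
  \<open>Q' v v\<close>, which is explicit. Treating the first \<open>m\<close> empirical directions together is essential: estimating
  them one at a time would lose a factor \<open>m\<close>.\<close>

theorem truncated_inverse_bound:
  assumes Q: "diagonalised_by Q \<kappa> e" and Q': "diagonalised_by Q' \<kappa>' e'"
    and D: "\<And>x. \<bar>Q x x - Q' x x\<bar> \<le> D * (norm x)\<^sup>2"
    and m: "m \<ge> 1" "\<kappa> m > 0" "D \<le> \<kappa> m / 2"
    and s: "\<And>N. (\<Sum>k=1..N. (g \<bullet> e k)\<^sup>2 / (\<kappa> k + \<kappa> m)) \<le> s"
  shows "(\<Sum>k=1..m. ((g \<bullet> e' k) / \<kappa>' k)\<^sup>2) \<le> 8 / \<kappa> m * s"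
proof -
  note e = diagonalised_byD(1)[OF Q] and e' = diagonalised_byD(1)[OF Q']
  have D': "\<bar>Q' x x - Q x x\<bar> \<le> D * (norm x)\<^sup>2" for x
    using D[of x] by (simp add: abs_minus_commute)
  have ev: "\<kappa>' k \<ge> \<kappa> m / 2" if "k \<in> {1..m}" for k
    using eigenvalue_perturbation[OF Q' Q D' m(1)] m(3) diagonalised_byD(3)[OF Q', of k m] that by auto
  \<comment> \<open>\<open>u\<close> stands for the squared norm of the vector called \<open>u\<close> above\<close>
  define f where "f k = (g \<bullet> e' k) / \<kappa>' k" for k
  define u where "u = (\<Sum>k=1..m. (f k)\<^sup>2)"
  define v where "v = (\<Sum>k=1..m. (f k / \<kappa>' k) *\<^sub>R e' k)"
  note vs = inner_orthonormal_combination[OF e', of "{1..m}", where c="\<lambda>k. f k / \<kappa>' k", folded v_def]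
  have s0: "0 \<le> s" using s[of 0] by simp
  have pos: "\<kappa>' k > 0" if "k \<in> {1..m}" for k using ev[OF that] m(2) by simp
  have u: "u = g \<bullet> v"
    unfolding u_def vs(3)[OF finite_atLeastAtMost, of g, simplified] f_def
    using pos by (intro sum.cong) (auto simp: power2_eq_square)
  have Q'v: "Q' v v = (\<Sum>k=1..m. (f k)\<^sup>2 / \<kappa>' k)"
  proof -
    have "Q' v v = (\<Sum>k=1..m. \<kappa>' k * ((v \<bullet> e' k) * (v \<bullet> e' k)))"
      by (intro diagonalised_finite[OF Q']) (auto intro!: vs(2))
    also have "\<dots> = (\<Sum>k=1..m. (f k)\<^sup>2 / \<kappa>' k)"
      using pos by (intro sum.cong) (auto simp: vs(1) power2_eq_square field_simps)
    finally show ?thesis .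
  qed
  have nv: "(norm v)\<^sup>2 = (\<Sum>k=1..m. (f k)\<^sup>2 / (\<kappa>' k)\<^sup>2)"
    using vs(4) by (simp add: power_divide)
  have qv: "Q v v + \<kappa> m * (norm v)\<^sup>2 \<le> 8 / \<kappa> m * u"
  proof -
    have "Q v v + \<kappa> m * (norm v)\<^sup>2 \<le> Q' v v + D * (norm v)\<^sup>2 + \<kappa> m * (norm v)\<^sup>2"
      using D[of v] by (simp add: abs_le_iff)
    also have "\<dots> \<le> Q' v v + (3/2 * \<kappa> m) * (norm v)\<^sup>2"
      using mult_right_mono[OF m(3), of "(norm v)\<^sup>2"] by (simp add: algebra_simps)
    also have "\<dots> = (\<Sum>k=1..m. (f k)\<^sup>2 / \<kappa>' k + (3/2 * \<kappa> m) * ((f k)\<^sup>2 / (\<kappa>' k)\<^sup>2))"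
      unfolding Q'v nv by (simp add: sum.distrib sum_distrib_left)
    also have "\<dots> \<le> (\<Sum>k=1..m. 8 / \<kappa> m * (f k)\<^sup>2)"
    proof (rule sum_mono)
      fix k assume k: "k \<in> {1..m}"
      have i: "1 / \<kappa>' k \<le> 2 / \<kappa> m"
        using ev[OF k] m(2) pos[OF k] by (simp add: field_simps)
      have "(1 / \<kappa>' k)\<^sup>2 \<le> (2 / \<kappa> m)\<^sup>2"
        using i pos[OF k] by (intro power_mono) auto
      then have "(3/2 * \<kappa> m) * (1 / (\<kappa>' k)\<^sup>2) \<le> (3/2 * \<kappa> m) * (4 / (\<kappa> m)\<^sup>2)"
        using m(2) by (intro mult_left_mono) (auto simp: power_divide)
      also have "\<dots> = 6 / \<kappa> m" using m(2) by (simp add: power2_eq_square)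
      finally have "1 / \<kappa>' k + (3/2 * \<kappa> m) * (1 / (\<kappa>' k)\<^sup>2) \<le> 8 / \<kappa> m"
        using i by simp
      then have "(f k)\<^sup>2 * (1 / \<kappa>' k + (3/2 * \<kappa> m) * (1 / (\<kappa>' k)\<^sup>2)) \<le> (f k)\<^sup>2 * (8 / \<kappa> m)"
        by (intro mult_left_mono) auto
      then show "(f k)\<^sup>2 / \<kappa>' k + (3/2 * \<kappa> m) * ((f k)\<^sup>2 / (\<kappa>' k)\<^sup>2) \<le> 8 / \<kappa> m * (f k)\<^sup>2"
        by (simp add: algebra_simps)
    qed
    also have "\<dots> = 8 / \<kappa> m * u"
      by (simp add: u_def sum_distrib_left)
    finally show ?thesis .
  qed
  have "u\<^sup>2 \<le> s * (Q v v + \<kappa> m * (norm v)\<^sup>2)"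
  proof (rule LIMSEQ_le)
    show "(\<lambda>N. (\<Sum>k=1..N. (g \<bullet> e k) * (v \<bullet> e k))\<^sup>2) \<longlonglongrightarrow> u\<^sup>2"
      unfolding u by (intro tendsto_intros parseval e)
    show "(\<lambda>N. s * ((\<Sum>k=1..N. \<kappa> k * ((v \<bullet> e k) * (v \<bullet> e k))) + \<kappa> m * (\<Sum>k=1..N. (v \<bullet> e k)\<^sup>2)))
        \<longlonglongrightarrow> s * (Q v v + \<kappa> m * (norm v)\<^sup>2)"
      by (intro tendsto_intros parseval_norm e diagonalised_byD(4)[OF Q])
    have "(\<Sum>k=1..N. (g \<bullet> e k) * (v \<bullet> e k))\<^sup>2
        \<le> s * ((\<Sum>k=1..N. \<kappa> k * ((v \<bullet> e k) * (v \<bullet> e k))) + \<kappa> m * (\<Sum>k=1..N. (v \<bullet> e k)\<^sup>2))" for N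
    proof -
      have p: "\<kappa> k + \<kappa> m > 0" if "k \<in> {1..N}" for k
        using diagonalised_byD(2)[OF Q, of k] m that by auto
      have "(\<Sum>k=1..N. (g \<bullet> e k) * (v \<bullet> e k))
          = (\<Sum>k=1..N. ((g \<bullet> e k) / sqrt (\<kappa> k + \<kappa> m)) * (sqrt (\<kappa> k + \<kappa> m) * (v \<bullet> e k)))"
        using p by (intro sum.cong) (auto simp: less_imp_neq[symmetric])
      also have "(\<dots>)\<^sup>2 \<le> (\<Sum>k=1..N. ((g \<bullet> e k) / sqrt (\<kappa> k + \<kappa> m))\<^sup>2)
          * (\<Sum>k=1..N. (sqrt (\<kappa> k + \<kappa> m) * (v \<bullet> e k))\<^sup>2)"
        by (rule Cauchy_Schwarz_ineq_sum)
      also have "(\<Sum>k=1..N. ((g \<bullet> e k) / sqrt (\<kappa> k + \<kappa> m))\<^sup>2) = (\<Sum>k=1..N. (g \<bullet> e k)\<^sup>2 / (\<kappa> k + \<kappa> m))"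
        using p by (intro sum.cong) (auto simp: power_divide less_imp_le)
      also have "(\<Sum>k=1..N. (sqrt (\<kappa> k + \<kappa> m) * (v \<bullet> e k))\<^sup>2) = (\<Sum>k=1..N. (\<kappa> k + \<kappa> m) * (v \<bullet> e k)\<^sup>2)"
        using p by (intro sum.cong) (auto simp: power_mult_distrib less_imp_le)
      also have "\<dots> = (\<Sum>k=1..N. \<kappa> k * ((v \<bullet> e k) * (v \<bullet> e k))) + \<kappa> m * (\<Sum>k=1..N. (v \<bullet> e k)\<^sup>2)"
        by (simp add: algebra_simps sum.distrib sum_distrib_left power2_eq_square)
      also have "(\<Sum>k=1..N. (g \<bullet> e k)\<^sup>2 / (\<kappa> k + \<kappa> m)) * \<dots> \<le> s * \<dots>"
        using diagonalised_byD(2)[OF Q] m(2)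
        by (intro mult_right_mono s add_nonneg_nonneg sum_nonneg zero_le_square mult_nonneg_nonneg) auto
      finally show ?thesis .
    qed
    then show "\<exists>N0. \<forall>N\<ge>N0. (\<Sum>k=1..N. (g \<bullet> e k) * (v \<bullet> e k))\<^sup>2
        \<le> s * ((\<Sum>k=1..N. \<kappa> k * ((v \<bullet> e k) * (v \<bullet> e k))) + \<kappa> m * (\<Sum>k=1..N. (v \<bullet> e k)\<^sup>2))"
      by blast
  qed
  also have "\<dots> \<le> s * (8 / \<kappa> m * u)"
    by (intro mult_left_mono qv s0)
  finally have "u * u \<le> (8 / \<kappa> m * s) * u"
    by (simp add: power2_eq_square algebra_simps)
  moreover have "0 \<le> u" by (simp add: u_def sum_nonneg)
  ultimately have "u \<le> 8 / \<kappa> m * s"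
    using s0 m(2) mult_right_le_imp_le[of u u "8 / \<kappa> m * s"] by (cases "u = 0") auto
  then show ?thesis by (simp add: u_def f_def)
qed

text \<open>Let \<open>w\<close> be the part of \<open>e l\<close> outside the span of \<open>e' 1, \<dots>, e' m\<close>. On the pair \<open>(e l, w)\<close> the form \<open>Q\<close>
  takes the value \<open>\<kappa> l \<parallel>w\<parallel>\<^sup>2\<close>, whereas \<open>Q'\<close> does not exceed \<open>\<kappa>' (m + 1) \<parallel>w\<parallel>\<^sup>2\<close>; the two values differ by
  at most \<open>D \<parallel>w\<parallel>\<close>, so \<open>\<parallel>w\<parallel>\<close> is small when the gap is large.\<close>

theorem eigenvector_leakage:
  assumes Q: "diagonalised_by Q \<kappa> e" and Q': "diagonalised_by Q' \<kappa>' e'"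
    and D: "\<And>x y. \<bar>Q x y - Q' x y\<bar> \<le> D * norm x * norm y"
    and l: "1 \<le> l" "l \<le> m" and gap: "D \<le> (\<kappa> m - \<kappa> (Suc m)) / 2" "\<kappa> (Suc m) < \<kappa> m"
    and A: "finite A" "A \<subseteq> {m<..}"
  shows "(\<Sum>j\<in>A. (e l \<bullet> e' j)\<^sup>2) \<le> (2 * D / (\<kappa> l - \<kappa> (Suc m)))\<^sup>2"
proof -
  note e = diagonalised_byD(1)[OF Q] and e' = diagonalised_byD(1)[OF Q']
  define w where "w = e l - (\<Sum>j=1..m. (e l \<bullet> e' j) *\<^sub>R e' j)"
  have w0: "w \<bullet> e' j = 0" if "1 \<le> j" "j \<le> m" for j
    using that inner_orthonormal_combination(1)[OF e', of "{1..m}" j] by (auto simp: w_def inner_diff_left)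
  have w1: "w \<bullet> e' j = e l \<bullet> e' j" if "j > m" for j
    using that inner_orthonormal_combination(2)[OF e', of "{1..m}" j] by (auto simp: w_def inner_diff_left)
  have wl: "e l \<bullet> w = (norm w)\<^sup>2"
  proof -
    have "w \<bullet> (\<Sum>j=1..m. (e l \<bullet> e' j) *\<^sub>R e' j) = 0"
      using w0 by (simp add: inner_sum_right)
    then have "w \<bullet> w = w \<bullet> e l"
      using w_def by (metis inner_diff_right diff_zero)
    then show ?thesis by (simp add: power2_norm_eq_inner inner_commute)
  qed
  have ge: "\<kappa> m \<le> \<kappa> l" using diagonalised_byD(3)[OF Q] l by auto
  have nl: "norm (e l) = 1"
    using orthonormal_basis_inner[OF e, of l l] l by (simp add: norm_eq_sqrt_inner)
  have D0: "0 \<le> D"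
    using D[of "e l" "e l"] nl by simp
  have "Q (e l) w = (\<Sum>k\<in>{l}. \<kappa> k * ((e l \<bullet> e k) * (w \<bullet> e k)))"
    using l by (intro diagonalised_finite[OF Q]) (auto simp: orthonormal_basis_inner[OF e])
  then have Qw: "Q (e l) w = \<kappa> l * (norm w)\<^sup>2"
    using l wl by (simp add: orthonormal_basis_inner[OF e] inner_commute)
  have "(\<lambda>N. \<Sum>k=1..N. \<kappa>' k * ((e l \<bullet> e' k) * (w \<bullet> e' k))) \<longlonglongrightarrow> Q' w (e l)"
    using diagonalised_byD(4)[OF Q', of w "e l"] by (simp add: mult.commute)
  then have sym: "Q' (e l) w = Q' w (e l)"
    using diagonalised_byD(4)[OF Q', of "e l" w] LIMSEQ_unique by blast
  have "Q' w (e l) \<le> \<kappa>' (Suc m) * (norm w)\<^sup>2"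
    using w0 w1 by (intro diagonalised_upper[OF Q']) auto
  also have "\<kappa>' (Suc m) \<le> \<kappa> (Suc m) + D"
    using D by (intro eigenvalue_perturbation[OF Q Q']) (auto simp: power2_eq_square mult.assoc)
  finally have "Q' w (e l) \<le> (\<kappa> (Suc m) + D) * (norm w)\<^sup>2"
    by (simp add: mult_right_mono)
  then have "(\<kappa> l - \<kappa> (Suc m) - D) * (norm w)\<^sup>2 \<le> D * norm w"
    using D[of "e l" w] Qw sym nl by (simp add: algebra_simps abs_le_iff)
  moreover have "(\<kappa> l - \<kappa> (Suc m)) / 2 * (norm w)\<^sup>2 \<le> (\<kappa> l - \<kappa> (Suc m) - D) * (norm w)\<^sup>2"
    using gap ge by (intro mult_right_mono) auto
  ultimately have "((\<kappa> l - \<kappa> (Suc m)) / 2 * norm w) * norm w \<le> D * norm w"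
    by (simp add: power2_eq_square)
  then have "(\<kappa> l - \<kappa> (Suc m)) / 2 * norm w \<le> D"
    using D0 by (cases "w = 0") (auto simp: mult_le_cancel_right)
  then have "norm w \<le> 2 * D / (\<kappa> l - \<kappa> (Suc m))"
    using gap ge by (simp add: field_simps)
  then have "(norm w)\<^sup>2 \<le> (2 * D / (\<kappa> l - \<kappa> (Suc m)))\<^sup>2"
    by (intro power_mono) auto
  moreover have "(\<Sum>j\<in>A. (e l \<bullet> e' j)\<^sup>2) = (\<Sum>j\<in>A. (w \<bullet> e' j)\<^sup>2)"
    using A w1 by (intro sum.cong) auto
  moreover have "\<dots> \<le> (norm w)\<^sup>2"
    using A by (intro bessel e') auto
  ultimately show ?thesis by linarith
qed

text \<open>The components of \<open>g\<close> beyond \<open>m\<close> in the basis \<open>e'\<close> come from those beyond \<open>m\<close> in the basis \<open>e\<close>, and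
  from the leakage of each \<open>e l\<close> with \<open>l \<le> m\<close>.\<close>

theorem projection_tail_bound:
  assumes Q: "diagonalised_by Q \<kappa> e" and Q': "diagonalised_by Q' \<kappa>' e'"
    and D: "\<And>x y. \<bar>Q x y - Q' x y\<bar> \<le> D * norm x * norm y" "0 \<le> D"
    and gap: "D \<le> (\<kappa> m - \<kappa> (Suc m)) / 2" "\<kappa> (Suc m) < \<kappa> m"
    and A: "finite A" "A \<subseteq> {m<..}"
    and a: "\<And>l. l \<ge> 1 \<Longrightarrow> \<bar>g \<bullet> e l\<bar> \<le> a l" and t: "\<And>N. (\<Sum>l=Suc m..N. (a l)\<^sup>2) \<le> t"
  shows "(\<Sum>j\<in>A. (g \<bullet> e' j)\<^sup>2) \<le> 2 * (\<Sum>l=1..m. a l * (2 * D / (\<kappa> l - \<kappa> (Suc m))))\<^sup>2 + 2 * t"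
proof -
  note e = diagonalised_byD(1)[OF Q] and e' = diagonalised_byD(1)[OF Q']
  define P where "P x = (\<Sum>j\<in>A. (x \<bullet> e' j) *\<^sub>R e' j)" for x
  have A1: "A \<subseteq> {1..}" using A by auto
  have P2: "(norm (P x))\<^sup>2 = (\<Sum>j\<in>A. (x \<bullet> e' j)\<^sup>2)" for x
    unfolding P_def by (rule inner_orthonormal_combination(4)[OF e' A(1) A1])
  have lin: "linear P"
    by (rule linearI) (auto simp: P_def inner_add_left scaleR_add_left sum.distrib scaleR_sum_right)
  define r where "r = g - (\<Sum>l=1..m. (g \<bullet> e l) *\<^sub>R e l)"
  have r0: "r \<bullet> e l = 0" if "1 \<le> l" "l \<le> m" for l
    using that inner_orthonormal_combination(1)[OF e, of "{1..m}" l] by (auto simp: r_def inner_diff_left)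
  have r1: "r \<bullet> e l = g \<bullet> e l" if "l > m" for l
    using that inner_orthonormal_combination(2)[OF e, of "{1..m}" l] by (auto simp: r_def inner_diff_left)
  have "(norm r)\<^sup>2 \<le> t"
  proof (rule LIMSEQ_le_const2[OF parseval_norm[OF e]], intro exI[of _ 0] allI impI)
    fix N :: nat
    have "(\<Sum>l=1..N. (r \<bullet> e l)\<^sup>2) = (\<Sum>l\<in>{Suc m..N}. (r \<bullet> e l)\<^sup>2)"
      using r0 by (intro sum.mono_neutral_right) auto
    also have "\<dots> \<le> (\<Sum>l=Suc m..N. (a l)\<^sup>2)"
    proof (rule sum_mono)
      fix l assume "l \<in> {Suc m..N}"
      then show "(r \<bullet> e l)\<^sup>2 \<le> (a l)\<^sup>2"
        using a[of l] r1[of l] by (simp add: abs_le_square_iff[symmetric])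
    qed
    also have "\<dots> \<le> t" by (rule t)
    finally show "(\<Sum>l=1..N. (r \<bullet> e l)\<^sup>2) \<le> t" .
  qed
  moreover have "(norm (P r))\<^sup>2 \<le> (norm r)\<^sup>2"
    unfolding P2 by (rule bessel[OF e' A(1) A1])
  ultimately have Pr: "(norm (P r))\<^sup>2 \<le> t" by linarith
  have Pe: "norm (P (e l)) \<le> 2 * D / (\<kappa> l - \<kappa> (Suc m))" if "l \<in> {1..m}" for l
  proof (rule power2_le_imp_le)
    show "(norm (P (e l)))\<^sup>2 \<le> (2 * D / (\<kappa> l - \<kappa> (Suc m)))\<^sup>2"
      unfolding P2 using that by (intro eigenvector_leakage[OF Q Q' D(1) _ _ gap A]) auto
    have "\<kappa> m \<le> \<kappa> l" using diagonalised_byD(3)[OF Q] that by auto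
    then show "0 \<le> 2 * D / (\<kappa> l - \<kappa> (Suc m))" using D(2) gap by simp
  qed
  define h where "h = (\<Sum>l=1..m. (g \<bullet> e l) *\<^sub>R e l)"
  have "P h = (\<Sum>l=1..m. (g \<bullet> e l) *\<^sub>R P (e l))"
    unfolding h_def by (simp add: linear_sum[OF lin] linear_cmul[OF lin])
  then have "norm (P h) \<le> (\<Sum>l=1..m. \<bar>g \<bullet> e l\<bar> * norm (P (e l)))"
    using norm_sum[of "\<lambda>l. (g \<bullet> e l) *\<^sub>R P (e l)" "{1..m}"] by simp
  also have "\<dots> \<le> (\<Sum>l=1..m. a l * (2 * D / (\<kappa> l - \<kappa> (Suc m))))"
  proof (rule sum_mono)
    fix l assume l: "l \<in> {1..m}"
    then show "\<bar>g \<bullet> e l\<bar> * norm (P (e l)) \<le> a l * (2 * D / (\<kappa> l - \<kappa> (Suc m)))"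
      using a[of l] Pe[OF l] by (intro mult_mono) auto
  qed
  finally have Ph: "(norm (P h))\<^sup>2 \<le> (\<Sum>l=1..m. a l * (2 * D / (\<kappa> l - \<kappa> (Suc m))))\<^sup>2"
    by (intro power_mono) auto
  have "P g = P h + P r"
    by (simp add: linear_add[OF lin, symmetric] r_def h_def)
  then have "(norm (P g))\<^sup>2 \<le> 2 * (norm (P h))\<^sup>2 + 2 * (norm (P r))\<^sup>2"
    by (simp only: norm_add_square_le)
  then show ?thesis
    using Ph Pr P2[of g] by linarith
qed

section \<open>Square-integrable functions\<close>

lemma L2_measurable: "f \<in> L2 M \<Longrightarrow> f \<in> borel_measurable M"
  by (simp add: L2_def)

lemma L2_square_integrable: "f \<in> L2 M \<Longrightarrow> integrable M (\<lambda>x. (f x)\<^sup>2)"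
  by (simp add: L2_def)

lemma L2_mult_integrable:
  assumes f: "f \<in> L2 M" and g: "g \<in> L2 M"
  shows "integrable M (\<lambda>x. f x * g x)"
proof (rule Bochner_Integration.integrable_bound)
  show "integrable M (\<lambda>x. (f x)\<^sup>2 + (g x)\<^sup>2)"
    using f g by (auto intro: L2_square_integrable)
  show "(\<lambda>x. f x * g x) \<in> borel_measurable M"
    using f g by (intro borel_measurable_times L2_measurable)
  have "\<bar>a * b\<bar> \<le> a\<^sup>2 + b\<^sup>2" for a b :: real
    using sum_squares_bound[of "\<bar>a\<bar>" "\<bar>b\<bar>"] mult_nonneg_nonneg[OF abs_ge_zero[of a] abs_ge_zero[of b]]
    unfolding abs_mult power2_abs by linarith
  then show "AE x in M. norm (f x * g x) \<le> norm ((f x)\<^sup>2 + (g x)\<^sup>2)"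
    by simp
qed

lemma L2_add: "f \<in> L2 M \<Longrightarrow> g \<in> L2 M \<Longrightarrow> (\<lambda>x. f x + g x) \<in> L2 M"
  using L2_mult_integrable[of f M g] by (auto simp: L2_def power2_sum mult.assoc)

lemma L2_cmult: "f \<in> L2 M \<Longrightarrow> (\<lambda>x. c * f x) \<in> L2 M"
  by (auto simp: L2_def power_mult_distrib)

lemma L2_diff: "f \<in> L2 M \<Longrightarrow> g \<in> L2 M \<Longrightarrow> (\<lambda>x. f x - g x) \<in> L2 M"
  using L2_mult_integrable[of f M g] by (auto simp: L2_def power2_diff mult.assoc)

lemma L2_zero: "(\<lambda>x. 0) \<in> L2 M"
  by (simp add: L2_def)

lemma L2_sum: "(\<And>i. i \<in> A \<Longrightarrow> f i \<in> L2 M) \<Longrightarrow> (\<lambda>x. \<Sum>i\<in>A. f i x) \<in> L2 M"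
  by (induction A rule: infinite_finite_induct) (auto intro: L2_zero L2_add)

lemma L2_cong_AE:
  "f \<in> L2 M \<Longrightarrow> g \<in> borel_measurable M \<Longrightarrow> AE x in M. f x = g x \<Longrightarrow> g \<in> L2 M"
  unfolding L2_def by (auto elim!: integrable_cong_AE_imp elim: eventually_mono)

lemma (in finite_measure) L2_const: "(\<lambda>x. c) \<in> L2 M"
  by (simp add: L2_def)

lemma (in finite_measure) L2_integrable: "f \<in> L2 M \<Longrightarrow> integrable M f"
  using L2_mult_integrable[OF _ L2_const[of 1], of f] by simp

lemma L2_Cauchy_Schwarz:
  assumes f: "f \<in> L2 M" and g: "g \<in> L2 M"
  shows "(\<integral>x. f x * g x \<partial>M)\<^sup>2 \<le> (\<integral>x. (f x)\<^sup>2 \<partial>M) * (\<integral>x. (g x)\<^sup>2 \<partial>M)"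
proof -
  define F G a where "F = (\<integral>x. (f x)\<^sup>2 \<partial>M)" and "G = (\<integral>x. (g x)\<^sup>2 \<partial>M)" and "a = (\<integral>x. f x * g x \<partial>M)"
  note [simp] = L2_square_integrable[OF f] L2_square_integrable[OF g] L2_mult_integrable[OF f g]
  have [measurable]: "f \<in> borel_measurable M" "g \<in> borel_measurable M"
    using f g by (auto dest: L2_measurable)
  have G0: "0 \<le> G" by (simp add: G_def)
  show ?thesis
  proof (cases "G = 0")
    case True
    then have "AE x in M. (g x)\<^sup>2 = 0"
      unfolding G_def by (subst (asm) integral_nonneg_eq_0_iff_AE) auto
    then have "a = (\<integral>x. 0 \<partial>M)"
      unfolding a_def by (intro integral_cong_AE) auto
    then show ?thesis using True by (simp add: a_def G_def)
  next
    case False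
    have "0 \<le> (\<integral>x. (G * f x - a * g x)\<^sup>2 \<partial>M)" by simp
    also have "\<dots> = (\<integral>x. (G\<^sup>2 * (f x)\<^sup>2 - (2 * G * a) * (f x * g x)) + a\<^sup>2 * (g x)\<^sup>2 \<partial>M)"
      by (intro Bochner_Integration.integral_cong) (auto simp: power2_eq_square algebra_simps)
    also have "\<dots> = G\<^sup>2 * F - (2 * G * a) * a + a\<^sup>2 * G"
      by (simp add: F_def G_def a_def)
    also have "\<dots> = G * (F * G - a\<^sup>2)"
      by (simp add: power2_eq_square algebra_simps)
    finally have "a\<^sup>2 \<le> F * G"
      using False G0 by (simp add: zero_le_mult_iff)
    then show ?thesis by (simp add: F_def G_def a_def)
  qed
qed

lemma (in pair_sigma_finite) L2_tensor:
  assumes f: "f \<in> L2 M1" and g: "g \<in> L2 M2"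
  shows "(\<lambda>(s, t). f s * g t) \<in> L2 (M1 \<Otimes>\<^sub>M M2)"
proof -
  have [measurable]: "f \<in> borel_measurable M1" "g \<in> borel_measurable M2"
    using f g by (auto dest: L2_measurable)
  have "integrable (M1 \<Otimes>\<^sub>M M2) (\<lambda>(s, t). (f s)\<^sup>2 * (g t)\<^sup>2)"
  proof (rule Fubini_integrable)
    show "integrable M1 (\<lambda>s. \<integral>t. norm (case (s, t) of (s, t) \<Rightarrow> (f s)\<^sup>2 * (g t)\<^sup>2) \<partial>M2)"
      using L2_square_integrable[OF f] by (simp add: abs_mult)
  qed (use L2_square_integrable[OF g] in auto)
  then show ?thesis
    by (simp add: L2_def case_prod_beta' power_mult_distrib)
qed

text \<open>The two integral operators defined by a kernel are adjoint to each other. With a probability space in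
  place of one of the intervals, this is also the form in which expectation and integration over
  \<open>t\<close> are interchanged.\<close>

lemma (in pair_sigma_finite) L2_kernel:
  assumes h: "(\<lambda>(s, t). h s t) \<in> L2 (M1 \<Otimes>\<^sub>M M2)" and f: "f \<in> L2 M1" and g: "g \<in> L2 M2"
  shows "(\<lambda>t. \<integral>s. h s t * f s \<partial>M1) \<in> L2 M2"
    and "(\<lambda>s. \<integral>t. h s t * g t \<partial>M2) \<in> L2 M1"
    and "(\<integral>(s, t). h s t * f s * g t \<partial>(M1 \<Otimes>\<^sub>M M2)) = L2_inner M2 (\<lambda>t. \<integral>s. h s t * f s \<partial>M1) g"
    and "(\<integral>(s, t). h s t * f s * g t \<partial>(M1 \<Otimes>\<^sub>M M2)) = L2_inner M1 (\<lambda>s. \<integral>t. h s t * g t \<partial>M2) f"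
    and "AE s in M1. (\<lambda>t. h s t) \<in> L2 M2"
    and "AE t in M2. (\<lambda>s. h s t) \<in> L2 M1"
proof -
  have hm[measurable]: "(\<lambda>(s, t). h s t) \<in> borel_measurable (M1 \<Otimes>\<^sub>M M2)"
    using h by (rule L2_measurable)
  have [measurable]: "f \<in> borel_measurable M1" "g \<in> borel_measurable M2"
    using f g by (auto dest: L2_measurable)
  have h2: "integrable (M1 \<Otimes>\<^sub>M M2) (\<lambda>(s, t). (h s t)\<^sup>2)"
    using L2_square_integrable[OF h] by (simp add: case_prod_beta')
  show sec1: "AE s in M1. (\<lambda>t. h s t) \<in> L2 M2"
    using AE_integrable_fst[OF h2] AE_space
    by eventually_elim (auto simp: L2_def)
  show sec2: "AE t in M2. (\<lambda>s. h s t) \<in> L2 M1"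
    using AE_integrable_snd[OF h2] AE_space
    by eventually_elim (auto simp: L2_def)
  show "(\<lambda>t. \<integral>s. h s t * f s \<partial>M1) \<in> L2 M2"
  proof -
    have m: "(\<lambda>t. \<integral>s. h s t * f s \<partial>M1) \<in> borel_measurable M2"
      by measurable
    have "integrable M2 (\<lambda>t. (\<integral>s. h s t * f s \<partial>M1)\<^sup>2)"
    proof (rule Bochner_Integration.integrable_bound)
      show "integrable M2 (\<lambda>t. (\<integral>s. (h s t)\<^sup>2 \<partial>M1) * (\<integral>s. (f s)\<^sup>2 \<partial>M1))"
        using integrable_snd[OF h2] by simp
      show "AE t in M2. norm ((\<integral>s. h s t * f s \<partial>M1)\<^sup>2) \<le> norm ((\<integral>s. (h s t)\<^sup>2 \<partial>M1) * (\<integral>s. (f s)\<^sup>2 \<partial>M1))"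
        using sec2 by eventually_elim (use f L2_Cauchy_Schwarz in auto)
    qed (use m in auto)
    then show ?thesis using m by (simp add: L2_def)
  qed
  show "(\<lambda>s. \<integral>t. h s t * g t \<partial>M2) \<in> L2 M1"
  proof -
    have m: "(\<lambda>s. \<integral>t. h s t * g t \<partial>M2) \<in> borel_measurable M1"
      by measurable
    have "integrable M1 (\<lambda>s. (\<integral>t. h s t * g t \<partial>M2)\<^sup>2)"
    proof (rule Bochner_Integration.integrable_bound)
      show "integrable M1 (\<lambda>s. (\<integral>t. (h s t)\<^sup>2 \<partial>M2) * (\<integral>t. (g t)\<^sup>2 \<partial>M2))"
        using integrable_fst[OF h2] by simp
      show "AE s in M1. norm ((\<integral>t. h s t * g t \<partial>M2)\<^sup>2) \<le> norm ((\<integral>t. (h s t)\<^sup>2 \<partial>M2) * (\<integral>t. (g t)\<^sup>2 \<partial>M2))"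
        using sec1 by eventually_elim (use g L2_Cauchy_Schwarz in auto)
    qed (use m in auto)
    then show ?thesis using m by (simp add: L2_def)
  qed
  have int: "integrable (M1 \<Otimes>\<^sub>M M2) (\<lambda>(s, t). h s t * f s * g t)"
    using L2_mult_integrable[OF h L2_tensor[OF f g]] by (simp add: case_prod_beta' mult.assoc)
  show "(\<integral>(s, t). h s t * f s * g t \<partial>(M1 \<Otimes>\<^sub>M M2)) = L2_inner M2 (\<lambda>t. \<integral>s. h s t * f s \<partial>M1) g"
    using integral_snd[OF int] by (simp add: L2_inner_def)
  have "(\<integral>s. \<integral>t. h s t * f s * g t \<partial>M2 \<partial>M1) = (\<integral>s. (\<integral>t. h s t * g t \<partial>M2) * f s \<partial>M1)"
  proof (intro Bochner_Integration.integral_cong refl)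
    fix s
    have "(\<integral>t. h s t * f s * g t \<partial>M2) = (\<integral>t. (h s t * g t) * f s \<partial>M2)"
      by (simp add: mult_ac)
    then show "(\<integral>t. h s t * f s * g t \<partial>M2) = (\<integral>t. h s t * g t \<partial>M2) * f s"
      by simp
  qed
  then show "(\<integral>(s, t). h s t * f s * g t \<partial>(M1 \<Otimes>\<^sub>M M2)) = L2_inner M1 (\<lambda>s. \<integral>t. h s t * g t \<partial>M2) f"
    using integral_fst[OF int] by (simp add: L2_inner_def)
qed

lemma (in pair_sigma_finite) L2_kernel_norm_le:
  assumes h: "(\<lambda>(s, t). h s t) \<in> L2 (M1 \<Otimes>\<^sub>M M2)" and g: "g \<in> L2 M2"
  shows "(\<integral>s. (\<integral>t. h s t * g t \<partial>M2)\<^sup>2 \<partial>M1) \<le> (\<integral>(s, t). (h s t)\<^sup>2 \<partial>(M1 \<Otimes>\<^sub>M M2)) * (\<integral>t. (g t)\<^sup>2 \<partial>M2)"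
proof -
  have h2: "integrable (M1 \<Otimes>\<^sub>M M2) (\<lambda>(s, t). (h s t)\<^sup>2)"
    using L2_square_integrable[OF h] by (simp add: case_prod_beta')
  have "(\<integral>s. (\<integral>t. h s t * g t \<partial>M2)\<^sup>2 \<partial>M1) \<le> (\<integral>s. (\<integral>t. (h s t)\<^sup>2 \<partial>M2) * (\<integral>t. (g t)\<^sup>2 \<partial>M2) \<partial>M1)"
  proof (rule integral_mono_AE)
    show "integrable M1 (\<lambda>s. (\<integral>t. h s t * g t \<partial>M2)\<^sup>2)"
      by (rule L2_square_integrable[OF L2_kernel(2)[OF h L2_zero g]])
    show "integrable M1 (\<lambda>s. (\<integral>t. (h s t)\<^sup>2 \<partial>M2) * (\<integral>t. (g t)\<^sup>2 \<partial>M2))"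
      using integrable_fst[OF h2] by simp
    show "AE s in M1. (\<integral>t. h s t * g t \<partial>M2)\<^sup>2 \<le> (\<integral>t. (h s t)\<^sup>2 \<partial>M2) * (\<integral>t. (g t)\<^sup>2 \<partial>M2)"
      using L2_kernel(5)[OF h L2_zero g] by eventually_elim (rule L2_Cauchy_Schwarz[OF _ g])
  qed
  also have "\<dots> = (\<integral>(s, t). (h s t)\<^sup>2 \<partial>(M1 \<Otimes>\<^sub>M M2)) * (\<integral>t. (g t)\<^sup>2 \<partial>M2)"
    using integral_fst[OF h2] by simp
  finally show ?thesis .
qed

section \<open>The inner product space of square-integrable functions on the unit interval\<close>

lemma prob_space_unit_I: "prob_space unit_I"
  by (rule prob_space_restrict_space) auto

interpretation unit_I: prob_space unit_I
  by (rule prob_space_unit_I)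

interpretation unit_I2: pair_prob_space unit_I unit_I ..

text \<open>Identifying functions that agree almost everywhere turns the seminorm into a norm, which makes the
  results on inner product spaces available.\<close>

definition L2_eq :: "(real \<Rightarrow> real) \<Rightarrow> (real \<Rightarrow> real) \<Rightarrow> bool" where
  "L2_eq f g \<longleftrightarrow> f \<in> L2 unit_I \<and> g \<in> L2 unit_I \<and> (AE t in unit_I. f t = g t)"

lemma L2_eqI:
  "f \<in> L2 unit_I \<Longrightarrow> g \<in> L2 unit_I \<Longrightarrow> (\<And>t. f t = g t) \<Longrightarrow> L2_eq f g"
  by (simp add: L2_eq_def)

lemma L2_eqD:
  assumes "L2_eq f g"
  shows "f \<in> L2 unit_I" "g \<in> L2 unit_I" "AE t in unit_I. f t = g t"
  using assms by (simp_all add: L2_eq_def)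

quotient_type l2 = "real \<Rightarrow> real" / partial: L2_eq
proof (rule part_equivpI)
  show "\<exists>f. L2_eq f f"
    by (intro exI[of _ "\<lambda>t. 0"] L2_eqI L2_zero) simp
  show "symp L2_eq"
    unfolding symp_def L2_eq_def by (simp add: eq_commute)
  show "transp L2_eq"
  proof (rule transpI)
    fix f g h assume "L2_eq f g" "L2_eq g h"
    note * = L2_eqD[OF this(1)] L2_eqD[OF this(2)]
    have "AE t in unit_I. f t = h t"
      using *(3,6) by eventually_elim simp
    then show "L2_eq f h" using * by (simp add: L2_eq_def)
  qed
qed

lemma L2_eq_combine:
  assumes "L2_eq f f'" "L2_eq g g'"
  shows "L2_eq (\<lambda>t. a * f t + c * g t) (\<lambda>t. a * f' t + c * g' t)"
    and "L2_inner unit_I f g = L2_inner unit_I f' g'"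
proof -
  note * = L2_eqD[OF assms(1)] L2_eqD[OF assms(2)]
  have "AE t in unit_I. a * f t + c * g t = a * f' t + c * g' t"
    using *(3,6) by eventually_elim simp
  then show "L2_eq (\<lambda>t. a * f t + c * g t) (\<lambda>t. a * f' t + c * g' t)"
    using * by (simp add: L2_eq_def L2_add L2_cmult)
  have "AE t in unit_I. f t * g t = f' t * g' t"
    using *(3,6) by eventually_elim simp
  then show "L2_inner unit_I f g = L2_inner unit_I f' g'"
    unfolding L2_inner_def using *(1,2,4,5)[THEN L2_measurable]
    by (intro integral_cong_AE) auto
qed

instantiation l2 :: real_inner
begin

lift_definition zero_l2 :: l2 is "\<lambda>t. 0"
  by (intro L2_eqI L2_zero) simp

lift_definition plus_l2 :: "l2 \<Rightarrow> l2 \<Rightarrow> l2" is "\<lambda>f g t. f t + g t"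
  using L2_eq_combine(1)[where a=1 and c=1] by simp

lift_definition minus_l2 :: "l2 \<Rightarrow> l2 \<Rightarrow> l2" is "\<lambda>f g t. f t - g t"
  using L2_eq_combine(1)[where a=1 and c="-1"] by simp

lift_definition scaleR_l2 :: "real \<Rightarrow> l2 \<Rightarrow> l2" is "\<lambda>c f t. c * f t"
  using L2_eq_combine(1)[where c=0] by simp

lift_definition inner_l2 :: "l2 \<Rightarrow> l2 \<Rightarrow> real" is "L2_inner unit_I"
  by (rule L2_eq_combine(2))

definition uminus_l2 :: "l2 \<Rightarrow> l2" where "uminus_l2 x = (-1) *\<^sub>R x"
definition norm_l2 :: "l2 \<Rightarrow> real" where "norm_l2 x = sqrt (x \<bullet> x)"
definition dist_l2 :: "l2 \<Rightarrow> l2 \<Rightarrow> real" where "dist_l2 x y = norm (x - y)"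
definition sgn_l2 :: "l2 \<Rightarrow> l2" where "sgn_l2 x = inverse (norm x) *\<^sub>R x"
definition uniformity_l2 :: "(l2 \<times> l2) filter" where
  "uniformity_l2 = (INF e\<in>{0 <..}. principal {(x, y). dist x y < e})"
definition open_l2 :: "l2 set \<Rightarrow> bool" where
  "open_l2 S = (\<forall>x\<in>S. \<forall>\<^sub>F (x', y) in uniformity. x' = x \<longrightarrow> y \<in> S)"

instance
proof
  fix x y z :: l2 and a b :: real
  show "x + y + z = x + (y + z)"
    by transfer (intro L2_eqI L2_add, auto dest: L2_eqD)
  show "x + y = y + x"
    by transfer (intro L2_eqI L2_add, auto dest: L2_eqD)
  show "0 + x = x"
    by transfer (intro L2_eqI L2_add L2_zero, auto dest: L2_eqD)
  show "- x + x = 0"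
    unfolding uminus_l2_def
    by transfer (intro L2_eqI L2_add L2_cmult L2_zero, auto dest: L2_eqD)
  show "x - y = x + - y"
    unfolding uminus_l2_def
    by transfer (intro L2_eqI L2_add L2_diff L2_cmult, auto dest: L2_eqD)
  show "a *\<^sub>R (x + y) = a *\<^sub>R x + a *\<^sub>R y"
    by transfer (intro L2_eqI L2_add L2_cmult, auto dest: L2_eqD simp: distrib_left)
  show "(a + b) *\<^sub>R x = a *\<^sub>R x + b *\<^sub>R x"
    by transfer (intro L2_eqI L2_add L2_cmult, auto dest: L2_eqD simp: distrib_right)
  show "a *\<^sub>R b *\<^sub>R x = (a * b) *\<^sub>R x"
    by transfer (intro L2_eqI L2_cmult, auto dest: L2_eqD)
  show "1 *\<^sub>R x = x"
    by transfer (intro L2_eqI L2_cmult, auto dest: L2_eqD)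
  show "dist x y = norm (x - y)" by (simp add: dist_l2_def)
  show "sgn x = inverse (norm x) *\<^sub>R x" by (simp add: sgn_l2_def)
  show "uniformity = (INF e\<in>{0 <..}. principal {(x::l2, y). dist x y < e})"
    by (simp add: uniformity_l2_def)
  show "open U = (\<forall>x\<in>U. \<forall>\<^sub>F (x', y) in uniformity. x' = x \<longrightarrow> y \<in> U)" for U :: "l2 set"
    by (simp add: open_l2_def)
  show "x \<bullet> y = y \<bullet> x"
    by transfer (simp add: L2_inner_def mult.commute)
  show "(x + y) \<bullet> z = x \<bullet> z + y \<bullet> z"
    by transfer (simp add: L2_inner_def L2_eq_def distrib_right L2_mult_integrable)
  show "(a *\<^sub>R x) \<bullet> y = a * (x \<bullet> y)"
    by transfer (simp add: L2_inner_def mult.assoc)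
  show "0 \<le> x \<bullet> x"
    by transfer (simp add: L2_inner_def)
  show "norm x = sqrt (x \<bullet> x)"
    by (simp add: norm_l2_def)
  show "(x \<bullet> x = 0) = (x = 0)"
  proof transfer
    fix f assume "L2_eq f f"
    then have f: "f \<in> L2 unit_I" by (simp add: L2_eq_def)
    have "L2_inner unit_I f f = 0 \<longleftrightarrow> (AE t in unit_I. f t * f t = 0)"
      unfolding L2_inner_def using L2_mult_integrable[OF f f]
      by (subst integral_nonneg_eq_0_iff_AE) auto
    then show "(L2_inner unit_I f f = 0) = L2_eq f (\<lambda>t. 0)"
      using f by (simp add: L2_eq_def L2_zero)
  qed
qed

end

abbreviation cls :: "(real \<Rightarrow> real) \<Rightarrow> l2" where
  "cls \<equiv> abs_l2"

lemma L2_eq_refl [simp]: "f \<in> L2 unit_I \<Longrightarrow> L2_eq f f"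
  by (simp add: L2_eq_def)

lemma cls_surj: obtains f where "f \<in> L2 unit_I" "x = cls f"
  using Quotient_rep_reflp[OF Quotient_l2, of x] Quotient_abs_rep[OF Quotient_l2, of x]
  by (metis L2_eq_def)

lemma cls_eqI: "f \<in> L2 unit_I \<Longrightarrow> g \<in> L2 unit_I \<Longrightarrow> AE t in unit_I. f t = g t \<Longrightarrow> cls f = cls g"
  by (intro Quotient_rel_abs[OF Quotient_l2]) (simp add: L2_eq_def)

lemma cls_add: "f \<in> L2 unit_I \<Longrightarrow> g \<in> L2 unit_I \<Longrightarrow> cls (\<lambda>t. f t + g t) = cls f + cls g"
  by (simp add: plus_l2.abs_eq)

lemma cls_diff: "f \<in> L2 unit_I \<Longrightarrow> g \<in> L2 unit_I \<Longrightarrow> cls (\<lambda>t. f t - g t) = cls f - cls g"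
  by (simp add: minus_l2.abs_eq)

lemma cls_cmult: "f \<in> L2 unit_I \<Longrightarrow> cls (\<lambda>t. c * f t) = c *\<^sub>R cls f"
  by (simp add: scaleR_l2.abs_eq)

lemma cls_zero: "cls (\<lambda>t. 0) = 0"
  by (simp add: zero_l2.abs_eq)

lemma cls_sum: "(\<And>i. i \<in> A \<Longrightarrow> f i \<in> L2 unit_I) \<Longrightarrow> cls (\<lambda>t. \<Sum>i\<in>A. f i t) = (\<Sum>i\<in>A. cls (f i))"
  by (induction A rule: infinite_finite_induct) (auto simp: cls_zero cls_add L2_sum)

lemma cls_lincomb:
  assumes "\<And>i. i \<in> A \<Longrightarrow> f i \<in> L2 unit_I"
  shows "cls (\<lambda>t. \<Sum>i\<in>A. r i * f i t) = (\<Sum>i\<in>A. r i *\<^sub>R cls (f i))"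
proof -
  have "cls (\<lambda>t. \<Sum>i\<in>A. r i * f i t) = (\<Sum>i\<in>A. cls (\<lambda>t. r i * f i t))"
    using assms by (intro cls_sum L2_cmult)
  also have "\<dots> = (\<Sum>i\<in>A. r i *\<^sub>R cls (f i))"
    using assms by (intro sum.cong refl cls_cmult)
  finally show ?thesis .
qed

lemma inner_cls: "f \<in> L2 unit_I \<Longrightarrow> g \<in> L2 unit_I \<Longrightarrow> cls f \<bullet> cls g = L2_inner unit_I f g"
  by (simp add: inner_l2.abs_eq)

lemma norm_cls: "f \<in> L2 unit_I \<Longrightarrow> norm (cls f) = L2_norm unit_I f"
  by (simp add: norm_l2_def inner_cls L2_inner_def L2_norm_def power2_eq_square)

lemma L2_basisD:
  assumes "L2_basis \<phi>"
  shows "k \<ge> 1 \<Longrightarrow> \<phi> k \<in> L2 unit_I" and "orthonormal_basis (\<lambda>k. cls (\<phi> k))"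
proof -
  show L2: "k \<ge> 1 \<Longrightarrow> \<phi> k \<in> L2 unit_I" for k
    using assms by (simp add: L2_basis_def)
  have "(\<lambda>N. \<Sum>k=1..N. (x \<bullet> cls (\<phi> k)) *\<^sub>R cls (\<phi> k)) \<longlonglongrightarrow> x" for x
  proof (cases x rule: cls_surj)
    case (1 f)
    have "norm (x - (\<Sum>k=1..N. (x \<bullet> cls (\<phi> k)) *\<^sub>R cls (\<phi> k)))
        = L2_norm unit_I (\<lambda>t. f t - (\<Sum>k=1..N. L2_inner unit_I f (\<phi> k) * \<phi> k t))" for N
    proof -
      have "(\<Sum>k=1..N. (x \<bullet> cls (\<phi> k)) *\<^sub>R cls (\<phi> k)) = (\<Sum>k=1..N. cls (\<lambda>t. L2_inner unit_I f (\<phi> k) * \<phi> k t))"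
        using 1 L2 by (intro sum.cong) (auto simp: inner_cls cls_cmult)
      also have "\<dots> = cls (\<lambda>t. \<Sum>k=1..N. L2_inner unit_I f (\<phi> k) * \<phi> k t)"
        using L2 by (intro cls_sum[symmetric] L2_cmult) auto
      finally have "norm (x - (\<Sum>k=1..N. (x \<bullet> cls (\<phi> k)) *\<^sub>R cls (\<phi> k)))
          = norm (cls f - cls (\<lambda>t. \<Sum>k=1..N. L2_inner unit_I f (\<phi> k) * \<phi> k t))"
        using 1 by simp
      moreover have "(\<lambda>t. \<Sum>k=1..N. L2_inner unit_I f (\<phi> k) * \<phi> k t) \<in> L2 unit_I"
        using L2 by (intro L2_sum L2_cmult) auto
      ultimately show ?thesis
        using 1 by (simp only: cls_diff[symmetric] norm_cls L2_diff)
    qed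
    then have "(\<lambda>N. norm (x - (\<Sum>k=1..N. (x \<bullet> cls (\<phi> k)) *\<^sub>R cls (\<phi> k)))) \<longlonglongrightarrow> 0"
      using assms 1 by (simp add: L2_basis_def)
    then show ?thesis
      by (subst (asm) norm_minus_commute) (simp add: LIM_zero_iff tendsto_norm_zero_iff)
  qed
  then show "orthonormal_basis (\<lambda>k. cls (\<phi> k))"
    using assms L2 by (simp add: orthonormal_basis_def L2_basis_def inner_cls)
qed

text \<open>The sections \<open>h s\<close> are expanded in \<open>\<psi>\<close> for almost every \<open>s\<close>, and each coefficient, a function of
  \<open>s\<close>, is expanded in \<open>\<phi>\<close>. Since the summands are nonnegative, the partial sums over squares already
  control the iterated series.\<close>

lemma L2_norm_tensor_basis_le:
  assumes h: "(\<lambda>(s, t). h s t) \<in> L2 unit_I2" and \<phi>: "L2_basis \<phi>" and \<psi>: "L2_basis \<psi>"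
    and c: "\<And>N. (\<Sum>j=1..N. \<Sum>k=1..N. (\<integral>(s, t). h s t * \<phi> j s * \<psi> k t \<partial>unit_I2)\<^sup>2) \<le> c"
  shows "(L2_norm unit_I2 (\<lambda>(s, t). h s t))\<^sup>2 \<le> c"
proof -
  define G where "G k s = (\<integral>t. h s t * \<psi> k t \<partial>unit_I)" for k s
  have G: "G k \<in> L2 unit_I" if "k \<ge> 1" for k
    unfolding G_def by (rule unit_I2.L2_kernel(2)[OF h L2_zero]) (rule L2_basisD(1)[OF \<psi> that])
  have GG: "(\<integral>(s, t). h s t * \<phi> j s * \<psi> k t \<partial>unit_I2) = cls (G k) \<bullet> cls (\<phi> j)" if "k \<ge> 1" "j \<ge> 1" for j k
    unfolding inner_cls[OF G[OF that(1)] L2_basisD(1)[OF \<phi> that(2)]] G_def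
    by (rule unit_I2.L2_kernel(4)[OF h]) (auto intro: L2_basisD(1)[OF \<psi>] L2_basisD(1)[OF \<phi>] that)
  have h2: "integrable unit_I2 (\<lambda>(s, t). (h s t)\<^sup>2)"
    using L2_square_integrable[OF h] by (simp add: case_prod_beta')
  have "(\<Sum>k=1..K. (norm (cls (G k)))\<^sup>2) \<le> c" for K
  proof (rule LIMSEQ_le_const2)
    show "(\<lambda>J. \<Sum>k=1..K. \<Sum>j=1..J. (cls (G k) \<bullet> cls (\<phi> j))\<^sup>2) \<longlonglongrightarrow> (\<Sum>k=1..K. (norm (cls (G k)))\<^sup>2)"
      by (intro tendsto_sum parseval_norm L2_basisD(2) \<phi>)
    show "\<exists>J0. \<forall>J\<ge>J0. (\<Sum>k=1..K. \<Sum>j=1..J. (cls (G k) \<bullet> cls (\<phi> j))\<^sup>2) \<le> c"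
    proof (intro exI[of _ K] allI impI)
      fix J assume "J \<ge> K"
      then have "(\<Sum>k=1..K. \<Sum>j=1..J. (cls (G k) \<bullet> cls (\<phi> j))\<^sup>2)
          \<le> (\<Sum>k=1..J. \<Sum>j=1..J. (cls (G k) \<bullet> cls (\<phi> j))\<^sup>2)"
        by (intro sum_mono2) (auto intro: sum_nonneg)
      also have "\<dots> = (\<Sum>k=1..J. \<Sum>j=1..J. (\<integral>(s, t). h s t * \<phi> j s * \<psi> k t \<partial>unit_I2)\<^sup>2)"
        by (intro sum.cong) (auto simp: GG)
      also have "\<dots> \<le> c"
        using c[of J] by (subst sum.swap)
      finally show "(\<Sum>k=1..K. \<Sum>j=1..J. (cls (G k) \<bullet> cls (\<phi> j))\<^sup>2) \<le> c" .
    qed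
  qed
  moreover have "(\<Sum>k=1..K. (norm (cls (G k)))\<^sup>2) = (\<integral>s. (\<Sum>k=1..K. (G k s)\<^sup>2) \<partial>unit_I)" for K
    using G by (subst Bochner_Integration.integral_sum)
      (auto intro!: sum.cong simp: norm_cls L2_norm_def L2_square_integrable)
  ultimately have le: "(\<integral>s. (\<Sum>k=1..K. (G k s)\<^sup>2) \<partial>unit_I) \<le> c" for K
    by simp
  have sec: "AE s in unit_I. (\<lambda>t. h s t) \<in> L2 unit_I"
    by (rule unit_I2.L2_kernel(5)[OF h L2_zero L2_zero])
  have Gs: "G k s = cls (\<lambda>t. h s t) \<bullet> cls (\<psi> k)" if "(\<lambda>t. h s t) \<in> L2 unit_I" "k \<ge> 1" for k s
    using that L2_basisD(1)[OF \<psi>] by (simp add: inner_cls L2_inner_def G_def)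
  have ns: "(norm (cls (\<lambda>t. h s t)))\<^sup>2 = (\<integral>t. (h s t)\<^sup>2 \<partial>unit_I)" if "(\<lambda>t. h s t) \<in> L2 unit_I" for s
    using that by (simp add: norm_cls L2_norm_def)
  have "(\<lambda>K. \<integral>s. (\<Sum>k=1..K. (G k s)\<^sup>2) \<partial>unit_I) \<longlonglongrightarrow> (\<integral>s. (\<integral>t. (h s t)\<^sup>2 \<partial>unit_I) \<partial>unit_I)"
  proof (rule integral_dominated_convergence)
    show dom: "integrable unit_I (\<lambda>s. \<integral>t. (h s t)\<^sup>2 \<partial>unit_I)"
      by (rule unit_I2.integrable_fst[OF h2])
    then show "(\<lambda>s. \<integral>t. (h s t)\<^sup>2 \<partial>unit_I) \<in> borel_measurable unit_I" by auto
    show "(\<lambda>s. \<Sum>k=1..K. (G k s)\<^sup>2) \<in> borel_measurable unit_I" for K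
      using G[THEN L2_measurable] by auto
    show "AE s in unit_I. (\<lambda>K. \<Sum>k=1..K. (G k s)\<^sup>2) \<longlonglongrightarrow> (\<integral>t. (h s t)\<^sup>2 \<partial>unit_I)"
      using sec
    proof eventually_elim
      case (elim s)
      then show ?case
        using parseval_norm[OF L2_basisD(2)[OF \<psi>], of "cls (\<lambda>t. h s t)"] by (simp add: Gs ns)
    qed
    show "AE s in unit_I. norm (\<Sum>k=1..K. (G k s)\<^sup>2) \<le> (\<integral>t. (h s t)\<^sup>2 \<partial>unit_I)" for K
      using sec
    proof eventually_elim
      case (elim s)
      then show ?case
        using bessel[OF L2_basisD(2)[OF \<psi>], of "{1..K}" "cls (\<lambda>t. h s t)"]
        by (simp add: Gs ns sum_nonneg)
    qed
  qed
  then have "(\<integral>s. (\<integral>t. (h s t)\<^sup>2 \<partial>unit_I) \<partial>unit_I) \<le> c"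
    using le by (rule LIMSEQ_le_const2[OF _ exI, rule_format])
  moreover have "(L2_norm unit_I2 (\<lambda>(s, t). h s t))\<^sup>2 = (\<integral>s. (\<integral>t. (h s t)\<^sup>2 \<partial>unit_I) \<partial>unit_I)"
    unfolding unit_I2.integral_fst[OF h2] by (simp add: L2_norm_def case_prod_beta')
  ultimately show ?thesis by simp
qed

lemma space_L2_borel: "space L2_borel = L2 unit_I"
  unfolding L2_borel_def by (rule space_measure_of) auto

text \<open>The functional is norm-continuous, so preimages of open sets are among the sets that generate the
  \<open>\<sigma>\<close>-algebra.\<close>

lemma measurable_inner_L2_borel:
  assumes g: "g \<in> L2 unit_I"
  shows "(\<lambda>f. cls f \<bullet> cls g) \<in> borel_measurable L2_borel"
proof (rule borel_measurableI)
  fix S :: "real set" assume S: "open S"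
  let ?U = "(\<lambda>f. cls f \<bullet> cls g) -` S \<inter> space L2_borel"
  have "\<exists>e>0. \<forall>f'\<in>L2 unit_I. L2_norm unit_I (\<lambda>t. f' t - f t) < e \<longrightarrow> f' \<in> ?U" if f: "f \<in> ?U" for f
  proof -
    have fL: "f \<in> L2 unit_I" using f by (simp add: space_L2_borel)
    obtain d where d: "d > 0" "\<And>y. dist y (cls f \<bullet> cls g) < d \<Longrightarrow> y \<in> S"
      using S f unfolding open_dist by auto
    show ?thesis
    proof (intro exI conjI ballI impI)
      show "0 < d / (norm (cls g) + 1)" using d by (simp add: add_nonneg_pos)
      fix f' assume f': "f' \<in> L2 unit_I" "L2_norm unit_I (\<lambda>t. f' t - f t) < d / (norm (cls g) + 1)"
      have "\<bar>cls f' \<bullet> cls g - cls f \<bullet> cls g\<bar> \<le> norm (cls f' - cls f) * norm (cls g)"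
        unfolding inner_diff_left[symmetric] by (rule Cauchy_Schwarz_ineq2)
      also have "\<dots> \<le> norm (cls f' - cls f) * (norm (cls g) + 1)"
        by (intro mult_left_mono) auto
      also have "\<dots> < d"
        using f' fL pos_less_divide_eq[of "norm (cls g) + 1" "norm (cls f' - cls f)" d]
        by (simp add: cls_diff[symmetric] norm_cls L2_diff add_nonneg_pos)
      finally have "cls f' \<bullet> cls g \<in> S"
        by (intro d) (simp add: dist_real_def)
      then show "f' \<in> ?U" using f' by (simp add: space_L2_borel)
    qed
  qed
  then show "?U \<in> sets L2_borel"
    unfolding L2_borel_def
    by (subst sets_measure_of) (auto simp: space_L2_borel[unfolded L2_borel_def] intro!: sigma_sets.Basic)
qed

section \<open>Power sums and polynomially decaying eigenvalues\<close>

lemma powr_difference_bounds: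
  fixes x p :: real
  assumes "x > 0" "p > 0"
  shows "p * (x + 1) powr (- p - 1) \<le> x powr (- p) - (x + 1) powr (- p)"
    and "x powr (- p) - (x + 1) powr (- p) \<le> p * x powr (- p - 1)"
proof -
  have "\<exists>z>x. z < x + 1 \<and> (x + 1) powr (- p) - x powr (- p) = (x + 1 - x) * (- p * z powr (- p - 1))"
    using assms by (intro MVT2) (auto intro!: derivative_eq_intros simp: powr_diff)
  then obtain z where z: "x < z" "z < x + 1" "x powr (- p) - (x + 1) powr (- p) = p * z powr (- p - 1)"
    by auto
  have "z powr (- p - 1) \<le> x powr (- p - 1)" "(x + 1) powr (- p - 1) \<le> z powr (- p - 1)"
    using assms z by (auto intro!: powr_mono2')
  then show "p * (x + 1) powr (- p - 1) \<le> x powr (- p) - (x + 1) powr (- p)"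
    and "x powr (- p) - (x + 1) powr (- p) \<le> p * x powr (- p - 1)"
    using z assms by auto
qed

lemma sum_powr_tail:
  fixes p :: real
  assumes "p > 0" "m \<ge> 1"
  shows "(\<Sum>k=Suc m..N. real k powr (- p - 1)) \<le> real m powr (- p) / p"
proof (cases "N \<ge> m")
  case True
  have "(\<Sum>k=Suc m..N. real k powr (- p - 1)) \<le> (real m powr (- p) - real N powr (- p)) / p"
    using True
  proof (induction N rule: dec_induct)
    case (step N)
    then show ?case
      using powr_difference_bounds(1)[of "real N" p] assms by (simp add: field_simps)
  qed simp
  also have "\<dots> \<le> real m powr (- p) / p"
    using assms by (intro divide_right_mono) auto
  finally show ?thesis .
qed (use assms in auto)

lemma sum_powr_bounded:
  fixes p :: real
  assumes "p > 0"
  shows "(\<Sum>k=1..N. real k powr (- p - 1)) \<le> 1 + 1 / p"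
proof (cases "N \<ge> 1")
  case True
  then have "(\<Sum>k=1..N. real k powr (- p - 1)) = 1 + (\<Sum>k=Suc 1..N. real k powr (- p - 1))"
    by (subst sum.atLeast_Suc_atMost) auto
  then show ?thesis
    using sum_powr_tail[OF assms, of 1 N] by simp
qed (use assms in auto)

text \<open>The sum dominates \<open>(l\<^bsup>-\<alpha>\<^esup> - (m + 1)\<^bsup>-\<alpha>\<^esup>) / \<alpha>\<close> by telescoping, and \<open>x\<^sup>\<alpha> \<le> x\<close> for
  \<open>x = l / (m + 1)\<close>. For \<open>l\<close> well below \<open>m\<close> the bound is of the order \<open>l\<^bsup>-\<alpha>\<^esup>\<close>, much more than the
  single summand \<open>l\<^bsup>-\<alpha>-1\<^esup>\<close>.\<close>

lemma sum_powr_section_lower: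
  fixes \<alpha> :: real
  assumes "\<alpha> \<ge> 1" "1 \<le> l" "l \<le> m"
  shows "real l powr (- \<alpha>) / \<alpha> * ((real m + 1 - real l) / (real m + 1)) \<le> (\<Sum>i=l..m. real i powr (- \<alpha> - 1))"
proof -
  have tele: "(real l powr (- \<alpha>) - (real m + 1) powr (- \<alpha>)) / \<alpha> \<le> (\<Sum>i=l..m. real i powr (- \<alpha> - 1))"
    using assms(3)
  proof (induction m rule: dec_induct)
    case base
    then show ?case
      using powr_difference_bounds(2)[of "real l" \<alpha>] assms by (simp add: field_simps)
  next
    case (step n)
    then show ?case
      using powr_difference_bounds(2)[of "real n + 1" \<alpha>] assms by (simp add: field_simps)
  qed
  define x where "x = real l / (real m + 1)"
  have x: "0 < x" "x \<le> 1" using assms by (auto simp: x_def)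
  have "(real m + 1) powr (- \<alpha>) = real l powr (- \<alpha>) * x powr \<alpha>"
    using assms by (simp add: x_def powr_divide powr_minus field_simps)
  moreover have "x powr \<alpha> \<le> x"
    using powr_mono'[of 1 \<alpha> x] x assms by simp
  ultimately have "real l powr (- \<alpha>) * (1 - x) \<le> real l powr (- \<alpha>) - (real m + 1) powr (- \<alpha>)"
    using mult_left_mono[of "x powr \<alpha>" x "real l powr (- \<alpha>)"] by (simp add: algebra_simps)
  then have "real l powr (- \<alpha>) * (1 - x) / \<alpha> \<le> (real l powr (- \<alpha>) - (real m + 1) powr (- \<alpha>)) / \<alpha>"
    using assms by (intro divide_right_mono) auto
  moreover have "1 - x = (real m + 1 - real l) / (real m + 1)"
    by (simp add: x_def field_simps)
  ultimately show ?thesis using tele by (simp add: mult.commute[of \<alpha>])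
qed

text \<open>The sum grows only logarithmically, but a square root fits the powers of \<open>m\<close> in which the rate is
  expressed.\<close>

lemma harmonic_le_sqrt: "(\<Sum>l=1..m. 1 / real l) \<le> 2 * sqrt (real m)"
proof (induction m)
  case (Suc m)
  have "1 / real (Suc m) \<le> 2 * (sqrt (real (Suc m)) - sqrt (real m))"
  proof -
    define a b where "a = sqrt (real (Suc m))" and "b = sqrt (real m)"
    have ab: "b \<le> a" "1 \<le> a" "0 \<le> b" by (auto simp: a_def b_def)
    have "a * a = real (Suc m)" "b * b = real m" by (auto simp: a_def b_def)
    then have d: "(a - b) * (a + b) = 1" by (simp add: algebra_simps)
    have "a + b \<le> 2 * (a * a)"
    proof -
      have "1 * a \<le> a * a" using ab by (intro mult_right_mono) auto
      then show ?thesis using ab by linarith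
    qed
    then have "(a - b) * (a + b) \<le> (a - b) * (2 * (a * a))"
      using ab by (intro mult_left_mono) auto
    then have "1 \<le> 2 * (a - b) * real (Suc m)"
      unfolding d \<open>a * a = real (Suc m)\<close> by (simp add: algebra_simps)
    then show ?thesis by (simp add: a_def b_def field_simps)
  qed
  then show ?case using Suc by simp
qed simp

text \<open>Here \<open>l\<^bsup>\<alpha>-\<beta>\<^esup> \<le> m\<^bsup>\<alpha>/2\<^esup> / l\<close>, and the partial fractions
  \<open>(m + 1) / (l (m + 1 - l)) = 1/l + 1/(m + 1 - l)\<close> lead to two harmonic sums.\<close>

lemma weighted_reciprocal_sum:
  fixes \<alpha> \<beta> :: real
  assumes "\<beta> \<ge> \<alpha> / 2 + 1" "\<alpha> \<ge> 0"
  shows "(\<Sum>l=1..m. real l powr (\<alpha> - \<beta>) * ((real m + 1) / (real m + 1 - real l))) \<le> 4 * real m powr ((\<alpha> + 1) / 2)"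
proof -
  have "real l powr (\<alpha> - \<beta>) * ((real m + 1) / (real m + 1 - real l))
      \<le> real m powr (\<alpha> / 2) * (1 / real l + 1 / (real m + 1 - real l))" if l: "l \<in> {1..m}" for l
  proof -
    have "real l powr (\<alpha> - \<beta>) \<le> real l powr (\<alpha> / 2 - 1)"
      using l assms by (intro powr_mono) auto
    also have "\<dots> = real l powr (\<alpha> / 2) * (1 / real l)"
      using l by (simp add: powr_diff)
    also have "\<dots> \<le> real m powr (\<alpha> / 2) * (1 / real l)"
      using l assms by (intro mult_right_mono powr_mono2) auto
    finally have "real l powr (\<alpha> - \<beta>) * ((real m + 1) / (real m + 1 - real l))
        \<le> real m powr (\<alpha> / 2) * (1 / real l) * ((real m + 1) / (real m + 1 - real l))"
      using l by (intro mult_right_mono) auto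
    also have "\<dots> = real m powr (\<alpha> / 2) * (1 / real l + 1 / (real m + 1 - real l))"
      using l by (simp add: field_simps)
    finally show ?thesis .
  qed
  then have "(\<Sum>l=1..m. real l powr (\<alpha> - \<beta>) * ((real m + 1) / (real m + 1 - real l)))
      \<le> (\<Sum>l=1..m. real m powr (\<alpha> / 2) * (1 / real l + 1 / (real m + 1 - real l)))"
    by (rule sum_mono)
  also have "\<dots> = real m powr (\<alpha> / 2) * ((\<Sum>l=1..m. 1 / real l) + (\<Sum>l=1..m. 1 / (real m + 1 - real l)))"
    by (simp only: sum_distrib_left[symmetric] sum.distrib)
  also have "(\<Sum>l=1..m. 1 / (real m + 1 - real l)) = (\<Sum>l=1..m. 1 / real l)"
    by (rule sum.reindex_bij_witness[of _ "\<lambda>l. m + 1 - l" "\<lambda>l. m + 1 - l"]) (auto simp: of_nat_diff)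
  also have "real m powr (\<alpha> / 2) * ((\<Sum>l=1..m. 1 / real l) + (\<Sum>l=1..m. 1 / real l))
      \<le> real m powr (\<alpha> / 2) * (2 * sqrt (real m) + 2 * sqrt (real m))"
    using harmonic_le_sqrt[of m] by (intro mult_left_mono) auto
  also have "\<dots> = 4 * real m powr ((\<alpha> + 1) / 2)"
    by (cases "m = 0") (auto simp: powr_half_sqrt[symmetric] powr_add[symmetric] add_divide_distrib)
  finally show ?thesis .
qed

locale polynomial_eigenvalues =
  fixes \<kappa> :: "nat \<Rightarrow> real" and \<alpha> C :: real
  assumes \<alpha>: "\<alpha> > 1" and C: "C > 1"
    and pos: "k \<ge> 1 \<Longrightarrow> \<kappa> k > 0"
    and upper: "k \<ge> 1 \<Longrightarrow> \<kappa> k \<le> C * real k powr (- \<alpha>)"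
    and gap: "k \<ge> 1 \<Longrightarrow> inverse C * real k powr (- \<alpha> - 1) \<le> \<kappa> k - \<kappa> (Suc k)"
begin

lemma decreasing:
  assumes "1 \<le> j" "j \<le> k"
  shows "\<kappa> k \<le> \<kappa> j"
  using assms(2)
proof (induction k rule: dec_induct)
  case (step n)
  have "0 \<le> inverse C * real n powr (- \<alpha> - 1)" using C by simp
  then show ?case using step assms(1) gap[of n] by simp
qed simp

lemma gap_lower:
  assumes "1 \<le> l" "l \<le> m"
  shows "real l powr (- \<alpha>) / (\<alpha> * C) * ((real m + 1 - real l) / (real m + 1)) \<le> \<kappa> l - \<kappa> (Suc m)"
proof -
  have "(\<Sum>i=l..m. inverse C * real i powr (- \<alpha> - 1)) \<le> (\<Sum>i=l..m. \<kappa> i - \<kappa> (Suc i))"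
    using assms by (intro sum_mono gap) auto
  also have "\<dots> = \<kappa> l - \<kappa> (Suc m)"
    using assms(2) by (induction m rule: dec_induct) auto
  finally have "inverse C * (\<Sum>i=l..m. real i powr (- \<alpha> - 1)) \<le> \<kappa> l - \<kappa> (Suc m)"
    by (simp add: sum_distrib_left)
  moreover have "inverse C * (real l powr (- \<alpha>) / \<alpha> * ((real m + 1 - real l) / (real m + 1)))
      \<le> inverse C * (\<Sum>i=l..m. real i powr (- \<alpha> - 1))"
    using assms \<alpha> C by (intro mult_left_mono sum_powr_section_lower) auto
  ultimately show ?thesis by (simp add: field_simps)
qed

lemma lower:
  assumes "m \<ge> 1"
  shows "real m powr (- \<alpha>) / (2 * \<alpha> * C) \<le> \<kappa> m"
proof -
  \<comment> \<open>with this upper index the factor in \<open>gap_lower\<close> becomes one half\<close>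
  define M where "M = 2 * m - 1"
  have M: "m \<le> M" "real M + 1 = 2 * real m" using assms by (auto simp: M_def of_nat_diff)
  have "real m powr (- \<alpha>) / (\<alpha> * C) * ((real M + 1 - real m) / (real M + 1)) \<le> \<kappa> m - \<kappa> (Suc M)"
    by (rule gap_lower[OF assms M(1)])
  moreover have "(real M + 1 - real m) / (real M + 1) = 1 / 2"
    using assms M(2) by simp
  ultimately have "real m powr (- \<alpha>) / (\<alpha> * C) / 2 \<le> \<kappa> m - \<kappa> (Suc M)" by simp
  then show ?thesis using pos[of "Suc M"] by (simp add: mult.assoc mult.commute)
qed

lemma inverse_le:
  assumes "m \<ge> 1"
  shows "1 / \<kappa> m \<le> 2 * \<alpha> * C * real m powr \<alpha>"
  using lower[OF assms] pos[OF assms] \<alpha> C assms by (simp add: field_simps powr_minus)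

lemma trace_le: "(\<Sum>k=1..N. \<kappa> k) \<le> C * (1 + 1 / (\<alpha> - 1))"
proof -
  have "(\<Sum>k=1..N. \<kappa> k) \<le> (\<Sum>k=1..N. C * real k powr (- (\<alpha> - 1) - 1))"
    using upper by (intro sum_mono) auto
  also have "\<dots> \<le> C * (1 + 1 / (\<alpha> - 1))"
    unfolding sum_distrib_left[symmetric] using \<alpha> C by (intro mult_left_mono sum_powr_bounded) auto
  finally show ?thesis .
qed

definition dim_const :: real where "dim_const = 1 + 2 * \<alpha> * C\<^sup>2 / (\<alpha> - 1)"

lemma dim_const_ge_1: "dim_const \<ge> 1"
  using \<alpha> C by (simp add: dim_const_def)

text \<open>Each of the first \<open>m\<close> summands is at most 1; the others are at most \<open>\<kappa> k / \<kappa> m\<close>, and the tail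
  \<open>O(m\<^bsup>1-\<alpha>\<^esup>)\<close> of the eigenvalues divided by \<open>\<kappa> m\<close> is again of the order \<open>m\<close>.\<close>

lemma effective_dimension:
  assumes m: "m \<ge> 1"
  shows "(\<Sum>k=1..N. \<kappa> k / (\<kappa> k + \<kappa> m)) \<le> dim_const * real m"
proof -
  have "(\<Sum>k=1..N. \<kappa> k / (\<kappa> k + \<kappa> m)) \<le> (\<Sum>k=1..m+N. \<kappa> k / (\<kappa> k + \<kappa> m))"
  proof (rule sum_mono2)
    fix k assume "k \<in> {1..m+N} - {1..N}"
    then have "\<kappa> k > 0" "\<kappa> m > 0" using pos m by auto
    then show "0 \<le> \<kappa> k / (\<kappa> k + \<kappa> m)" by simp
  qed auto
  also have "\<dots> = (\<Sum>k=1..m. \<kappa> k / (\<kappa> k + \<kappa> m)) + (\<Sum>k=Suc m..m+N. \<kappa> k / (\<kappa> k + \<kappa> m))"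
    using m by (subst sum.ub_add_nat) auto
  also have "(\<Sum>k=1..m. \<kappa> k / (\<kappa> k + \<kappa> m)) \<le> (\<Sum>k=1..m. 1)"
  proof (rule sum_mono)
    fix k assume "k \<in> {1..m}"
    then have "\<kappa> k > 0" "\<kappa> m > 0" using pos m by auto
    then show "\<kappa> k / (\<kappa> k + \<kappa> m) \<le> 1" by simp
  qed
  also have "(\<Sum>k=Suc m..m+N. \<kappa> k / (\<kappa> k + \<kappa> m)) \<le> (\<Sum>k=Suc m..m+N. C * real k powr (- (\<alpha> - 1) - 1) * (1 / \<kappa> m))"
  proof (rule sum_mono)
    fix k assume k: "k \<in> {Suc m..m+N}"
    then have p: "\<kappa> k > 0" "\<kappa> m > 0" using pos m by auto
    then have "\<kappa> k / (\<kappa> k + \<kappa> m) \<le> \<kappa> k * (1 / \<kappa> m)"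
      by (simp add: frac_le)
    also have "\<dots> \<le> C * real k powr (- (\<alpha> - 1) - 1) * (1 / \<kappa> m)"
      using k p upper[of k] by (intro mult_right_mono) auto
    finally show "\<kappa> k / (\<kappa> k + \<kappa> m) \<le> C * real k powr (- (\<alpha> - 1) - 1) * (1 / \<kappa> m)" .
  qed
  also have "\<dots> = C * (\<Sum>k=Suc m..m+N. real k powr (- (\<alpha> - 1) - 1)) * (1 / \<kappa> m)"
    by (simp only: sum_distrib_left sum_distrib_right)
  also have "\<dots> \<le> C * (real m powr (- (\<alpha> - 1)) / (\<alpha> - 1)) * (2 * \<alpha> * C * real m powr \<alpha>)"
    using m \<alpha> C pos[OF m]
    by (intro mult_mono mult_left_mono sum_powr_tail inverse_le mult_nonneg_nonneg) (auto simp: divide_nonneg_nonneg)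
  also have "\<dots> = 2 * \<alpha> * C\<^sup>2 / (\<alpha> - 1) * (real m powr (- (\<alpha> - 1)) * real m powr \<alpha>)"
    using \<alpha> by (simp add: power2_eq_square)
  also have "real m powr (- (\<alpha> - 1)) * real m powr \<alpha> = real m"
    using m by (simp add: powr_add[symmetric])
  finally show ?thesis by (simp add: dim_const_def algebra_simps)
qed

end

section \<open>Moments and tail probabilities\<close>

text \<open>Markov's inequality for the supremum of an increasing sequence, by continuity from below. Controlling
  all partial sums of a series on one event makes it unnecessary to discuss convergence.\<close>

lemma (in prob_space) markov_incseq:
  fixes F :: "nat \<Rightarrow> 'a \<Rightarrow> real"
  assumes int: "\<And>N. integrable M (F N)" and nonneg: "\<And>N \<omega>. 0 \<le> F N \<omega>"
    and mono: "\<And>N \<omega>. F N \<omega> \<le> F (Suc N) \<omega>" and c: "\<And>N. expectation (F N) \<le> c" and t: "t > 0"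
  shows "{\<omega>\<in>space M. \<exists>N. F N \<omega> > t} \<in> events" and "prob {\<omega>\<in>space M. \<exists>N. F N \<omega> > t} \<le> c / t"
proof -
  note [measurable] = borel_measurable_integrable[OF int]
  show "{\<omega>\<in>space M. \<exists>N. F N \<omega> > t} \<in> events" by measurable
  define A where "A N = {\<omega>\<in>space M. F N \<omega> > t}" for N
  have A[measurable]: "A N \<in> events" for N unfolding A_def by measurable
  have "incseq A"
    unfolding A_def by (intro incseq_SucI) (auto intro: less_le_trans mono)
  then have "(\<lambda>N. prob (A N)) \<longlonglongrightarrow> prob (\<Union>N. A N)"
    using A by (intro finite_Lim_measure_incseq) auto
  moreover have "prob (A N) \<le> c / t" for N
  proof -
    have "prob (A N) \<le> prob {\<omega>\<in>space M. F N \<omega> \<ge> t}"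
      by (intro finite_measure_mono) (auto simp: A_def)
    also have "\<dots> \<le> expectation (F N) / t"
      using int nonneg t by (intro integral_Markov_inequality_measure[where A = "{}"]) auto
    also have "\<dots> \<le> c / t"
      using c t by (intro divide_right_mono) auto
    finally show ?thesis .
  qed
  ultimately have "prob (\<Union>N. A N) \<le> c / t"
    by (intro LIMSEQ_le_const2[where X = "\<lambda>N. prob (A N)"]) auto
  moreover have "(\<Union>N. A N) = {\<omega>\<in>space M. \<exists>N. F N \<omega> > t}"
    by (auto simp: A_def)
  ultimately show "prob {\<omega>\<in>space M. \<exists>N. F N \<omega> > t} \<le> c / t" by simp
qed

lemma (in prob_space) markov_partial_sums:
  fixes Z :: "'i \<Rightarrow> 'a \<Rightarrow> real"
  assumes I: "\<And>N. finite (I N)" "\<And>N. I N \<subseteq> I (Suc N)"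
    and Z: "\<And>i N. i \<in> I N \<Longrightarrow> integrable M (Z i)" "\<And>i N \<omega>. i \<in> I N \<Longrightarrow> 0 \<le> Z i \<omega>"
    and c: "\<And>N. (\<Sum>i\<in>I N. expectation (Z i)) \<le> c" and t: "t > 0"
  shows "\<exists>A\<in>events. prob A \<le> c / t \<and> (\<forall>\<omega>\<in>space M - A. \<forall>N. (\<Sum>i\<in>I N. Z i \<omega>) \<le> t)"
proof (intro bexI conjI)
  let ?F = "\<lambda>N \<omega>. \<Sum>i\<in>I N. Z i \<omega>"
  have 1: "integrable M (?F N)" for N using Z(1) by (intro Bochner_Integration.integrable_sum)
  have 2: "0 \<le> ?F N \<omega>" for N \<omega> using Z(2) by (intro sum_nonneg)
  have 3: "?F N \<omega> \<le> ?F (Suc N) \<omega>" for N \<omega> using I Z(2)[of _ "Suc N"] by (intro sum_mono2) auto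
  have 4: "expectation (?F N) \<le> c" for N
    using c[of N] Z(1) by (subst Bochner_Integration.integral_sum) auto
  note m = markov_incseq[of ?F, OF 1 2 3 4 t]
  show "{\<omega>\<in>space M. \<exists>N. ?F N \<omega> > t} \<in> events" "prob {\<omega>\<in>space M. \<exists>N. ?F N \<omega> > t} \<le> c / t"
    by (fact m)+
  show "\<forall>\<omega>\<in>space M - {\<omega>\<in>space M. \<exists>N. ?F N \<omega> > t}. \<forall>N. ?F N \<omega> \<le> t"
    by (auto simp: not_less)
qed

lemma (in prob_space) outside_union:
  assumes "\<exists>A\<in>events. prob A \<le> p \<and> (\<forall>\<omega>\<in>space M - A. P \<omega>)"
    and "\<exists>A\<in>events. prob A \<le> q \<and> (\<forall>\<omega>\<in>space M - A. Q \<omega>)"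
  shows "\<exists>A\<in>events. prob A \<le> p + q \<and> (\<forall>\<omega>\<in>space M - A. P \<omega> \<and> Q \<omega>)"
proof -
  obtain A B where AB: "A \<in> events" "B \<in> events" "prob A \<le> p" "prob B \<le> q"
    "\<forall>\<omega>\<in>space M - A. P \<omega>" "\<forall>\<omega>\<in>space M - B. Q \<omega>"
    using assms by blast
  have "prob (A \<union> B) \<le> p + q"
    using measure_Un_le[OF AB(1,2)] AB(3,4) by linarith
  then show ?thesis
    using AB by (intro bexI[of _ "A \<union> B"]) auto
qed

text \<open>After centring, the products of distinct summands have mean zero by independence.\<close>

lemma (in prob_space) mean_square_of_average:
  fixes f :: "'b \<Rightarrow> real" and n :: nat
  assumes indep: "indep_vars (\<lambda>_. S) W {1..}"
    and law: "\<And>i. i \<ge> 1 \<Longrightarrow> distr M S (W i) = distr M S V"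
    and V: "V \<in> M \<rightarrow>\<^sub>M S" and f: "f \<in> borel_measurable S"
    and sq: "integrable M (\<lambda>\<omega>. (f (V \<omega>))\<^sup>2)" and z: "expectation (\<lambda>\<omega>. f (V \<omega>)) = z" and n: "n \<ge> 1"
  shows "integrable M (\<lambda>\<omega>. ((\<Sum>i=1..n. f (W i \<omega>)) / real n - z)\<^sup>2)"
    and "expectation (\<lambda>\<omega>. ((\<Sum>i=1..n. f (W i \<omega>)) / real n - z)\<^sup>2) \<le> expectation (\<lambda>\<omega>. (f (V \<omega>))\<^sup>2) / real n"
proof -
  note [measurable] = V f
  have W[measurable]: "W i \<in> M \<rightarrow>\<^sub>M S" if "i \<ge> 1" for i
    using indep that by (auto simp: indep_vars_def)
  have law_int: "integrable M (\<lambda>\<omega>. h (W i \<omega>)) \<longleftrightarrow> integrable M (\<lambda>\<omega>. h (V \<omega>))"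
    and law_exp: "expectation (\<lambda>\<omega>. h (W i \<omega>)) = expectation (\<lambda>\<omega>. h (V \<omega>))"
    if "h \<in> borel_measurable S" "i \<ge> 1" for h :: "'b \<Rightarrow> real" and i
  proof -
    show "integrable M (\<lambda>\<omega>. h (W i \<omega>)) \<longleftrightarrow> integrable M (\<lambda>\<omega>. h (V \<omega>))"
      using integrable_distr_eq[OF W[OF that(2)] that(1)] integrable_distr_eq[OF V that(1)] law[OF that(2)]
      by simp
    show "expectation (\<lambda>\<omega>. h (W i \<omega>)) = expectation (\<lambda>\<omega>. h (V \<omega>))"
      using integral_distr[OF W[OF that(2)] that(1)] integral_distr[OF V that(1)] law[OF that(2)]
      by simp
  qed
  have fV: "(\<lambda>\<omega>. f (V \<omega>)) \<in> L2 M" using sq by (simp add: L2_def)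
  define g where "g x = f x - z" for x
  have g[measurable]: "g \<in> borel_measurable S" unfolding g_def by measurable
  have gV: "(\<lambda>\<omega>. g (V \<omega>)) \<in> L2 M"
    unfolding g_def by (intro L2_diff fV L2_const)
  have gV0: "expectation (\<lambda>\<omega>. g (V \<omega>)) = 0"
    using z L2_integrable[OF fV] by (simp add: g_def prob_space)
  have "expectation (\<lambda>\<omega>. (g (V \<omega>))\<^sup>2) = expectation (\<lambda>\<omega>. ((f (V \<omega>))\<^sup>2 - 2 * z * f (V \<omega>)) + z\<^sup>2)"
    unfolding g_def by (intro Bochner_Integration.integral_cong) (auto simp: power2_eq_square algebra_simps)
  also have "\<dots> = expectation (\<lambda>\<omega>. (f (V \<omega>))\<^sup>2) - z\<^sup>2"
    using sq L2_integrable[OF fV] z by (simp add: prob_space power2_eq_square)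
  finally have gV2: "expectation (\<lambda>\<omega>. (g (V \<omega>))\<^sup>2) \<le> expectation (\<lambda>\<omega>. (f (V \<omega>))\<^sup>2)" by simp
  have gW: "(\<lambda>\<omega>. g (W i \<omega>)) \<in> L2 M" if "i \<ge> 1" for i
    using law_int[of "\<lambda>x. (g x)\<^sup>2" i] gV that by (auto simp: L2_def)
  have cross: "expectation (\<lambda>\<omega>. g (W i \<omega>) * g (W j \<omega>)) = 0" if "i \<ge> 1" "j \<ge> 1" "i \<noteq> j" for i j
  proof -
    have "indep_vars (\<lambda>_. borel) (\<lambda>i \<omega>. g (W i \<omega>)) {i, j}"
      using that by (intro indep_vars_compose2[OF indep_vars_subset[OF indep]]) auto
    then have "expectation (\<lambda>\<omega>. \<Prod>k\<in>{i, j}. g (W k \<omega>)) = (\<Prod>k\<in>{i, j}. expectation (\<lambda>\<omega>. g (W k \<omega>)))"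
      using that gW L2_integrable by (intro indep_vars_lebesgue_integral) auto
    then show ?thesis
      using that law_exp[of g] gV0 by simp
  qed
  have eq: "((\<Sum>i=1..n. f (W i \<omega>)) / real n - z)\<^sup>2
      = (\<Sum>i=1..n. \<Sum>j=1..n. g (W i \<omega>) * g (W j \<omega>)) / (real n)\<^sup>2" for \<omega>
  proof -
    have "(\<Sum>i=1..n. f (W i \<omega>)) / real n - z = (\<Sum>i=1..n. g (W i \<omega>)) / real n"
      using n by (simp add: g_def sum_subtractf field_simps)
    then show ?thesis
      by (simp add: power_divide power2_eq_square sum_product)
  qed
  have int: "integrable M (\<lambda>\<omega>. g (W i \<omega>) * g (W j \<omega>))" if "i \<ge> 1" "j \<ge> 1" for i j
    using gW that by (intro L2_mult_integrable) auto
  show "integrable M (\<lambda>\<omega>. ((\<Sum>i=1..n. f (W i \<omega>)) / real n - z)\<^sup>2)"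
    unfolding eq using int by (intro integrable_divide Bochner_Integration.integrable_sum) auto
  have "expectation (\<lambda>\<omega>. ((\<Sum>i=1..n. f (W i \<omega>)) / real n - z)\<^sup>2)
      = (\<Sum>i=1..n. \<Sum>j=1..n. expectation (\<lambda>\<omega>. g (W i \<omega>) * g (W j \<omega>))) / (real n)\<^sup>2"
  proof -
    have "expectation (\<lambda>\<omega>. \<Sum>i=1..n. \<Sum>j=1..n. g (W i \<omega>) * g (W j \<omega>))
        = (\<Sum>i=1..n. expectation (\<lambda>\<omega>. \<Sum>j=1..n. g (W i \<omega>) * g (W j \<omega>)))"
      using int by (intro Bochner_Integration.integral_sum Bochner_Integration.integrable_sum) auto
    also have "\<dots> = (\<Sum>i=1..n. \<Sum>j=1..n. expectation (\<lambda>\<omega>. g (W i \<omega>) * g (W j \<omega>)))"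
      using int by (intro sum.cong refl Bochner_Integration.integral_sum) auto
    finally show ?thesis unfolding eq by simp
  qed
  also have "(\<Sum>i=1..n. \<Sum>j=1..n. expectation (\<lambda>\<omega>. g (W i \<omega>) * g (W j \<omega>)))
      = (\<Sum>i=1..n. \<Sum>j=1..n. if j = i then expectation (\<lambda>\<omega>. (g (V \<omega>))\<^sup>2) else 0)"
  proof (intro sum.cong refl)
    fix i j assume "i \<in> {1..n}" "j \<in> {1..n}"
    then show "expectation (\<lambda>\<omega>. g (W i \<omega>) * g (W j \<omega>)) = (if j = i then expectation (\<lambda>\<omega>. (g (V \<omega>))\<^sup>2) else 0)"
      using cross[of i j] law_exp[of "\<lambda>x. g x * g x" i] by (auto simp: power2_eq_square)
  qed
  also have "\<dots> = real n * expectation (\<lambda>\<omega>. (g (V \<omega>))\<^sup>2)" by simp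
  also have "\<dots> / (real n)\<^sup>2 = expectation (\<lambda>\<omega>. (g (V \<omega>))\<^sup>2) / real n"
    using n by (simp add: power2_eq_square)
  also have "\<dots> \<le> expectation (\<lambda>\<omega>. (f (V \<omega>))\<^sup>2) / real n"
    using gV2 by (intro divide_right_mono) auto
  finally show "expectation (\<lambda>\<omega>. ((\<Sum>i=1..n. f (W i \<omega>)) / real n - z)\<^sup>2) \<le> expectation (\<lambda>\<omega>. (f (V \<omega>))\<^sup>2) / real n" .
qed

section \<open>Random elements of the Hilbert space\<close>

lemma L2_randomD:
  assumes "L2_random M X"
  shows "X \<in> M \<rightarrow>\<^sub>M L2_borel" and "(\<lambda>(\<omega>, t). X \<omega> t) \<in> borel_measurable (M \<Otimes>\<^sub>M unit_I)"
    and "\<omega> \<in> space M \<Longrightarrow> X \<omega> \<in> L2 unit_I"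
  using assms measurable_space[of X M L2_borel \<omega>] by (auto simp: L2_random_def space_L2_borel)

lemma (in prob_space) pair_prob_space_unit_I: "pair_prob_space M unit_I" ..

lemma (in prob_space) L2_random_jointly_square_integrable:
  assumes X: "L2_random M X" and sq: "integrable M (\<lambda>\<omega>. (L2_norm unit_I (X \<omega>))\<^sup>2)"
  shows "(\<lambda>(\<omega>, t). X \<omega> t) \<in> L2 (M \<Otimes>\<^sub>M unit_I)"
proof -
  interpret P: pair_prob_space M unit_I by (rule pair_prob_space_unit_I)
  note [measurable] = L2_randomD(2)[OF X]
  have "integrable (M \<Otimes>\<^sub>M unit_I) (\<lambda>(\<omega>, t). (X \<omega> t)\<^sup>2)"
  proof (rule P.Fubini_integrable)
    show "integrable M (\<lambda>\<omega>. \<integral>t. norm (case (\<omega>, t) of (\<omega>, t) \<Rightarrow> (X \<omega> t)\<^sup>2) \<partial>unit_I)"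
      using sq by (simp add: L2_norm_def)
    show "AE \<omega> in M. integrable unit_I (\<lambda>t. case (\<omega>, t) of (\<omega>, t) \<Rightarrow> (X \<omega> t)\<^sup>2)"
      using L2_randomD(3)[OF X] by (intro AE_I2) (simp add: L2_def)
  qed measurable
  then show ?thesis
    by (simp add: L2_def case_prod_beta')
qed

lemma (in prob_space) mean_fun_of_random_element:
  assumes X: "L2_random M X" and sq: "integrable M (\<lambda>\<omega>. (L2_norm unit_I (X \<omega>))\<^sup>2)"
  shows "mean_fun M X \<in> L2 unit_I"
    and "g \<in> L2 unit_I \<Longrightarrow> (\<lambda>\<omega>. cls (X \<omega>) \<bullet> cls g) \<in> L2 M"
    and "g \<in> L2 unit_I \<Longrightarrow> expectation (\<lambda>\<omega>. cls (X \<omega>) \<bullet> cls g) = cls (mean_fun M X) \<bullet> cls g"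
proof -
  interpret P: pair_prob_space M unit_I by (rule pair_prob_space_unit_I)
  note h = L2_random_jointly_square_integrable[OF X sq]
  note K = P.L2_kernel[OF h L2_const[of 1]]
  show m: "mean_fun M X \<in> L2 unit_I"
    using K(1)[OF L2_zero] by (simp add: mean_fun_def[abs_def])
  assume g: "g \<in> L2 unit_I"
  have eq: "(\<integral>t. X \<omega> t * g t \<partial>unit_I) = cls (X \<omega>) \<bullet> cls g" if "\<omega> \<in> space M" for \<omega>
    using L2_randomD(3)[OF X that] g by (simp add: inner_cls L2_inner_def)
  show "(\<lambda>\<omega>. cls (X \<omega>) \<bullet> cls g) \<in> L2 M"
    by (rule L2_cong_AE[OF K(2)[OF g]])
       (auto intro!: AE_I2 eq measurable_compose[OF L2_randomD(1)[OF X] measurable_inner_L2_borel[OF g]])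
  have "L2_inner unit_I (mean_fun M X) g = expectation (\<lambda>\<omega>. \<integral>t. X \<omega> t * g t \<partial>unit_I)"
    using K(3)[OF g] K(4)[OF g] by (simp add: L2_inner_def mean_fun_def)
  also have "\<dots> = expectation (\<lambda>\<omega>. cls (X \<omega>) \<bullet> cls g)"
    by (intro Bochner_Integration.integral_cong eq refl)
  finally show "expectation (\<lambda>\<omega>. cls (X \<omega>) \<bullet> cls g) = cls (mean_fun M X) \<bullet> cls g"
    using m g by (simp add: inner_cls)
qed

text \<open>For almost every \<open>s\<close>, the integral operator applied to \<open>g\<close> is the expectation of \<open>X(s) - E X(s)\<close> times
  the score of \<open>g\<close>; integrating this against \<open>f\<close> gives the covariance of the two scores.\<close>

lemma (in prob_space) covariance_of_scores:
  assumes X: "L2_random M X" and sq: "integrable M (\<lambda>\<omega>. (L2_norm unit_I (X \<omega>))\<^sup>2)"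
    and f: "f \<in> L2 unit_I" and g: "g \<in> L2 unit_I"
    and eig: "AE s in unit_I. int_op (cov_kernel M X) g s = c * g s"
  shows "expectation (\<lambda>\<omega>. ((cls (X \<omega>) - cls (mean_fun M X)) \<bullet> cls f) * ((cls (X \<omega>) - cls (mean_fun M X)) \<bullet> cls g))
    = c * (cls f \<bullet> cls g)"
proof -
  interpret P: pair_prob_space M unit_I by (rule pair_prob_space_unit_I)
  note m = mean_fun_of_random_element(1)[OF X sq]
  define Z where "Z \<omega> t = X \<omega> t - mean_fun M X t" for \<omega> t
  have ZL: "Z \<omega> \<in> L2 unit_I" if "\<omega> \<in> space M" for \<omega>
    unfolding Z_def by (intro L2_diff m L2_randomD(3)[OF X that])
  have h: "(\<lambda>(\<omega>, t). Z \<omega> t) \<in> L2 (M \<Otimes>\<^sub>M unit_I)"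
    using L2_diff[OF L2_random_jointly_square_integrable[OF X sq] P.L2_tensor[OF L2_const[of 1] m]]
    by (simp add: Z_def case_prod_beta')
  define S where "S g \<omega> = (\<integral>t. Z \<omega> t * g t \<partial>unit_I)" for g \<omega>
  have S: "S g \<in> L2 M" if "g \<in> L2 unit_I" for g
    unfolding S_def by (rule P.L2_kernel(2)[OF h L2_zero that])
  have Sx: "S g \<omega> = (cls (X \<omega>) - cls (mean_fun M X)) \<bullet> cls g" if "\<omega> \<in> space M" "g \<in> L2 unit_I" for \<omega> g
    using that m L2_randomD(3)[OF X that(1)] ZL[OF that(1)]
    by (simp add: cls_diff[symmetric] inner_cls S_def L2_inner_def Z_def[abs_def])
  have "AE s in unit_I. (\<integral>\<omega>. Z \<omega> s * S g \<omega> \<partial>M) = c * g s"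
    using eig P.L2_kernel(6)[OF h L2_zero L2_zero]
  proof eventually_elim
    case (elim s)
    have "int_op (cov_kernel M X) g s = L2_inner unit_I (\<lambda>t. \<integral>\<omega>. Z \<omega> t * Z \<omega> s \<partial>M) g"
      by (simp add: int_op_def cov_kernel_def L2_inner_def Z_def mult.commute)
    also have "\<dots> = L2_inner M (S g) (\<lambda>\<omega>. Z \<omega> s)"
      using P.L2_kernel(3,4)[OF h elim(2) g] by (simp add: S_def[abs_def])
    finally show ?case using elim(1) by (simp add: L2_inner_def mult.commute)
  qed
  then have "L2_inner unit_I (\<lambda>s. \<integral>\<omega>. Z \<omega> s * S g \<omega> \<partial>M) f = (\<integral>s. (c * g s) * f s \<partial>unit_I)"
    unfolding L2_inner_def using L2_measurable[OF f] L2_measurable[OF g] L2_measurable[OF P.L2_kernel(1)[OF h S[OF g] f]]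
    by (intro integral_cong_AE) (auto elim!: eventually_mono)
  also have "\<dots> = c * (cls f \<bullet> cls g)"
    using f g by (simp add: inner_cls L2_inner_def mult_ac)
  finally have "L2_inner M (S f) (S g) = c * (cls f \<bullet> cls g)"
    using P.L2_kernel(3,4)[OF h S[OF g] f] by (simp add: S_def[abs_def])
  moreover have "L2_inner M (S f) (S g)
      = expectation (\<lambda>\<omega>. ((cls (X \<omega>) - cls (mean_fun M X)) \<bullet> cls f) * ((cls (X \<omega>) - cls (mean_fun M X)) \<bullet> cls g))"
    unfolding L2_inner_def by (intro Bochner_Integration.integral_cong) (simp_all add: Sx f g)
  ultimately show ?thesis by simp
qed

section \<open>Conditional moments of the error\<close>

text \<open>The factor \<open>f\<close> is unbounded in the application, where it is a squared score, so integrability of the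
  product has to be proved along with the bound: truncate \<open>f\<close> at \<open>N\<close> and pass to the limit.\<close>

lemma (in sigma_finite_subalgebra) integral_mult_le_of_cond_exp_le:
  assumes f: "f \<in> borel_measurable F" "integrable M f" "\<And>x. 0 \<le> f x"
    and g: "integrable M g" "\<And>x. 0 \<le> g x"
    and c: "AE x in M. real_cond_exp M F g x \<le> c" "0 \<le> c"
  shows "integrable M (\<lambda>x. f x * g x)" and "(\<integral>x. f x * g x \<partial>M) \<le> c * (\<integral>x. f x \<partial>M)"
proof -
  have [measurable]: "f \<in> borel_measurable F" "f \<in> borel_measurable M" "g \<in> borel_measurable M"
    using f(1) g(1) measurable_from_subalg[OF subalg f(1)] by auto
  define h where "h N x = min (f x) (real N) * g x" for N x
  have int: "integrable M (h N)" for N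
  proof (rule Bochner_Integration.integrable_bound)
    show "integrable M (\<lambda>x. real N * g x)" using g by simp
    show "AE x in M. norm (h N x) \<le> norm (real N * g x)"
      using f(3) g(2) by (intro AE_I2) (auto simp: h_def abs_mult intro!: mult_right_mono)
  qed (simp add: h_def[abs_def])
  have le: "(\<integral>x. h N x \<partial>M) \<le> c * (\<integral>x. f x \<partial>M)" for N
  proof -
    have m: "(\<lambda>x. min (f x) (real N)) \<in> borel_measurable F" by measurable
    note ce = real_cond_exp_intg[OF int[of N, unfolded h_def] m borel_measurable_integrable[OF g(1)]]
    have "(\<integral>x. h N x \<partial>M) = (\<integral>x. min (f x) (real N) * real_cond_exp M F g x \<partial>M)"
      unfolding h_def using ce(2) by simp
    also have "\<dots> \<le> (\<integral>x. c * f x \<partial>M)"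
    proof (rule integral_mono_AE)
      show "integrable M (\<lambda>x. c * f x)" using f by simp
      show "AE x in M. min (f x) (real N) * real_cond_exp M F g x \<le> c * f x"
        using c(1)
      proof eventually_elim
        case (elim x)
        have "min (f x) (real N) * real_cond_exp M F g x \<le> min (f x) (real N) * c"
          using elim f(3) by (intro mult_left_mono) auto
        also have "\<dots> \<le> f x * c"
          using c(2) by (intro mult_right_mono) auto
        finally show ?case by (simp add: mult.commute)
      qed
    qed (rule ce(1))
    finally show ?thesis by simp
  qed
  have mono: "AE x in M. mono (\<lambda>N. h N x)"
    using g(2) by (intro AE_I2 monoI) (auto simp: h_def intro!: mult_right_mono)
  have lim: "AE x in M. (\<lambda>N. h N x) \<longlonglongrightarrow> f x * g x"
  proof (intro AE_I2)
    fix x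
    obtain N0 where N0: "f x \<le> real N0" using real_arch_simple by blast
    have "eventually (\<lambda>N. h N x = f x * g x) sequentially"
      unfolding eventually_sequentially
    proof (intro exI[of _ N0] allI impI)
      fix N assume "N \<ge> N0"
      then have "f x \<le> real N" using N0 by linarith
      then show "h N x = f x * g x" by (simp add: h_def)
    qed
    then show "(\<lambda>N. h N x) \<longlonglongrightarrow> f x * g x" by (rule tendsto_eventually)
  qed
  have "incseq (\<lambda>N. \<integral>x. h N x \<partial>M)"
    using g(2) by (intro incseq_SucI integral_mono int) (auto simp: h_def intro!: mult_right_mono)
  moreover have "bdd_above (range (\<lambda>N. \<integral>x. h N x \<partial>M))"
    using le by (intro bdd_aboveI[of _ "c * (\<integral>x. f x \<partial>M)"]) auto
  ultimately have conv: "(\<lambda>N. \<integral>x. h N x \<partial>M) \<longlonglongrightarrow> (SUP N. \<integral>x. h N x \<partial>M)"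
    by (intro LIMSEQ_incseq_SUP)
  have fg: "(\<lambda>x. f x * g x) \<in> borel_measurable M" by measurable
  show "integrable M (\<lambda>x. f x * g x)"
    by (rule integrable_monotone_convergence[OF int mono lim conv fg])
  have "(\<integral>x. f x * g x \<partial>M) = (SUP N. \<integral>x. h N x \<partial>M)"
    by (rule integral_monotone_convergence[OF int mono lim conv fg])
  also have "\<dots> \<le> c * (\<integral>x. f x \<partial>M)"
    using le by (intro cSUP_least) auto
  finally show "(\<integral>x. f x * g x \<partial>M) \<le> c * (\<integral>x. f x \<partial>M)" .
qed

section \<open>The population model in coordinates\<close>

locale functional_linear_model = prob_space M for M :: "'w measure" +
  fixes X Y EYX :: "'w \<Rightarrow> real \<Rightarrow> real" and b :: "real \<Rightarrow> real \<Rightarrow> real"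
    and \<kappa> :: "nat \<Rightarrow> real" and \<phi> :: "nat \<Rightarrow> real \<Rightarrow> real" and C :: real
  assumes X: "L2_random M X" and Y: "L2_random M Y"
    and b: "(\<lambda>(s, t). b s t) \<in> L2 unit_I2"
    and EYX: "L2_cond_exp M (sigma_gen M X) Y EYX"
    and regression: "AE \<omega> in M. AE s in unit_I.
           EYX \<omega> s = mean_fun M Y s + (\<integral>t. b s t * (X \<omega> t - mean_fun M X t) \<partial>unit_I)"
    and basis: "L2_basis \<phi>"
    and eigen: "\<And>k. k \<ge> 1 \<Longrightarrow> AE s in unit_I. int_op (cov_kernel M X) (\<phi> k) s = \<kappa> k * \<phi> k s"
    and C_pos: "C > 0"
    and Y2: "integrable M (\<lambda>\<omega>. (L2_norm unit_I (Y \<omega>))\<^sup>2)"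
    and X2: "integrable M (\<lambda>\<omega>. (L2_norm unit_I (X \<omega>))\<^sup>2)"
    and err2: "AE \<omega> in M. real_cond_exp M (sigma_gen M X)
                  (\<lambda>\<omega>'. (L2_norm unit_I (\<lambda>s. Y \<omega>' s - EYX \<omega>' s))\<^sup>2) \<omega> \<le> C"
    and X4: "\<And>k. k \<ge> 1 \<Longrightarrow> integrable M (\<lambda>\<omega>. (\<integral>t. (X \<omega> t - mean_fun M X t) * \<phi> k t \<partial>unit_I) ^ 4) \<and>
               (\<integral>\<omega>. (\<integral>t. (X \<omega> t - mean_fun M X t) * \<phi> k t \<partial>unit_I) ^ 4 \<partial>M) \<le> C * (\<kappa> k)\<^sup>2"
begin

abbreviation e :: "nat \<Rightarrow> l2" where "e k \<equiv> cls (\<phi> k)"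
abbreviation \<mu>X :: l2 where "\<mu>X \<equiv> cls (mean_fun M X)"
abbreviation \<mu>Y :: l2 where "\<mu>Y \<equiv> cls (mean_fun M Y)"

text \<open>The \<open>j\<close>-th coordinate of the function \<open>s \<mapsto> \<integral> b(s, t) f(t) dt\<close> is the inner product of \<open>f\<close> with
  \<open>brow j\<close>.\<close>

definition brow :: "nat \<Rightarrow> real \<Rightarrow> real" where "brow j t = (\<integral>s. b s t * \<phi> j s \<partial>unit_I)"

text \<open>Scores and residual coordinates are defined as functions of a pair, to be evaluated both at \<open>(X, Y)\<close>
  and at the sample pairs: the latter come without conditional expectations of their own, but have the
  same law, so that the moments of these functions carry over.\<close>

definition score :: "nat \<Rightarrow> (real \<Rightarrow> real) \<times> (real \<Rightarrow> real) \<Rightarrow> real" where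
  "score k p = (cls (fst p) - \<mu>X) \<bullet> e k"

definition resid :: "nat \<Rightarrow> (real \<Rightarrow> real) \<times> (real \<Rightarrow> real) \<Rightarrow> real" where
  "resid j p = (cls (snd p) - \<mu>Y) \<bullet> e j - (cls (fst p) - \<mu>X) \<bullet> cls (brow j)"

abbreviation XY :: "'w \<Rightarrow> (real \<Rightarrow> real) \<times> (real \<Rightarrow> real)" where "XY \<omega> \<equiv> (X \<omega>, Y \<omega>)"

lemma \<phi>_L2: "k \<ge> 1 \<Longrightarrow> \<phi> k \<in> L2 unit_I"
  by (rule L2_basisD(1)[OF basis])

lemma onb: "orthonormal_basis e"
  by (rule L2_basisD(2)[OF basis])

lemmas meanX_L2 = mean_fun_of_random_element(1)[OF X X2]
  and meanY_L2 = mean_fun_of_random_element(1)[OF Y Y2]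

lemma brow_L2: "j \<ge> 1 \<Longrightarrow> brow j \<in> L2 unit_I"
  unfolding brow_def[abs_def] by (rule unit_I2.L2_kernel(1)[OF b \<phi>_L2 L2_zero])

lemma brow_coefficient:
  assumes "j \<ge> 1" "g \<in> L2 unit_I"
  shows "cls (brow j) \<bullet> cls g = (\<integral>(s, t). b s t * \<phi> j s * g t \<partial>unit_I2)"
    and "cls (brow j) \<bullet> cls g = cls (\<lambda>s. \<integral>t. b s t * g t \<partial>unit_I) \<bullet> e j"
  using assms unit_I2.L2_kernel(2-4)[OF b \<phi>_L2[OF assms(1)] assms(2)] brow_L2[OF assms(1)] \<phi>_L2[OF assms(1)]
  by (simp_all add: inner_cls brow_def[abs_def])

lemma score_measurable [measurable]: "k \<ge> 1 \<Longrightarrow> score k \<in> borel_measurable (L2_borel \<Otimes>\<^sub>M L2_borel)"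
  unfolding score_def inner_diff_left
  by (intro borel_measurable_diff borel_measurable_const
      measurable_compose[OF measurable_fst measurable_inner_L2_borel] \<phi>_L2)

lemma resid_measurable [measurable]: "j \<ge> 1 \<Longrightarrow> resid j \<in> borel_measurable (L2_borel \<Otimes>\<^sub>M L2_borel)"
  unfolding resid_def inner_diff_left
  by (intro borel_measurable_diff borel_measurable_const \<phi>_L2 brow_L2
      measurable_compose[OF measurable_fst measurable_inner_L2_borel]
      measurable_compose[OF measurable_snd measurable_inner_L2_borel])

lemma XY_measurable [measurable]: "XY \<in> M \<rightarrow>\<^sub>M L2_borel \<Otimes>\<^sub>M L2_borel"
  using L2_randomD(1)[OF X] L2_randomD(1)[OF Y] by measurable

lemma score_integral:
  assumes "k \<ge> 1" "\<omega> \<in> space M"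
  shows "(\<integral>t. (X \<omega> t - mean_fun M X t) * \<phi> k t \<partial>unit_I) = score k (XY \<omega>)"
  using L2_randomD(3)[OF X assms(2)] meanX_L2 \<phi>_L2[OF assms(1)]
  by (simp add: score_def cls_diff[symmetric] inner_cls L2_inner_def L2_diff)

lemma score_L2: "k \<ge> 1 \<Longrightarrow> (\<lambda>\<omega>. score k (XY \<omega>)) \<in> L2 M"
  unfolding score_def inner_diff_left fst_conv
  by (intro L2_diff L2_const mean_fun_of_random_element(2)[OF X X2] \<phi>_L2)

lemma score_mean: "k \<ge> 1 \<Longrightarrow> expectation (\<lambda>\<omega>. score k (XY \<omega>)) = 0"
  unfolding score_def inner_diff_left fst_conv
  using mean_fun_of_random_element(2,3)[OF X X2 \<phi>_L2, of k] L2_integrable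
  by (simp add: prob_space)

lemma score_covariance:
  assumes "k \<ge> 1" "l \<ge> 1"
  shows "expectation (\<lambda>\<omega>. score k (XY \<omega>) * score l (XY \<omega>)) = (if k = l then \<kappa> k else 0)"
  using covariance_of_scores[OF X X2 \<phi>_L2[OF assms(1)] \<phi>_L2[OF assms(2)] eigen[OF assms(2)]]
    orthonormal_basis_inner[OF onb assms]
  by (auto simp: score_def)

lemma score_fourth_moment:
  assumes "k \<ge> 1"
  shows "integrable M (\<lambda>\<omega>. score k (XY \<omega>) ^ 4)" and "expectation (\<lambda>\<omega>. score k (XY \<omega>) ^ 4) \<le> C * (\<kappa> k)\<^sup>2"
proof -
  have "integrable M (\<lambda>\<omega>. score k (XY \<omega>) ^ 4) \<longleftrightarrow>
      integrable M (\<lambda>\<omega>. (\<integral>t. (X \<omega> t - mean_fun M X t) * \<phi> k t \<partial>unit_I) ^ 4)"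
    using assms by (intro Bochner_Integration.integrable_cong refl) (simp add: score_integral)
  then show "integrable M (\<lambda>\<omega>. score k (XY \<omega>) ^ 4)" using X4[OF assms] by simp
  have "expectation (\<lambda>\<omega>. score k (XY \<omega>) ^ 4) =
      expectation (\<lambda>\<omega>. (\<integral>t. (X \<omega> t - mean_fun M X t) * \<phi> k t \<partial>unit_I) ^ 4)"
    using assms by (intro Bochner_Integration.integral_cong refl) (simp add: score_integral)
  then show "expectation (\<lambda>\<omega>. score k (XY \<omega>) ^ 4) \<le> C * (\<kappa> k)\<^sup>2" using X4[OF assms] by simp
qed

text \<open>The fourth moments enter here, through the Cauchy-Schwarz inequality.\<close>

lemma score_products:
  assumes "k \<ge> 1" "l \<ge> 1"
  shows "integrable M (\<lambda>\<omega>. (score k (XY \<omega>) * score l (XY \<omega>))\<^sup>2)"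
    and "expectation (\<lambda>\<omega>. (score k (XY \<omega>) * score l (XY \<omega>))\<^sup>2) \<le> C * \<kappa> k * \<kappa> l"
proof -
  have m: "(\<lambda>\<omega>. (score k (XY \<omega>))\<^sup>2) \<in> borel_measurable M" if "k \<ge> 1" for k
    using that by measurable
  have sq: "(\<lambda>\<omega>. (score k (XY \<omega>))\<^sup>2) \<in> L2 M" if "k \<ge> 1" for k
    using score_fourth_moment(1)[OF that] m[OF that] by (simp add: L2_def power_mult[symmetric])
  show "integrable M (\<lambda>\<omega>. (score k (XY \<omega>) * score l (XY \<omega>))\<^sup>2)"
    using L2_mult_integrable[OF sq[OF assms(1)] sq[OF assms(2)]] by (simp add: power_mult_distrib)
  have \<kappa>: "\<kappa> k \<ge> 0" if "k \<ge> 1" for k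
  proof -
    have "\<kappa> k = expectation (\<lambda>\<omega>. score k (XY \<omega>) * score k (XY \<omega>))"
      using score_covariance[OF that that] by simp
    also have "\<dots> \<ge> 0" by simp
    finally show ?thesis .
  qed
  have "(expectation (\<lambda>\<omega>. (score k (XY \<omega>) * score l (XY \<omega>))\<^sup>2))\<^sup>2
      \<le> expectation (\<lambda>\<omega>. score k (XY \<omega>) ^ 4) * expectation (\<lambda>\<omega>. score l (XY \<omega>) ^ 4)"
    using L2_Cauchy_Schwarz[OF sq[OF assms(1)] sq[OF assms(2)]]
    by (simp add: power_mult_distrib power_mult[symmetric])
  also have "\<dots> \<le> (C * (\<kappa> k)\<^sup>2) * (C * (\<kappa> l)\<^sup>2)"
    using assms C_pos by (intro mult_mono score_fourth_moment) auto
  also have "\<dots> = (C * \<kappa> k * \<kappa> l)\<^sup>2"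
    by (simp add: power2_eq_square)
  finally show "expectation (\<lambda>\<omega>. (score k (XY \<omega>) * score l (XY \<omega>))\<^sup>2) \<le> C * \<kappa> k * \<kappa> l"
    by (rule power2_le_imp_le) (use C_pos assms \<kappa> in auto)
qed

definition err :: "'w \<Rightarrow> real \<Rightarrow> real" where "err \<omega> s = Y \<omega> s - EYX \<omega> s"

lemma X_generated: "X \<in> sigma_gen M X \<rightarrow>\<^sub>M L2_borel"
  using measurable_space[OF L2_randomD(1)[OF X]] by (intro measurable_vimage_algebra1) auto

sublocale finite_measure_subalgebra M "sigma_gen M X"
proof
  show "subalgebra M (sigma_gen M X)"
    using measurable_sets[OF L2_randomD(1)[OF X]] measurable_space[OF L2_randomD(1)[OF X]]
    unfolding subalgebra_def by (auto simp: sets_vimage_algebra2)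
qed

lemma EYX_random: "L2_random M EYX"
proof -
  have F: "L2_random (sigma_gen M X) EYX" using EYX by (simp add: L2_cond_exp_def)
  have id: "(\<lambda>\<omega>. \<omega>) \<in> M \<rightarrow>\<^sub>M sigma_gen M X"
    by (rule measurable_from_subalg[OF subalg measurable_ident_sets[OF refl]])
  have "(\<lambda>(\<omega>, t). EYX \<omega> t) \<in> borel_measurable (M \<Otimes>\<^sub>M unit_I)"
  proof -
    have "(\<lambda>p. (fst p, snd p)) \<in> M \<Otimes>\<^sub>M unit_I \<rightarrow>\<^sub>M sigma_gen M X \<Otimes>\<^sub>M unit_I"
      by (intro measurable_Pair measurable_compose[OF measurable_fst id] measurable_snd)
    from measurable_compose[OF this L2_randomD(2)[OF F]] show ?thesis by (simp add: case_prod_beta')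
  qed
  then show ?thesis
    using measurable_from_subalg[OF subalg L2_randomD(1)[OF F]] by (simp add: L2_random_def)
qed

lemma EYX_decomposition:
  "AE \<omega> in M. cls (EYX \<omega>) = \<mu>Y + cls (\<lambda>s. \<integral>t. b s t * (X \<omega> t - mean_fun M X t) \<partial>unit_I)"
  using regression AE_space
proof eventually_elim
  case (elim \<omega>)
  have B: "(\<lambda>s. \<integral>t. b s t * (X \<omega> t - mean_fun M X t) \<partial>unit_I) \<in> L2 unit_I"
    by (rule unit_I2.L2_kernel(2)[OF b L2_zero L2_diff[OF L2_randomD(3)[OF X elim(2)] meanX_L2]])
  show ?case
    unfolding cls_add[OF meanY_L2 B, symmetric]
    by (intro cls_eqI L2_add B meanY_L2 L2_randomD(3)[OF EYX_random] elim)
qed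

text \<open>The regression equation expresses the conditional expectation through \<open>X\<close>, up to a null set, and the
  kernel \<open>b\<close> defines a bounded operator.\<close>

lemma EYX_square_integrable: "integrable M (\<lambda>\<omega>. (L2_norm unit_I (EYX \<omega>))\<^sup>2)"
proof (rule Bochner_Integration.integrable_bound)
  define B where "B = (\<integral>(s, t). (b s t)\<^sup>2 \<partial>unit_I2)"
  have B0: "B \<ge> 0" unfolding B_def by (intro integral_nonneg_AE) auto
  show "integrable M (\<lambda>\<omega>. 2 * (norm \<mu>Y)\<^sup>2 + 2 * (B * (2 * (L2_norm unit_I (X \<omega>))\<^sup>2 + 2 * (norm \<mu>X)\<^sup>2)))"
    using X2 by simp
  note [measurable] = L2_randomD(2)[OF EYX_random]
  show "(\<lambda>\<omega>. (L2_norm unit_I (EYX \<omega>))\<^sup>2) \<in> borel_measurable M"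
    unfolding L2_norm_def by measurable
  show "AE \<omega> in M. norm ((L2_norm unit_I (EYX \<omega>))\<^sup>2)
      \<le> norm (2 * (norm \<mu>Y)\<^sup>2 + 2 * (B * (2 * (L2_norm unit_I (X \<omega>))\<^sup>2 + 2 * (norm \<mu>X)\<^sup>2)))"
    using EYX_decomposition AE_space
  proof eventually_elim
    case (elim \<omega>)
    let ?Z = "\<lambda>t. X \<omega> t - mean_fun M X t" and ?BZ = "\<lambda>s. \<integral>t. b s t * (X \<omega> t - mean_fun M X t) \<partial>unit_I"
    have XL: "X \<omega> \<in> L2 unit_I" by (rule L2_randomD(3)[OF X elim(2)])
    have Z: "?Z \<in> L2 unit_I" by (intro L2_diff XL meanX_L2)
    have BZ: "?BZ \<in> L2 unit_I" by (rule unit_I2.L2_kernel(2)[OF b L2_zero Z])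
    have "(norm (cls ?BZ))\<^sup>2 = (\<integral>s. (?BZ s)\<^sup>2 \<partial>unit_I)"
      using BZ by (simp add: norm_cls L2_norm_def)
    also have "\<dots> \<le> B * (\<integral>t. (?Z t)\<^sup>2 \<partial>unit_I)"
      unfolding B_def by (rule unit_I2.L2_kernel_norm_le[OF b Z])
    also have "(\<integral>t. (?Z t)\<^sup>2 \<partial>unit_I) = (norm (cls (X \<omega>) + (- \<mu>X)))\<^sup>2"
      using Z XL meanX_L2 by (simp add: cls_diff[symmetric] norm_cls L2_norm_def)
    also have "B * \<dots> \<le> B * (2 * (norm (cls (X \<omega>)))\<^sup>2 + 2 * (norm (- \<mu>X))\<^sup>2)"
      by (intro mult_left_mono norm_add_square_le B0)
    finally have "(norm (cls ?BZ))\<^sup>2 \<le> B * (2 * (norm (cls (X \<omega>)))\<^sup>2 + 2 * (norm \<mu>X)\<^sup>2)" by simp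
    moreover have "(norm (cls (EYX \<omega>)))\<^sup>2 \<le> 2 * (norm \<mu>Y)\<^sup>2 + 2 * (norm (cls ?BZ))\<^sup>2"
      unfolding elim(1) by (rule norm_add_square_le)
    moreover have "norm (cls (EYX \<omega>)) = L2_norm unit_I (EYX \<omega>)" "norm (cls (X \<omega>)) = L2_norm unit_I (X \<omega>)"
      using norm_cls[OF L2_randomD(3)[OF EYX_random elim(2)]] norm_cls[OF XL] by auto
    ultimately show ?case by simp
  qed
qed

lemma err_joint: "(\<lambda>(\<omega>, s). err \<omega> s) \<in> L2 (M \<Otimes>\<^sub>M unit_I)"
  using L2_diff[OF L2_random_jointly_square_integrable[OF Y Y2]
      L2_random_jointly_square_integrable[OF EYX_random EYX_square_integrable]]
  by (simp add: err_def case_prod_beta')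

lemma err_L2: "\<omega> \<in> space M \<Longrightarrow> err \<omega> \<in> L2 unit_I"
  unfolding err_def[abs_def] by (intro L2_diff L2_randomD(3)[OF Y] L2_randomD(3)[OF EYX_random])

lemma err_norm_integrable: "integrable M (\<lambda>\<omega>. (L2_norm unit_I (err \<omega>))\<^sup>2)"
proof -
  interpret P: pair_prob_space M unit_I by (rule pair_prob_space_unit_I)
  have "integrable (M \<Otimes>\<^sub>M unit_I) (\<lambda>(\<omega>, s). (err \<omega> s)\<^sup>2)"
    using L2_square_integrable[OF err_joint] by (simp add: case_prod_beta')
  from P.integrable_fst[OF this] show ?thesis by (simp add: L2_norm_def)
qed

lemma resid_eq_err: "AE \<omega> in M. \<forall>j\<ge>1. resid j (XY \<omega>) = cls (err \<omega>) \<bullet> e j"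
  using EYX_decomposition AE_space
proof eventually_elim
  case (elim \<omega>)
  show ?case
  proof (intro allI impI)
    fix j :: nat assume j: "j \<ge> 1"
    have XL: "X \<omega> \<in> L2 unit_I" "Y \<omega> \<in> L2 unit_I" "EYX \<omega> \<in> L2 unit_I"
      using L2_randomD(3)[OF X elim(2)] L2_randomD(3)[OF Y elim(2)] L2_randomD(3)[OF EYX_random elim(2)] by auto
    have Z: "(\<lambda>t. X \<omega> t - mean_fun M X t) \<in> L2 unit_I" by (intro L2_diff XL meanX_L2)
    have "(cls (X \<omega>) - \<mu>X) \<bullet> cls (brow j) = cls (\<lambda>s. \<integral>t. b s t * (X \<omega> t - mean_fun M X t) \<partial>unit_I) \<bullet> e j"
      using brow_coefficient(2)[OF j Z] XL meanX_L2 by (simp add: cls_diff inner_commute)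
    moreover have "cls (err \<omega>) = cls (Y \<omega>) - cls (EYX \<omega>)"
      unfolding err_def[abs_def] by (rule cls_diff[OF XL(2,3)])
    ultimately show "resid j (XY \<omega>) = cls (err \<omega>) \<bullet> e j"
      by (simp add: resid_def elim(1) inner_diff_left inner_add_left)
  qed
qed

lemma resid_L2: "j \<ge> 1 \<Longrightarrow> (\<lambda>\<omega>. resid j (XY \<omega>)) \<in> L2 M"
  unfolding resid_def inner_diff_left fst_conv snd_conv
  by (intro L2_diff L2_const mean_fun_of_random_element(2)[OF X X2]
      mean_fun_of_random_element(2)[OF Y Y2] \<phi>_L2 brow_L2)

text \<open>The defining property of the conditional expectation holds for almost every \<open>s\<close> with an exceptional set
  that depends on the event; integration against \<open>g\<close> removes that dependence.\<close>

lemma err_integral_zero: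
  assumes A: "A \<in> sets (sigma_gen M X)" and g: "g \<in> L2 unit_I"
  shows "(\<integral>\<omega>. indicator A \<omega> * (cls (err \<omega>) \<bullet> cls g) \<partial>M) = 0"
proof -
  interpret P: pair_prob_space M unit_I by (rule pair_prob_space_unit_I)
  have AM: "A \<in> sets M" using A subalg by (auto simp: subalgebra_def)
  have I: "(indicator A :: 'w \<Rightarrow> real) \<in> L2 M"
    using AM by (auto simp: L2_def power2_eq_square indicator_inter_arith[symmetric] less_top[symmetric]
        intro!: integrable_real_indicator)
  have YA: "AE s in unit_I. (\<lambda>\<omega>. Y \<omega> s) \<in> L2 M" "AE s in unit_I. (\<lambda>\<omega>. EYX \<omega> s) \<in> L2 M"
    by (rule P.L2_kernel(6)[OF L2_random_jointly_square_integrable[OF Y Y2] L2_zero L2_zero])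
       (rule P.L2_kernel(6)[OF L2_random_jointly_square_integrable[OF EYX_random EYX_square_integrable] L2_zero L2_zero])
  have "AE s in unit_I. (LINT \<omega>:A|M. EYX \<omega> s) = (LINT \<omega>:A|M. Y \<omega> s)"
    using EYX A by (simp add: L2_cond_exp_def)
  with YA have "AE s in unit_I. (\<integral>\<omega>. err \<omega> s * indicator A \<omega> \<partial>M) = 0"
  proof eventually_elim
    case (elim s)
    have "(\<integral>\<omega>. err \<omega> s * indicator A \<omega> \<partial>M) = (\<integral>\<omega>. Y \<omega> s * indicator A \<omega> - EYX \<omega> s * indicator A \<omega> \<partial>M)"
      by (simp add: err_def algebra_simps)
    also have "\<dots> = (\<integral>\<omega>. Y \<omega> s * indicator A \<omega> \<partial>M) - (\<integral>\<omega>. EYX \<omega> s * indicator A \<omega> \<partial>M)"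
      by (intro Bochner_Integration.integral_diff L2_mult_integrable elim I)
    also have "\<dots> = 0"
      using elim(3) by (simp add: set_lebesgue_integral_def mult.commute)
    finally show ?case .
  qed
  then have "L2_inner unit_I (\<lambda>s. \<integral>\<omega>. err \<omega> s * indicator A \<omega> \<partial>M) g = (\<integral>s. 0 \<partial>unit_I)"
    unfolding L2_inner_def using L2_measurable[OF g] L2_measurable[OF P.L2_kernel(1)[OF err_joint I g]]
    by (intro integral_cong_AE) (auto elim!: eventually_mono)
  then have "L2_inner M (\<lambda>\<omega>. \<integral>s. err \<omega> s * g s \<partial>unit_I) (indicator A) = 0"
    using P.L2_kernel(3,4)[OF err_joint I g] by simp
  moreover have "L2_inner M (\<lambda>\<omega>. \<integral>s. err \<omega> s * g s \<partial>unit_I) (indicator A) = (\<integral>\<omega>. indicator A \<omega> * (cls (err \<omega>) \<bullet> cls g) \<partial>M)"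
    unfolding L2_inner_def using g err_L2
    by (intro Bochner_Integration.integral_cong) (auto simp: inner_cls L2_inner_def)
  ultimately show ?thesis by simp
qed

lemma resid_orthogonal:
  assumes j: "j \<ge> 1" and f: "f \<in> borel_measurable (sigma_gen M X)" "f \<in> L2 M"
  shows "expectation (\<lambda>\<omega>. f \<omega> * resid j (XY \<omega>)) = 0"
proof -
  have rm: "(\<lambda>\<omega>. resid j (XY \<omega>)) \<in> borel_measurable M"
    by (rule L2_measurable[OF resid_L2[OF j]])
  have "AE \<omega> in M. real_cond_exp M (sigma_gen M X) (\<lambda>\<omega>. resid j (XY \<omega>)) \<omega> = 0"
  proof (rule real_cond_exp_charact)
    fix A assume A: "A \<in> sets (sigma_gen M X)"
    have AM: "A \<in> sets M" using A subalg by (auto simp: subalgebra_def)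
    have em: "(\<lambda>\<omega>. cls (err \<omega>) \<bullet> e j) \<in> borel_measurable M"
    proof -
      have "(\<lambda>\<omega>. cls (Y \<omega>) \<bullet> e j - cls (EYX \<omega>) \<bullet> e j) \<in> borel_measurable M"
        using measurable_compose[OF L2_randomD(1)[OF Y] measurable_inner_L2_borel[OF \<phi>_L2[OF j]]]
          measurable_compose[OF L2_randomD(1)[OF EYX_random] measurable_inner_L2_borel[OF \<phi>_L2[OF j]]]
        by measurable
      also have "?this \<longleftrightarrow> ?thesis"
        unfolding err_def[abs_def]
        by (intro measurable_cong)
           (simp add: cls_diff L2_randomD(3)[OF Y] L2_randomD(3)[OF EYX_random] inner_diff_left)
      finally show ?thesis .
    qed
    have "(\<integral>\<omega>\<in>A. resid j (XY \<omega>) \<partial>M) = (\<integral>\<omega>. indicator A \<omega> * (cls (err \<omega>) \<bullet> e j) \<partial>M)"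
      unfolding set_lebesgue_integral_def
      using resid_eq_err rm em AM j by (intro integral_cong_AE) (auto elim!: eventually_mono)
    then show "(\<integral>\<omega>\<in>A. resid j (XY \<omega>) \<partial>M) = (\<integral>\<omega>\<in>A. 0 \<partial>M)"
      using err_integral_zero[OF A \<phi>_L2[OF j]] by (simp add: set_lebesgue_integral_def)
  qed (use L2_integrable[OF resid_L2[OF j]] in auto)
  then have "expectation (\<lambda>\<omega>. f \<omega> * real_cond_exp M (sigma_gen M X) (\<lambda>\<omega>. resid j (XY \<omega>)) \<omega>) = expectation (\<lambda>\<omega>. 0)"
    using measurable_from_subalg[OF subalg f(1)] by (intro integral_cong_AE) (auto elim!: eventually_mono)
  then show ?thesis
    using real_cond_exp_intg(2)[OF L2_mult_integrable[OF f(2) resid_L2[OF j]] f(1) rm] by simp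
qed

lemma score_generated: "k \<ge> 1 \<Longrightarrow> (\<lambda>\<omega>. score k (XY \<omega>)) \<in> borel_measurable (sigma_gen M X)"
  unfolding score_def inner_diff_left fst_conv
  by (intro borel_measurable_diff borel_measurable_const
      measurable_compose[OF X_generated measurable_inner_L2_borel] \<phi>_L2)

lemma resid_mean: "j \<ge> 1 \<Longrightarrow> expectation (\<lambda>\<omega>. resid j (XY \<omega>)) = 0"
  using resid_orthogonal[of j "\<lambda>_. 1"] by (simp add: L2_const)

lemma resid_score: "j \<ge> 1 \<Longrightarrow> k \<ge> 1 \<Longrightarrow> expectation (\<lambda>\<omega>. resid j (XY \<omega>) * score k (XY \<omega>)) = 0"
  using resid_orthogonal[OF _ score_generated score_L2, of j k] by (simp add: mult.commute)

text \<open>By Bessel's inequality the squared residual coordinates add up to at most the squared norm of the error,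
  whose conditional expectation is bounded.\<close>

lemma weighted_resid_square:
  assumes f: "f \<in> borel_measurable (sigma_gen M X)" "integrable M f" "\<And>\<omega>. 0 \<le> f \<omega>"
  shows "j \<ge> 1 \<Longrightarrow> integrable M (\<lambda>\<omega>. f \<omega> * (resid j (XY \<omega>))\<^sup>2)"
    and "(\<Sum>j=1..J. expectation (\<lambda>\<omega>. f \<omega> * (resid j (XY \<omega>))\<^sup>2)) \<le> C * expectation f"
proof -
  have err2': "AE \<omega> in M. real_cond_exp M (sigma_gen M X) (\<lambda>\<omega>'. (L2_norm unit_I (err \<omega>'))\<^sup>2) \<omega> \<le> C"
    using err2 by (simp add: err_def[abs_def])
  note dom = integral_mult_le_of_cond_exp_le[OF f err_norm_integrable zero_le_power2 err2' less_imp_le[OF C_pos]]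
  have bes: "AE \<omega> in M. \<forall>J. (\<Sum>j=1..J. f \<omega> * (resid j (XY \<omega>))\<^sup>2) \<le> f \<omega> * (L2_norm unit_I (err \<omega>))\<^sup>2"
    using resid_eq_err AE_space
  proof eventually_elim
    case (elim \<omega>)
    show ?case
    proof
      fix J :: nat
      have "(\<Sum>j=1..J. (resid j (XY \<omega>))\<^sup>2) = (\<Sum>j=1..J. (cls (err \<omega>) \<bullet> e j)\<^sup>2)"
        using elim(1) by (intro sum.cong) auto
      also have "\<dots> \<le> (norm (cls (err \<omega>)))\<^sup>2"
        by (intro bessel onb) auto
      finally show "(\<Sum>j=1..J. f \<omega> * (resid j (XY \<omega>))\<^sup>2) \<le> f \<omega> * (L2_norm unit_I (err \<omega>))\<^sup>2"
        unfolding sum_distrib_left[symmetric] using f(3) err_L2[OF elim(2)]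
        by (intro mult_left_mono) (auto simp: norm_cls)
    qed
  qed
  have fm: "f \<in> borel_measurable M" by (rule measurable_from_subalg[OF subalg f(1)])
  show int: "integrable M (\<lambda>\<omega>. f \<omega> * (resid j (XY \<omega>))\<^sup>2)" if j: "j \<ge> 1" for j
  proof (rule Bochner_Integration.integrable_bound[OF dom(1)])
    show "(\<lambda>\<omega>. f \<omega> * (resid j (XY \<omega>))\<^sup>2) \<in> borel_measurable M"
      using fm L2_measurable[OF resid_L2[OF j]] by measurable
    show "AE \<omega> in M. norm (f \<omega> * (resid j (XY \<omega>))\<^sup>2) \<le> norm (f \<omega> * (L2_norm unit_I (err \<omega>))\<^sup>2)"
      using bes
    proof eventually_elim
      case (elim \<omega>)
      have "f \<omega> * (resid j (XY \<omega>))\<^sup>2 \<le> (\<Sum>j=1..j. f \<omega> * (resid j (XY \<omega>))\<^sup>2)"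
        using f(3) j by (intro member_le_sum) auto
      also have "\<dots> \<le> f \<omega> * (L2_norm unit_I (err \<omega>))\<^sup>2" using elim by blast
      finally show ?case using f(3) by simp
    qed
  qed
  have "(\<Sum>j=1..J. expectation (\<lambda>\<omega>. f \<omega> * (resid j (XY \<omega>))\<^sup>2)) = expectation (\<lambda>\<omega>. \<Sum>j=1..J. f \<omega> * (resid j (XY \<omega>))\<^sup>2)"
    using int by (intro Bochner_Integration.integral_sum[symmetric]) auto
  also have "\<dots> \<le> expectation (\<lambda>\<omega>. f \<omega> * (L2_norm unit_I (err \<omega>))\<^sup>2)"
    using int dom(1) bes by (intro integral_mono_AE Bochner_Integration.integrable_sum) (auto elim!: eventually_mono)
  also have "\<dots> \<le> C * expectation f" by (rule dom(2))
  finally show "(\<Sum>j=1..J. expectation (\<lambda>\<omega>. f \<omega> * (resid j (XY \<omega>))\<^sup>2)) \<le> C * expectation f" .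
qed

lemma resid_total: "(\<Sum>j=1..J. expectation (\<lambda>\<omega>. (resid j (XY \<omega>))\<^sup>2)) \<le> C"
proof -
  have "(\<Sum>j=1..J. expectation (\<lambda>\<omega>. 1 * (resid j (XY \<omega>))\<^sup>2)) \<le> C * expectation (\<lambda>\<omega>. 1)"
    by (rule weighted_resid_square(2)) auto
  moreover have "expectation (\<lambda>\<omega>. 1) = (1 :: real)" by (simp add: prob_space)
  ultimately show ?thesis by (simp only: mult_1 mult_1_right)
qed

lemma resid_score_square:
  assumes "k \<ge> 1"
  shows "j \<ge> 1 \<Longrightarrow> integrable M (\<lambda>\<omega>. (resid j (XY \<omega>) * score k (XY \<omega>))\<^sup>2)"
    and "(\<Sum>j=1..J. expectation (\<lambda>\<omega>. (resid j (XY \<omega>) * score k (XY \<omega>))\<^sup>2)) \<le> C * \<kappa> k"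
proof -
  have m: "(\<lambda>\<omega>. (score k (XY \<omega>))\<^sup>2) \<in> borel_measurable (sigma_gen M X)"
    using score_generated[OF assms] by measurable
  have i: "integrable M (\<lambda>\<omega>. (score k (XY \<omega>))\<^sup>2)"
    by (rule L2_square_integrable[OF score_L2[OF assms]])
  note w = weighted_resid_square[OF m i zero_le_power2]
  have eq: "(x * y)\<^sup>2 = y\<^sup>2 * x\<^sup>2" for x y :: real
    by (simp add: power_mult_distrib)
  show "j \<ge> 1 \<Longrightarrow> integrable M (\<lambda>\<omega>. (resid j (XY \<omega>) * score k (XY \<omega>))\<^sup>2)"
    unfolding eq by (rule w(1))
  have "expectation (\<lambda>\<omega>. (score k (XY \<omega>))\<^sup>2) = \<kappa> k"
    using score_covariance[OF assms assms] by (simp add: power2_eq_square)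
  then show "(\<Sum>j=1..J. expectation (\<lambda>\<omega>. (resid j (XY \<omega>) * score k (XY \<omega>))\<^sup>2)) \<le> C * \<kappa> k"
    unfolding eq using w(2)[of J] by simp
qed

end

section \<open>Population and empirical covariance forms\<close>

text \<open>The series converges on the diagonal because its terms are nonnegative and the \<open>\<kappa> k\<close> are bounded, and
  everywhere by polarisation.\<close>

lemma diagonal_form_exists:
  fixes e :: "nat \<Rightarrow> 'a::real_inner"
  assumes e: "orthonormal_basis e" and nonneg: "\<And>k. k \<ge> 1 \<Longrightarrow> 0 \<le> \<kappa> k"
    and dec: "\<And>j k. 1 \<le> j \<Longrightarrow> j \<le> k \<Longrightarrow> \<kappa> k \<le> \<kappa> j"
  shows "\<exists>Q. diagonalised_by Q \<kappa> e"
proof -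
  have sq: "convergent (\<lambda>N. \<Sum>k=1..N. \<kappa> k * (x \<bullet> e k)\<^sup>2)" for x
  proof (rule Bseq_mono_convergent)
    have "norm (\<Sum>k=1..N. \<kappa> k * (x \<bullet> e k)\<^sup>2) \<le> \<kappa> 1 * (norm x)\<^sup>2" for N
    proof -
      have "(\<Sum>k=1..N. \<kappa> k * (x \<bullet> e k)\<^sup>2) \<le> (\<Sum>k=1..N. \<kappa> 1 * (x \<bullet> e k)\<^sup>2)"
        by (intro sum_mono mult_right_mono dec) auto
      also have "\<dots> \<le> \<kappa> 1 * (norm x)\<^sup>2"
        unfolding sum_distrib_left[symmetric] using nonneg
        by (intro mult_left_mono bessel e) auto
      finally have "(\<Sum>k=1..N. \<kappa> k * (x \<bullet> e k)\<^sup>2) \<le> \<kappa> 1 * (norm x)\<^sup>2" .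
      moreover have "0 \<le> (\<Sum>k=1..N. \<kappa> k * (x \<bullet> e k)\<^sup>2)"
        using nonneg by (intro sum_nonneg mult_nonneg_nonneg) auto
      ultimately show ?thesis by simp
    qed
    then show "Bseq (\<lambda>N. \<Sum>k=1..N. \<kappa> k * (x \<bullet> e k)\<^sup>2)" by (rule BseqI')
    show "\<forall>M N. M \<le> N \<longrightarrow> (\<Sum>k=1..M. \<kappa> k * (x \<bullet> e k)\<^sup>2) \<le> (\<Sum>k=1..N. \<kappa> k * (x \<bullet> e k)\<^sup>2)"
      using nonneg by (intro allI impI sum_mono2) auto
  qed
  have "convergent (\<lambda>N. \<Sum>k=1..N. \<kappa> k * ((x \<bullet> e k) * (y \<bullet> e k)))" for x y
  proof -
    have "(\<Sum>k=1..N. \<kappa> k * ((x \<bullet> e k) * (y \<bullet> e k)))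
        = ((\<Sum>k=1..N. \<kappa> k * ((x + y) \<bullet> e k)\<^sup>2) - (\<Sum>k=1..N. \<kappa> k * ((x - y) \<bullet> e k)\<^sup>2)) * (1 / 4)" for N
      unfolding sum_subtractf[symmetric] sum_distrib_right
      by (intro sum.cong) (auto simp: inner_add_left inner_diff_left power2_eq_square algebra_simps)
    then show ?thesis
      using convergent_mult[OF convergent_diff[OF sq[of "x + y"] sq[of "x - y"]] convergent_const[of "1/4"]]
      by presburger
  qed
  then have "diagonalised_by (\<lambda>x y. lim (\<lambda>N. \<Sum>k=1..N. \<kappa> k * ((x \<bullet> e k) * (y \<bullet> e k)))) \<kappa> e"
    using e nonneg dec unfolding diagonalised_by_def convergent_LIMSEQ_iff[symmetric] by auto
  then show ?thesis by blast
qed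

lemma empirical_form_diagonalised:
  fixes c :: "'i \<Rightarrow> 'a::real_inner"
  assumes e: "orthonormal_basis e" and nonneg: "\<And>k. k \<ge> 1 \<Longrightarrow> 0 \<le> \<kappa> k"
    and dec: "\<And>k. k \<ge> 1 \<Longrightarrow> \<kappa> (Suc k) \<le> \<kappa> k"
    and eig: "\<And>k. k \<ge> 1 \<Longrightarrow> (\<Sum>i\<in>I. ((c i \<bullet> e k) / r) *\<^sub>R c i) = \<kappa> k *\<^sub>R e k"
  shows "diagonalised_by (\<lambda>x y. (\<Sum>i\<in>I. (c i \<bullet> x) * (c i \<bullet> y)) / r) \<kappa> e"
proof -
  have "(\<lambda>N. \<Sum>k=1..N. \<kappa> k * ((x \<bullet> e k) * (y \<bullet> e k))) \<longlonglongrightarrow> (\<Sum>i\<in>I. (c i \<bullet> x) * (c i \<bullet> y)) / r" for x y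
  proof -
    define T where "T = (\<Sum>i\<in>I. ((c i \<bullet> x) / r) *\<^sub>R c i)"
    have "T \<bullet> e k = \<kappa> k * (x \<bullet> e k)" if "k \<ge> 1" for k
    proof -
      have "T \<bullet> e k = x \<bullet> (\<Sum>i\<in>I. ((c i \<bullet> e k) / r) *\<^sub>R c i)"
        by (simp add: T_def inner_sum_left inner_sum_right inner_commute mult.commute)
      then show ?thesis by (simp add: eig[OF that])
    qed
    then have "(\<Sum>k=1..N. (T \<bullet> e k) * (y \<bullet> e k)) = (\<Sum>k=1..N. \<kappa> k * ((x \<bullet> e k) * (y \<bullet> e k)))" for N
      by (intro sum.cong) auto
    moreover have "T \<bullet> y = (\<Sum>i\<in>I. (c i \<bullet> x) * (c i \<bullet> y)) / r"
      by (simp add: T_def inner_sum_left sum_divide_distrib)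
    ultimately show ?thesis
      using parseval[OF e, of T y] by simp
  qed
  moreover have "\<kappa> k \<le> \<kappa> j" if "1 \<le> j" "j \<le> k" for j k
    using that(2)
  proof (induction k rule: dec_induct)
    case (step n)
    then show ?case using dec[of n] that(1) by simp
  qed simp
  ultimately show ?thesis
    using e nonneg by (simp add: diagonalised_by_def)
qed

text \<open>Apart from the correction for the sample mean, which contributes at most \<open>\<parallel>zbar\<parallel>\<^sup>2\<close>, the difference of
  the two forms has the matrix in the hypothesis, and the Hilbert-Schmidt norm of the matrix bounds the
  form. It is enough to see this on finite combinations of basis vectors.\<close>

lemma empirical_form_perturbation:
  fixes z :: "nat \<Rightarrow> 'a::real_inner"
  assumes Q: "diagonalised_by Q \<kappa> e" and n: "n \<ge> 1"
    and zbar: "zbar = (\<Sum>i=1..n. z i) /\<^sub>R real n" and c: "\<And>i. c i = z i - zbar"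
    and A: "\<And>N. (\<Sum>k=1..N. \<Sum>l=1..N. ((\<Sum>i=1..n. (z i \<bullet> e k) * (z i \<bullet> e l)) / real n - (if k = l then \<kappa> k else 0))\<^sup>2) \<le> t"
    and bar: "\<And>N. (\<Sum>k=1..N. (zbar \<bullet> e k)\<^sup>2) \<le> u"
  shows "\<bar>Q x y - (\<Sum>i=1..n. (c i \<bullet> x) * (c i \<bullet> y)) / real n\<bar> \<le> (sqrt t + u) * norm x * norm y"
proof -
  note e = diagonalised_byD(1)[OF Q]
  have nz: "(norm zbar)\<^sup>2 \<le> u"
    by (rule LIMSEQ_le_const2[OF parseval_norm[OF e]]) (use bar in auto)
  define R where "R x y = (\<Sum>i=1..n. (z i \<bullet> x) * (z i \<bullet> y)) / real n" for x y
  have split: "(\<Sum>i=1..n. (c i \<bullet> x) * (c i \<bullet> y)) / real n = R x y - (zbar \<bullet> x) * (zbar \<bullet> y)"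
  proof -
    have s: "(\<Sum>i=1..n. z i \<bullet> v) = real n * (zbar \<bullet> v)" for v
      using n by (simp add: zbar inner_sum_left)
    have "(\<Sum>i=1..n. (c i \<bullet> x) * (c i \<bullet> y))
        = (\<Sum>i=1..n. (z i \<bullet> x) * (z i \<bullet> y) - (z i \<bullet> x) * (zbar \<bullet> y) - (zbar \<bullet> x) * (z i \<bullet> y) + (zbar \<bullet> x) * (zbar \<bullet> y))"
      by (intro sum.cong) (auto simp: c inner_diff_left algebra_simps)
    also have "\<dots> = (\<Sum>i=1..n. (z i \<bullet> x) * (z i \<bullet> y)) - (\<Sum>i=1..n. z i \<bullet> x) * (zbar \<bullet> y)
        - (zbar \<bullet> x) * (\<Sum>i=1..n. z i \<bullet> y) + real n * ((zbar \<bullet> x) * (zbar \<bullet> y))"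
      by (simp add: sum.distrib sum_subtractf sum_distrib_left sum_distrib_right)
    also have "\<dots> = (\<Sum>i=1..n. (z i \<bullet> x) * (z i \<bullet> y)) - real n * ((zbar \<bullet> x) * (zbar \<bullet> y))"
      unfolding s by simp
    finally show ?thesis using n by (simp add: R_def diff_divide_distrib)
  qed
  have "\<bar>R x y - Q x y\<bar> \<le> sqrt t * norm x * norm y"
  proof -
    define p where "p N v = (\<Sum>k=1..N. (v \<bullet> e k) *\<^sub>R e k)" for N v
    have p: "(\<lambda>N. p N v) \<longlonglongrightarrow> v" for v
      using e unfolding p_def orthonormal_basis_def by blast
    show ?thesis
    proof (rule LIMSEQ_le_const2)
      show "(\<lambda>N. \<bar>R (p N x) (p N y) - (\<Sum>k=1..N. \<kappa> k * ((x \<bullet> e k) * (y \<bullet> e k)))\<bar>) \<longlonglongrightarrow> \<bar>R x y - Q x y\<bar>"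
        unfolding R_def using n by (intro tendsto_intros p diagonalised_byD(4)[OF Q]) auto
      have "\<bar>R (p N x) (p N y) - (\<Sum>k=1..N. \<kappa> k * ((x \<bullet> e k) * (y \<bullet> e k)))\<bar> \<le> sqrt t * norm x * norm y" for N
      proof -
        define a where "a k l = (\<Sum>i=1..n. (z i \<bullet> e k) * (z i \<bullet> e l)) / real n - (if k = l then \<kappa> k else 0)" for k l
        have "R (p N x) (p N y) = (\<Sum>i=1..n. (\<Sum>k=1..N. \<Sum>l=1..N. ((x \<bullet> e k) * (z i \<bullet> e k)) * ((y \<bullet> e l) * (z i \<bullet> e l)))) / real n"
          by (simp add: R_def p_def inner_sum_right sum_product)
        also have "\<dots> = (\<Sum>k=1..N. \<Sum>l=1..N. \<Sum>i=1..n. ((x \<bullet> e k) * (z i \<bullet> e k)) * ((y \<bullet> e l) * (z i \<bullet> e l))) / real n"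
          by (subst sum.swap, intro arg_cong[where f="\<lambda>x. x / real n"] sum.cong refl sum.swap)
        also have "\<dots> = (\<Sum>k=1..N. \<Sum>l=1..N. ((x \<bullet> e k) * (y \<bullet> e l)) * ((\<Sum>i=1..n. (z i \<bullet> e k) * (z i \<bullet> e l)) / real n))"
          unfolding sum_divide_distrib sum_distrib_left by (intro sum.cong) auto
        finally have 1: "R (p N x) (p N y) = (\<Sum>k=1..N. \<Sum>l=1..N. ((x \<bullet> e k) * (y \<bullet> e l)) * ((\<Sum>i=1..n. (z i \<bullet> e k) * (z i \<bullet> e l)) / real n))" .
        have 2: "(\<Sum>k=1..N. \<kappa> k * ((x \<bullet> e k) * (y \<bullet> e k))) = (\<Sum>k=1..N. \<Sum>l=1..N. ((x \<bullet> e k) * (y \<bullet> e l)) * (if k = l then \<kappa> k else 0))"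
          by (intro sum.cong refl) (simp add: if_distrib[where f="\<lambda>c. _ * c"] cong: if_cong)
        have "R (p N x) (p N y) - (\<Sum>k=1..N. \<kappa> k * ((x \<bullet> e k) * (y \<bullet> e k)))
            = (\<Sum>k=1..N. \<Sum>l=1..N. a k l * ((x \<bullet> e k) * (y \<bullet> e l)))"
          unfolding 1 2 sum_subtractf[symmetric] by (intro sum.cong refl) (simp add: a_def algebra_simps)
        also have "\<dots> = (\<Sum>q\<in>{1..N}\<times>{1..N}. a (fst q) (snd q) * ((x \<bullet> e (fst q)) * (y \<bullet> e (snd q))))"
          by (simp add: sum.cartesian_product case_prod_beta')
        finally have "(R (p N x) (p N y) - (\<Sum>k=1..N. \<kappa> k * ((x \<bullet> e k) * (y \<bullet> e k))))\<^sup>2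
            \<le> (\<Sum>q\<in>{1..N}\<times>{1..N}. (a (fst q) (snd q))\<^sup>2) * (\<Sum>q\<in>{1..N}\<times>{1..N}. ((x \<bullet> e (fst q)) * (y \<bullet> e (snd q)))\<^sup>2)"
          using Cauchy_Schwarz_ineq_sum by simp
        also have "(\<Sum>q\<in>{1..N}\<times>{1..N}. ((x \<bullet> e (fst q)) * (y \<bullet> e (snd q)))\<^sup>2)
            = (\<Sum>k=1..N. (x \<bullet> e k)\<^sup>2) * (\<Sum>l=1..N. (y \<bullet> e l)\<^sup>2)"
          by (simp add: sum_product sum.cartesian_product case_prod_beta' power_mult_distrib)
        also have "(\<Sum>q\<in>{1..N}\<times>{1..N}. (a (fst q) (snd q))\<^sup>2) = (\<Sum>k=1..N. \<Sum>l=1..N. (a k l)\<^sup>2)"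
          by (simp add: sum.cartesian_product case_prod_beta')
        also have "(\<Sum>k=1..N. \<Sum>l=1..N. (a k l)\<^sup>2) * ((\<Sum>k=1..N. (x \<bullet> e k)\<^sup>2) * (\<Sum>l=1..N. (y \<bullet> e l)\<^sup>2))
            \<le> t * ((norm x)\<^sup>2 * (norm y)\<^sup>2)"
          using A[of 0] by (intro mult_mono A[folded a_def] bessel[OF e] mult_nonneg_nonneg sum_nonneg) auto
        also have "\<dots> = (sqrt t * norm x * norm y)\<^sup>2"
          using A[of 0] by (simp add: power_mult_distrib)
        finally have "\<bar>R (p N x) (p N y) - (\<Sum>k=1..N. \<kappa> k * ((x \<bullet> e k) * (y \<bullet> e k)))\<bar> \<le> \<bar>sqrt t * norm x * norm y\<bar>"
          by (simp only: abs_le_square_iff)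
        moreover have "0 \<le> sqrt t * norm x * norm y"
          using A[of 0] by simp
        ultimately show ?thesis by simp
      qed
      then show "\<exists>N0. \<forall>N\<ge>N0. \<bar>R (p N x) (p N y) - (\<Sum>k=1..N. \<kappa> k * ((x \<bullet> e k) * (y \<bullet> e k)))\<bar> \<le> sqrt t * norm x * norm y"
        by blast
    qed
  qed
  moreover have "\<bar>(zbar \<bullet> x) * (zbar \<bullet> y)\<bar> \<le> u * norm x * norm y"
  proof -
    have "\<bar>(zbar \<bullet> x) * (zbar \<bullet> y)\<bar> \<le> (norm zbar * norm x) * (norm zbar * norm y)"
      unfolding abs_mult by (intro mult_mono Cauchy_Schwarz_ineq2) auto
    also have "\<dots> = (norm zbar)\<^sup>2 * (norm x * norm y)"
      by (simp add: power2_eq_square)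
    also have "\<dots> \<le> u * (norm x * norm y)"
      by (intro mult_right_mono nz) auto
    finally show ?thesis by simp
  qed
  ultimately show ?thesis
    unfolding split by (simp add: algebra_simps abs_le_iff)
qed

section \<open>The estimator in coordinates\<close>

locale functional_linear_sample =
  functional_linear_model M X Y EYX b \<kappa> \<phi> C + polynomial_eigenvalues \<kappa> \<alpha> C
  for M :: "'w measure" and X Y EYX :: "'w \<Rightarrow> real \<Rightarrow> real" and b :: "real \<Rightarrow> real \<Rightarrow> real"
    and \<kappa> :: "nat \<Rightarrow> real" and \<phi> :: "nat \<Rightarrow> real \<Rightarrow> real" and C \<alpha> :: real +
  fixes Xs Ys :: "nat \<Rightarrow> 'w \<Rightarrow> real \<Rightarrow> real"
    and \<kappa>h :: "nat \<Rightarrow> 'w \<Rightarrow> nat \<Rightarrow> real" and \<phi>h :: "nat \<Rightarrow> 'w \<Rightarrow> nat \<Rightarrow> real \<Rightarrow> real"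
    and \<beta> \<gamma> :: real
  assumes copies: "indep_copies M X Y Xs Ys"
    and sample_spectrum: "\<And>n \<omega>. n \<ge> 1 \<Longrightarrow> \<omega> \<in> space M \<Longrightarrow>
          spectral_expansion (sample_cov Xs n \<omega>) (\<kappa>h n \<omega>) (\<phi>h n \<omega>)"
    and \<beta>: "\<beta> > \<alpha> / 2 + 1" and \<gamma>: "\<gamma> > 1 / 2"
    and coefficients: "\<And>j k. j \<ge> 1 \<Longrightarrow> k \<ge> 1 \<Longrightarrow>
          \<bar>\<integral>(s, t). b s t * \<phi> j s * \<phi> k t \<partial>unit_I2\<bar> \<le> C * real j powr (-\<gamma>) * real k powr (-\<beta>)"
begin

abbreviation XYs :: "nat \<Rightarrow> 'w \<Rightarrow> (real \<Rightarrow> real) \<times> (real \<Rightarrow> real)" where "XYs i \<omega> \<equiv> (Xs i \<omega>, Ys i \<omega>)"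

abbreviation eh :: "nat \<Rightarrow> 'w \<Rightarrow> nat \<Rightarrow> l2" where "eh n \<omega> k \<equiv> cls (\<phi>h n \<omega> k)"

text \<open>The vectors \<open>z \<omega> i\<close> are centred at the population mean and hence independent of each other, whereas the
  estimator is built from the vectors \<open>zc n \<omega> i\<close>, centred at the sample mean. The vectors
  \<open>noise n \<omega> j\<close> are the rows, in the basis \<open>\<phi>\<close>, of the empirical cross-covariance of residuals and
  regressors.\<close>

definition z :: "'w \<Rightarrow> nat \<Rightarrow> l2" where "z \<omega> i = cls (Xs i \<omega>) - \<mu>X"
definition zbar :: "nat \<Rightarrow> 'w \<Rightarrow> l2" where "zbar n \<omega> = (\<Sum>i=1..n. z \<omega> i) /\<^sub>R real n"
definition zc :: "nat \<Rightarrow> 'w \<Rightarrow> nat \<Rightarrow> l2" where "zc n \<omega> i = z \<omega> i - zbar n \<omega>"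
definition noise :: "nat \<Rightarrow> 'w \<Rightarrow> nat \<Rightarrow> l2" where
  "noise n \<omega> j = (\<Sum>i=1..n. resid j (XYs i \<omega>) *\<^sub>R zc n \<omega> i) /\<^sub>R real n"
definition avg :: "nat \<Rightarrow> 'w \<Rightarrow> ((real \<Rightarrow> real) \<times> (real \<Rightarrow> real) \<Rightarrow> real) \<Rightarrow> real" where
  "avg n \<omega> f = (\<Sum>i=1..n. f (XYs i \<omega>)) / real n"

lemma Xs_L2: "i \<ge> 1 \<Longrightarrow> \<omega> \<in> space M \<Longrightarrow> Xs i \<omega> \<in> L2 unit_I"
  and Ys_L2: "i \<ge> 1 \<Longrightarrow> \<omega> \<in> space M \<Longrightarrow> Ys i \<omega> \<in> L2 unit_I"
  using copies L2_randomD(3)[of M "Xs i" \<omega>] L2_randomD(3)[of M "Ys i" \<omega>] by (auto simp: indep_copies_def)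

lemma avg_mean_square:
  assumes f: "f \<in> borel_measurable (L2_borel \<Otimes>\<^sub>M L2_borel)" "integrable M (\<lambda>\<omega>. (f (XY \<omega>))\<^sup>2)"
    and n: "n \<ge> 1" and a: "expectation (\<lambda>\<omega>. f (XY \<omega>)) = a"
  shows "integrable M (\<lambda>\<omega>. (avg n \<omega> f - a)\<^sup>2)"
    and "expectation (\<lambda>\<omega>. (avg n \<omega> f - a)\<^sup>2) \<le> expectation (\<lambda>\<omega>. (f (XY \<omega>))\<^sup>2) / real n"
  unfolding avg_def
  by (rule mean_square_of_average[where S = "L2_borel \<Otimes>\<^sub>M L2_borel" and V = XY];
      use copies f n a in \<open>auto simp: indep_copies_def\<close>)+

lemma score_z: "score k (XYs i \<omega>) = z \<omega> i \<bullet> e k"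
  by (simp add: score_def z_def)

lemma zbar_avg: "zbar n \<omega> \<bullet> e k = avg n \<omega> (score k)"
  by (simp add: zbar_def avg_def score_z inner_sum_left divide_inverse mult.commute)

lemma zc_cls:
  assumes n: "n \<ge> 1" and \<omega>: "\<omega> \<in> space M" and i: "i \<ge> 1"
  shows "(\<lambda>t. Xs i \<omega> t - sample_mean Xs n \<omega> t) \<in> L2 unit_I"
    and "cls (\<lambda>t. Xs i \<omega> t - sample_mean Xs n \<omega> t) = zc n \<omega> i"
proof -
  have m: "sample_mean Xs n \<omega> = (\<lambda>t. inverse (real n) * (\<Sum>i=1..n. Xs i \<omega> t))"
    by (simp add: sample_mean_def fun_eq_iff field_simps)
  have S: "(\<lambda>t. \<Sum>i=1..n. Xs i \<omega> t) \<in> L2 unit_I"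
    using \<omega> by (intro L2_sum Xs_L2) auto
  have mL: "sample_mean Xs n \<omega> \<in> L2 unit_I"
    unfolding m by (intro L2_cmult S)
  show "(\<lambda>t. Xs i \<omega> t - sample_mean Xs n \<omega> t) \<in> L2 unit_I"
    by (intro L2_diff Xs_L2 \<omega> i mL)
  have "cls (sample_mean Xs n \<omega>) = (\<Sum>i=1..n. cls (Xs i \<omega>)) /\<^sub>R real n"
    unfolding m cls_cmult[OF S] using \<omega> by (subst cls_sum) (auto intro: Xs_L2)
  moreover have "zbar n \<omega> = (\<Sum>i=1..n. cls (Xs i \<omega>)) /\<^sub>R real n - \<mu>X"
    using n by (simp add: zbar_def z_def sum_subtractf scaleR_diff_right sum_constant_scaleR del: sum_constant)
  ultimately show "cls (\<lambda>t. Xs i \<omega> t - sample_mean Xs n \<omega> t) = zc n \<omega> i"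
    using cls_diff[OF Xs_L2[OF i \<omega>] mL] by (simp add: zc_def z_def)
qed

lemma sum_zc: "n \<ge> 1 \<Longrightarrow> (\<Sum>i=1..n. zc n \<omega> i) = 0"
  by (simp add: zc_def sum_subtractf sum_constant_scaleR zbar_def del: sum_constant)

lemma sample_basis: "n \<ge> 1 \<Longrightarrow> \<omega> \<in> space M \<Longrightarrow> L2_basis (\<phi>h n \<omega>)"
  using sample_spectrum by (simp add: spectral_expansion_def)

text \<open>The spectral expansion of the sample covariance kernel, restated for the centred vectors.\<close>

lemma sample_eigenvector:
  assumes n: "n \<ge> 1" and \<omega>: "\<omega> \<in> space M" and k: "k \<ge> 1"
  shows "(\<Sum>i=1..n. ((zc n \<omega> i \<bullet> eh n \<omega> k) / real n) *\<^sub>R zc n \<omega> i) = \<kappa>h n \<omega> k *\<^sub>R eh n \<omega> k"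
proof -
  define c where "c i t = Xs i \<omega> t - sample_mean Xs n \<omega> t" for i t
  have c: "c i \<in> L2 unit_I" "cls (c i) = zc n \<omega> i" if "i \<ge> 1" for i
    using zc_cls[OF n \<omega> that] by (simp_all add: c_def[abs_def])
  have f: "\<phi>h n \<omega> k \<in> L2 unit_I" by (rule L2_basisD(1)[OF sample_basis[OF n \<omega>] k])
  have op: "int_op (sample_cov Xs n \<omega>) (\<phi>h n \<omega> k) s = (\<Sum>i=1..n. ((zc n \<omega> i \<bullet> eh n \<omega> k) / real n) * c i s)" for s
  proof -
    have "int_op (sample_cov Xs n \<omega>) (\<phi>h n \<omega> k) s = (\<integral>t. (\<Sum>i=1..n. (c i s / real n) * (c i t * \<phi>h n \<omega> k t)) \<partial>unit_I)"
      unfolding int_op_def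
      by (intro Bochner_Integration.integral_cong refl)
         (simp add: sample_cov_def c_def sum_divide_distrib sum_distrib_right sum_distrib_left mult_ac)
    also have "\<dots> = (\<Sum>i=1..n. \<integral>t. (c i s / real n) * (c i t * \<phi>h n \<omega> k t) \<partial>unit_I)"
    proof (rule Bochner_Integration.integral_sum)
      fix i assume "i \<in> {1..n}"
      then have "c i \<in> L2 unit_I" by (intro c(1)) simp
      then show "integrable unit_I (\<lambda>t. (c i s / real n) * (c i t * \<phi>h n \<omega> k t))"
        by (rule integrable_mult_right[OF L2_mult_integrable[OF _ f]])
    qed
    also have "\<dots> = (\<Sum>i=1..n. (c i s / real n) * (\<integral>t. c i t * \<phi>h n \<omega> k t \<partial>unit_I))"
      by (intro sum.cong refl integral_mult_right_zero)
    also have "\<dots> = (\<Sum>i=1..n. ((zc n \<omega> i \<bullet> eh n \<omega> k) / real n) * c i s)"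
    proof (intro sum.cong refl)
      fix i assume "i \<in> {1..n}"
      then have "(\<integral>t. c i t * \<phi>h n \<omega> k t \<partial>unit_I) = zc n \<omega> i \<bullet> eh n \<omega> k"
        using inner_cls[OF c(1) f, of i] c(2)[of i] by (simp add: L2_inner_def)
      then show "(c i s / real n) * (\<integral>t. c i t * \<phi>h n \<omega> k t \<partial>unit_I) = ((zc n \<omega> i \<bullet> eh n \<omega> k) / real n) * c i s"
        by simp
    qed
    finally show ?thesis .
  qed
  have "(\<Sum>i=1..n. ((zc n \<omega> i \<bullet> eh n \<omega> k) / real n) *\<^sub>R zc n \<omega> i)
      = (\<Sum>i=1..n. ((zc n \<omega> i \<bullet> eh n \<omega> k) / real n) *\<^sub>R cls (c i))"
    by (intro sum.cong refl arg_cong[of _ _ "scaleR _"] c(2)[symmetric]) simp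
  also have "\<dots> = cls (\<lambda>s. \<Sum>i=1..n. ((zc n \<omega> i \<bullet> eh n \<omega> k) / real n) * c i s)"
    by (intro cls_lincomb[symmetric] c(1)) simp
  also have "\<dots> = cls (\<lambda>s. \<kappa>h n \<omega> k * \<phi>h n \<omega> k s)"
  proof (rule cls_eqI)
    show "(\<lambda>s. \<Sum>i=1..n. ((zc n \<omega> i \<bullet> eh n \<omega> k) / real n) * c i s) \<in> L2 unit_I"
      using c by (intro L2_sum L2_cmult) auto
    show "(\<lambda>s. \<kappa>h n \<omega> k * \<phi>h n \<omega> k s) \<in> L2 unit_I" by (intro L2_cmult f)
    show "AE s in unit_I. (\<Sum>i=1..n. ((zc n \<omega> i \<bullet> eh n \<omega> k) / real n) * c i s) = \<kappa>h n \<omega> k * \<phi>h n \<omega> k s"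
    proof -
      have "AE s in unit_I. int_op (sample_cov Xs n \<omega>) (\<phi>h n \<omega> k) s = \<kappa>h n \<omega> k * \<phi>h n \<omega> k s"
        using sample_spectrum[OF n \<omega>] k by (simp add: spectral_expansion_def)
      then show ?thesis unfolding op .
    qed
  qed
  also have "\<dots> = \<kappa>h n \<omega> k *\<^sub>R eh n \<omega> k" by (rule cls_cmult[OF f])
  finally show ?thesis .
qed

lemma sample_form_diagonalised:
  assumes n: "n \<ge> 1" and \<omega>: "\<omega> \<in> space M"
  shows "diagonalised_by (\<lambda>x y. (\<Sum>i=1..n. (zc n \<omega> i \<bullet> x) * (zc n \<omega> i \<bullet> y)) / real n) (\<kappa>h n \<omega>) (eh n \<omega>)"
  using sample_spectrum[OF n \<omega>] sample_eigenvector[OF n \<omega>]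
  by (intro empirical_form_diagonalised L2_basisD(2)[OF sample_basis[OF n \<omega>]]) (auto simp: spectral_expansion_def)

lemma noise_coefficient:
  assumes n: "n \<ge> 1"
  shows "noise n \<omega> j \<bullet> e k = avg n \<omega> (\<lambda>p. resid j p * score k p) - avg n \<omega> (resid j) * avg n \<omega> (score k)"
proof -
  have "noise n \<omega> j \<bullet> e k = (\<Sum>i=1..n. resid j (XYs i \<omega>) * (zc n \<omega> i \<bullet> e k)) / real n"
    by (simp add: noise_def inner_sum_left field_simps)
  also have "\<dots> = (\<Sum>i=1..n. resid j (XYs i \<omega>) * score k (XYs i \<omega>) - resid j (XYs i \<omega>) * avg n \<omega> (score k)) / real n"
    by (simp add: zc_def inner_diff_left score_z zbar_avg right_diff_distrib)
  also have "\<dots> = avg n \<omega> (\<lambda>p. resid j p * score k p) - avg n \<omega> (resid j) * avg n \<omega> (score k)"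
  proof -
    have "(\<Sum>i=1..n. resid j (XYs i \<omega>) * a) / real n = avg n \<omega> (resid j) * a" for a
      unfolding avg_def sum_distrib_right[symmetric] by simp
    then show ?thesis
      unfolding sum_subtractf diff_divide_distrib avg_def[of n \<omega> "\<lambda>p. resid j p * score k p"] by simp
  qed
  finally show ?thesis .
qed

definition err_kernel :: "(nat \<Rightarrow> nat) \<Rightarrow> nat \<Rightarrow> 'w \<Rightarrow> real \<Rightarrow> real \<Rightarrow> real" where
  "err_kernel m n \<omega> s t = b_hat Xs Ys \<kappa>h \<phi>h m n \<omega> s t - b s t"

text \<open>Insert the decomposition of each \<open>Y\<^sub>i\<close> into the \<open>k\<close>-th summand of the estimator. The parts that do not
  depend on \<open>i\<close> vanish since the \<open>zc n \<omega> i\<close> sum to zero. By the eigenvector equation the part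
  linear in \<open>zc n \<omega> i\<close> equals \<open>\<kappa>h\<^sub>k\<close> times the corresponding coefficient of \<open>b\<close>; after
  division by \<open>\<kappa>h\<^sub>k\<close> it cancels against \<open>b\<close>, and only the noise remains.\<close>

lemma estimation_error_coefficients:
  assumes n: "n \<ge> 1" and \<omega>: "\<omega> \<in> space M"
  shows "(\<lambda>(s, t). err_kernel m n \<omega> s t) \<in> L2 unit_I2"
    and "j \<ge> 1 \<Longrightarrow> k \<ge> 1 \<Longrightarrow> k \<le> m n \<Longrightarrow> \<kappa>h n \<omega> k \<noteq> 0 \<Longrightarrow>
      (\<integral>(s, t). err_kernel m n \<omega> s t * \<phi> j s * \<phi>h n \<omega> k t \<partial>unit_I2) = (noise n \<omega> j \<bullet> eh n \<omega> k) / \<kappa>h n \<omega> k"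
    and "j \<ge> 1 \<Longrightarrow> k > m n \<Longrightarrow>
      (\<integral>(s, t). err_kernel m n \<omega> s t * \<phi> j s * \<phi>h n \<omega> k t \<partial>unit_I2) = - (cls (brow j) \<bullet> eh n \<omega> k)"
proof -
  note \<phi>hL = L2_basisD(1)[OF sample_basis[OF n \<omega>]]
  note onbh = L2_basisD(2)[OF sample_basis[OF n \<omega>]]
  define g where "g k s = (\<Sum>i=1..n. ((zc n \<omega> i \<bullet> eh n \<omega> k) / real n / \<kappa>h n \<omega> k) * Ys i \<omega> s)" for k s
  have gL: "g k \<in> L2 unit_I" for k
    unfolding g_def using \<omega> by (intro L2_sum L2_cmult Ys_L2) auto
  have bh: "b_hat Xs Ys \<kappa>h \<phi>h m n \<omega> s t = (\<Sum>k=1..m n. g k s * \<phi>h n \<omega> k t)" for s t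
    unfolding b_hat_def
  proof (intro sum.cong refl)
    fix k assume k: "k \<in> {1..m n}"
    have sc: "sample_score Xs \<phi>h n \<omega> i k = zc n \<omega> i \<bullet> eh n \<omega> k" if "i \<in> {1..n}" for i
      using zc_cls[OF n \<omega>, of i] \<phi>hL[of k] that k inner_cls[OF zc_cls(1)[OF n \<omega>, of i] \<phi>hL[of k]]
      by (simp add: sample_score_def L2_inner_def)
    have "(\<Sum>i=1..n. sample_score Xs \<phi>h n \<omega> i k * Ys i \<omega> s) / real n / \<kappa>h n \<omega> k = g k s"
      unfolding g_def sum_divide_distrib by (intro sum.cong refl) (simp add: sc)
    then show "(\<Sum>i=1..n. sample_score Xs \<phi>h n \<omega> i k * Ys i \<omega> s) / real n / \<kappa>h n \<omega> k * \<phi>h n \<omega> k t = g k s * \<phi>h n \<omega> k t"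
      by simp
  qed
  have tensL: "(\<lambda>p. g k (fst p) * \<phi>h n \<omega> k (snd p)) \<in> L2 unit_I2" if "k \<ge> 1" for k
    using unit_I2.L2_tensor[OF gL \<phi>hL[OF that]] by (simp add: case_prod_beta')
  have bL: "(\<lambda>p. b (fst p) (snd p)) \<in> L2 unit_I2"
    using b by (simp add: case_prod_beta')
  have sumL: "(\<lambda>p. \<Sum>k=1..m n. g k (fst p) * \<phi>h n \<omega> k (snd p)) \<in> L2 unit_I2"
    using tensL by (intro L2_sum) auto
  show kL: "(\<lambda>(s, t). err_kernel m n \<omega> s t) \<in> L2 unit_I2"
    using L2_diff[OF sumL bL] by (simp add: err_kernel_def bh case_prod_beta')
  have coef: "(\<integral>(s, t). err_kernel m n \<omega> s t * \<phi> j s * \<phi>h n \<omega> k t \<partial>unit_I2)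
      = (\<Sum>k'=1..m n. (cls (g k') \<bullet> e j) * (eh n \<omega> k' \<bullet> eh n \<omega> k)) - cls (brow j) \<bullet> eh n \<omega> k"
    if j: "j \<ge> 1" and k: "k \<ge> 1" for j k
  proof -
    have W: "(\<lambda>p. \<phi> j (fst p) * \<phi>h n \<omega> k (snd p)) \<in> L2 unit_I2"
      using unit_I2.L2_tensor[OF \<phi>_L2[OF j] \<phi>hL[OF k]] by (simp add: case_prod_beta')
    have tens: "(\<integral>p. (g k' (fst p) * \<phi>h n \<omega> k' (snd p)) * (\<phi> j (fst p) * \<phi>h n \<omega> k (snd p)) \<partial>unit_I2)
        = (cls (g k') \<bullet> e j) * (eh n \<omega> k' \<bullet> eh n \<omega> k)" if k': "k' \<ge> 1" for k'
    proof -
      have "(\<lambda>(s, t). g k' s * \<phi>h n \<omega> k' t) \<in> L2 unit_I2" using tensL[OF k'] by (simp add: case_prod_beta')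
      from unit_I2.L2_kernel(3)[OF this \<phi>_L2[OF j] \<phi>hL[OF k]]
      have "(\<integral>(s, t). g k' s * \<phi>h n \<omega> k' t * \<phi> j s * \<phi>h n \<omega> k t \<partial>unit_I2)
          = (\<integral>t. (\<integral>s. g k' s * \<phi>h n \<omega> k' t * \<phi> j s \<partial>unit_I) * \<phi>h n \<omega> k t \<partial>unit_I)"
        by (simp add: L2_inner_def)
      also have "\<dots> = (\<integral>t. (\<integral>s. g k' s * \<phi> j s \<partial>unit_I) * (\<phi>h n \<omega> k' t * \<phi>h n \<omega> k t) \<partial>unit_I)"
      proof (intro Bochner_Integration.integral_cong refl)
        fix t
        have "(\<integral>s. g k' s * \<phi>h n \<omega> k' t * \<phi> j s \<partial>unit_I) = (\<integral>s. (g k' s * \<phi> j s) * \<phi>h n \<omega> k' t \<partial>unit_I)"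
          by (simp add: mult_ac)
        also have "\<dots> = (\<integral>s. g k' s * \<phi> j s \<partial>unit_I) * \<phi>h n \<omega> k' t" by simp
        finally show "(\<integral>s. g k' s * \<phi>h n \<omega> k' t * \<phi> j s \<partial>unit_I) * \<phi>h n \<omega> k t
            = (\<integral>s. g k' s * \<phi> j s \<partial>unit_I) * (\<phi>h n \<omega> k' t * \<phi>h n \<omega> k t)" by simp
      qed
      also have "\<dots> = (cls (g k') \<bullet> e j) * (eh n \<omega> k' \<bullet> eh n \<omega> k)"
        by (simp add: inner_cls[OF gL \<phi>_L2[OF j]] inner_cls[OF \<phi>hL[OF k'] \<phi>hL[OF k]] L2_inner_def)
      finally show ?thesis by (simp add: case_prod_beta' mult_ac)
    qed
    have "(\<integral>(s, t). err_kernel m n \<omega> s t * \<phi> j s * \<phi>h n \<omega> k t \<partial>unit_I2)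
        = (\<integral>p. (\<Sum>k'=1..m n. (g k' (fst p) * \<phi>h n \<omega> k' (snd p)) * (\<phi> j (fst p) * \<phi>h n \<omega> k (snd p)))
            - b (fst p) (snd p) * (\<phi> j (fst p) * \<phi>h n \<omega> k (snd p)) \<partial>unit_I2)"
      by (intro Bochner_Integration.integral_cong refl)
         (simp add: case_prod_beta' err_kernel_def bh left_diff_distrib mult.assoc sum_distrib_right)
    also have "\<dots> = (\<Sum>k'=1..m n. \<integral>p. (g k' (fst p) * \<phi>h n \<omega> k' (snd p)) * (\<phi> j (fst p) * \<phi>h n \<omega> k (snd p)) \<partial>unit_I2)
        - (\<integral>p. b (fst p) (snd p) * (\<phi> j (fst p) * \<phi>h n \<omega> k (snd p)) \<partial>unit_I2)"
      using tensL
      by (subst Bochner_Integration.integral_diff Bochner_Integration.integral_sum;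
          (intro Bochner_Integration.integrable_sum L2_mult_integrable W bL)?; auto)+
    also have "(\<integral>p. b (fst p) (snd p) * (\<phi> j (fst p) * \<phi>h n \<omega> k (snd p)) \<partial>unit_I2) = cls (brow j) \<bullet> eh n \<omega> k"
      unfolding brow_coefficient(1)[OF j \<phi>hL[OF k]] by (simp add: case_prod_beta' mult_ac)
    also have "(\<Sum>k'=1..m n. \<integral>p. (g k' (fst p) * \<phi>h n \<omega> k' (snd p)) * (\<phi> j (fst p) * \<phi>h n \<omega> k (snd p)) \<partial>unit_I2)
        = (\<Sum>k'=1..m n. (cls (g k') \<bullet> e j) * (eh n \<omega> k' \<bullet> eh n \<omega> k))"
      by (intro sum.cong refl tens) auto
    finally show ?thesis .
  qed
  show "(\<integral>(s, t). err_kernel m n \<omega> s t * \<phi> j s * \<phi>h n \<omega> k t \<partial>unit_I2) = - (cls (brow j) \<bullet> eh n \<omega> k)"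
    if j: "j \<ge> 1" and k: "k > m n" for j k
  proof -
    have "(\<Sum>k'=1..m n. (cls (g k') \<bullet> e j) * (eh n \<omega> k' \<bullet> eh n \<omega> k)) = 0"
      using k by (intro sum.neutral) (auto simp: orthonormal_basis_inner[OF onbh])
    then show ?thesis using coef[OF j, of k] k by simp
  qed
  show "(\<integral>(s, t). err_kernel m n \<omega> s t * \<phi> j s * \<phi>h n \<omega> k t \<partial>unit_I2) = (noise n \<omega> j \<bullet> eh n \<omega> k) / \<kappa>h n \<omega> k"
    if j: "j \<ge> 1" and k: "k \<ge> 1" "k \<le> m n" and nz: "\<kappa>h n \<omega> k \<noteq> 0" for j k
  proof -
    define q where "q i = (zc n \<omega> i \<bullet> eh n \<omega> k) / real n / \<kappa>h n \<omega> k" for i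
    have "(\<Sum>k'=1..m n. (cls (g k') \<bullet> e j) * (eh n \<omega> k' \<bullet> eh n \<omega> k)) = (\<Sum>k'\<in>{k}. (cls (g k') \<bullet> e j) * (eh n \<omega> k' \<bullet> eh n \<omega> k))"
      using k by (intro sum.mono_neutral_right) (auto simp: orthonormal_basis_inner[OF onbh])
    also have "\<dots> = cls (g k) \<bullet> e j"
      using k by (simp add: orthonormal_basis_inner[OF onbh])
    also have "cls (g k) = (\<Sum>i=1..n. q i *\<^sub>R cls (Ys i \<omega>))"
      unfolding g_def[abs_def] q_def using \<omega> by (intro cls_lincomb Ys_L2) auto
    also have "\<dots> \<bullet> e j = (\<Sum>i=1..n. q i * (\<mu>Y \<bullet> e j + zbar n \<omega> \<bullet> cls (brow j))
        + q i * (zc n \<omega> i \<bullet> cls (brow j)) + q i * resid j (XYs i \<omega>))"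
      unfolding inner_sum_left
    proof (intro sum.cong refl)
      fix i
      have "cls (Ys i \<omega>) \<bullet> e j
          = (\<mu>Y \<bullet> e j + zbar n \<omega> \<bullet> cls (brow j)) + zc n \<omega> i \<bullet> cls (brow j) + resid j (XYs i \<omega>)"
        by (simp add: resid_def zc_def z_def inner_diff_left)
      then show "q i *\<^sub>R cls (Ys i \<omega>) \<bullet> e j = q i * (\<mu>Y \<bullet> e j + zbar n \<omega> \<bullet> cls (brow j))
          + q i * (zc n \<omega> i \<bullet> cls (brow j)) + q i * resid j (XYs i \<omega>)"
        by (simp only: inner_scaleR_left distrib_left)
    qed
    also have "\<dots> = (\<Sum>i=1..n. q i) * (\<mu>Y \<bullet> e j + zbar n \<omega> \<bullet> cls (brow j))
        + (\<Sum>i=1..n. q i * (zc n \<omega> i \<bullet> cls (brow j))) + (\<Sum>i=1..n. q i * resid j (XYs i \<omega>))"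
      by (simp only: sum.distrib sum_distrib_right)
    also have "(\<Sum>i=1..n. q i) = 0"
      using sum_zc[OF n, of \<omega>] by (simp add: q_def inner_sum_left[symmetric] sum_divide_distrib[symmetric])
    also have "(\<Sum>i=1..n. q i * (zc n \<omega> i \<bullet> cls (brow j)))
        = (\<Sum>i=1..n. ((zc n \<omega> i \<bullet> eh n \<omega> k) / real n) *\<^sub>R zc n \<omega> i) \<bullet> cls (brow j) / \<kappa>h n \<omega> k"
      by (simp add: q_def inner_sum_left sum_divide_distrib)
    also have "\<dots> = eh n \<omega> k \<bullet> cls (brow j)"
      unfolding sample_eigenvector[OF n \<omega> k(1)] using nz by simp
    also have "(\<Sum>i=1..n. q i * resid j (XYs i \<omega>)) = noise n \<omega> j \<bullet> eh n \<omega> k / \<kappa>h n \<omega> k"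
      by (simp add: q_def noise_def inner_sum_left sum_divide_distrib sum_distrib_left divide_inverse mult_ac)
    finally show ?thesis
      using coef[OF j k(1)] nz by (simp add: inner_commute)
  qed
qed

end

context functional_linear_sample
begin

section \<open>A deterministic bound for the loss\<close>

lemma \<beta>_gt: "2 * \<beta> - 1 > 0"
  using \<beta> \<alpha> by simp

lemma brow_decay: "j \<ge> 1 \<Longrightarrow> k \<ge> 1 \<Longrightarrow> \<bar>cls (brow j) \<bullet> e k\<bar> \<le> C * real j powr (-\<gamma>) * real k powr (-\<beta>)"
  using coefficients[of j k] brow_coefficient(1)[OF _ \<phi>_L2, of j k] by simp

text \<open>The bounds are on population-basis quantities only: the coefficients of the difference of the covariance
  forms before the correction for the sample mean (\<open>t1\<close>), the sample mean (\<open>t2\<close>), and the noise. The noise is centred at the sample mean, which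
  is why the averages of residuals (\<open>t3\<close>) and of scores (\<open>t5\<close>) appear beside the main term (\<open>t4\<close>).\<close>

definition averages_within :: "nat \<Rightarrow> nat \<Rightarrow> 'w \<Rightarrow> real \<Rightarrow> real \<Rightarrow> real \<Rightarrow> real \<Rightarrow> real \<Rightarrow> bool" where
  "averages_within n m \<omega> t1 t2 t3 t4 t5 \<longleftrightarrow> (\<forall>N.
     (\<Sum>k=1..N. \<Sum>l=1..N. (avg n \<omega> (\<lambda>p. score k p * score l p) - (if k = l then \<kappa> k else 0))\<^sup>2) \<le> t1 \<and>
     (\<Sum>k=1..N. (avg n \<omega> (score k))\<^sup>2) \<le> t2 \<and>
     (\<Sum>j=1..N. (avg n \<omega> (resid j))\<^sup>2) \<le> t3 \<and>
     (\<Sum>j=1..N. \<Sum>k=1..N. (avg n \<omega> (\<lambda>p. resid j p * score k p))\<^sup>2 / (\<kappa> k + \<kappa> m)) \<le> t4 \<and>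
     (\<Sum>k=1..N. (avg n \<omega> (score k))\<^sup>2 / (\<kappa> k + \<kappa> m)) \<le> t5)"

text \<open>The witness for \<open>s j\<close> is the sum of the series whose partial sums are bounded. It has to be a single
  number for each \<open>j\<close>, since the bounds are added over \<open>j\<close> after \<open>truncated_inverse_bound\<close> has been applied to
  each row of the noise.\<close>

lemma noise_energy:
  assumes n: "n \<ge> 1" and m: "m \<ge> 1" and within: "averages_within n m \<omega> t1 t2 t3 t4 t5"
  shows "\<exists>s. (\<forall>j N. (\<Sum>k=1..N. (noise n \<omega> j \<bullet> e k)\<^sup>2 / (\<kappa> k + \<kappa> m)) \<le> s j) \<and>
    (\<forall>J. (\<Sum>j=1..J. s j) \<le> 2 * t4 + 2 * (t3 * t5))"
proof -
  define P where "P j k = avg n \<omega> (\<lambda>p. resid j p * score k p)" for j k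
  define R where "R j = avg n \<omega> (resid j)" for j
  define U where "U k = avg n \<omega> (score k)" for k
  note A = within[unfolded averages_within_def P_def[symmetric] R_def[symmetric] U_def[symmetric], rule_format]
  note A3 = A[THEN conjunct2, THEN conjunct2, THEN conjunct1]
    and A4 = A[THEN conjunct2, THEN conjunct2, THEN conjunct2, THEN conjunct1]
    and A5 = A[THEN conjunct2, THEN conjunct2, THEN conjunct2, THEN conjunct2]
  have coef: "noise n \<omega> j \<bullet> e k = P j k - R j * U k" for j k
    unfolding noise_coefficient[OF n] P_def R_def U_def ..
  define S where "S j N = (\<Sum>k=1..N. (noise n \<omega> j \<bullet> e k)\<^sup>2 / (\<kappa> k + \<kappa> m))" for j N
  have kk: "\<kappa> k + \<kappa> m > 0" if "k \<ge> 1" for k using pos[OF that] pos[OF m] by simp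
  have nn: "0 \<le> x\<^sup>2 / (\<kappa> k + \<kappa> m)" if "k \<ge> 1" for k x
    using kk[OF that] by simp
  have Sinc: "incseq (S j)" for j
    unfolding S_def by (intro incseq_SucI sum_mono2 nn) auto
  have Sbdd: "bdd_above (range (S j))" for j
  proof (intro bdd_aboveI2)
    fix N
    have "S j N \<le> (\<Sum>k=1..N. (noise n \<omega> j \<bullet> e k)\<^sup>2 / \<kappa> m)"
      unfolding S_def using pos[OF m] pos by (intro sum_mono divide_left_mono mult_pos_pos kk) (auto intro: less_imp_le)
    also have "\<dots> \<le> (norm (noise n \<omega> j))\<^sup>2 / \<kappa> m"
      unfolding sum_divide_distrib[symmetric] using pos[OF m] by (intro divide_right_mono bessel onb) auto
    finally show "S j N \<le> (norm (noise n \<omega> j))\<^sup>2 / \<kappa> m" .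
  qed
  define s where "s j = (SUP N. S j N)" for j
  have Slim: "(\<lambda>N. S j N) \<longlonglongrightarrow> s j" for j
    unfolding s_def by (rule LIMSEQ_incseq_SUP[OF Sbdd Sinc])
  have Stot: "(\<Sum>j=1..N. S j N) \<le> 2 * t4 + 2 * (t3 * t5)" for N
  proof -
    have "S j N \<le> (\<Sum>k=1..N. 2 * ((P j k)\<^sup>2 / (\<kappa> k + \<kappa> m)) + 2 * ((R j)\<^sup>2 * ((U k)\<^sup>2 / (\<kappa> k + \<kappa> m))))" for j
      unfolding S_def
    proof (rule sum_mono)
      fix k assume "k \<in> {1..N}"
      then have k: "\<kappa> k + \<kappa> m > 0" by (intro kk) auto
      have "(x - y)\<^sup>2 \<le> 2 * x\<^sup>2 + 2 * y\<^sup>2" for x y :: real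
        using zero_le_power2[of "x + y"] by (simp add: power2_eq_square algebra_simps)
      then have "(noise n \<omega> j \<bullet> e k)\<^sup>2 / (\<kappa> k + \<kappa> m) \<le> (2 * (P j k)\<^sup>2 + 2 * (R j * U k)\<^sup>2) / (\<kappa> k + \<kappa> m)"
        unfolding coef using k by (intro divide_right_mono) auto
      then show "(noise n \<omega> j \<bullet> e k)\<^sup>2 / (\<kappa> k + \<kappa> m)
          \<le> 2 * ((P j k)\<^sup>2 / (\<kappa> k + \<kappa> m)) + 2 * ((R j)\<^sup>2 * ((U k)\<^sup>2 / (\<kappa> k + \<kappa> m)))"
        by (simp add: add_divide_distrib power_mult_distrib)
    qed
    then have "(\<Sum>j=1..N. S j N)
        \<le> (\<Sum>j=1..N. \<Sum>k=1..N. 2 * ((P j k)\<^sup>2 / (\<kappa> k + \<kappa> m)) + 2 * ((R j)\<^sup>2 * ((U k)\<^sup>2 / (\<kappa> k + \<kappa> m))))"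
      by (rule sum_mono)
    also have "\<dots> = 2 * (\<Sum>j=1..N. \<Sum>k=1..N. (P j k)\<^sup>2 / (\<kappa> k + \<kappa> m))
        + 2 * ((\<Sum>j=1..N. (R j)\<^sup>2) * (\<Sum>k=1..N. (U k)\<^sup>2 / (\<kappa> k + \<kappa> m)))"
      by (simp only: sum.distrib sum_distrib_left[symmetric] sum_distrib_right[symmetric])
    also have "\<dots> \<le> 2 * t4 + 2 * (t3 * t5)"
      using A3[of 0] by (intro add_mono mult_left_mono mult_mono A4 A3 A5 sum_nonneg nn) auto
    finally show ?thesis .
  qed
  have "(\<Sum>j=1..J. s j) \<le> 2 * t4 + 2 * (t3 * t5)" for J
  proof (rule LIMSEQ_le_const2)
    show "(\<lambda>N. \<Sum>j=1..J. S j N) \<longlonglongrightarrow> (\<Sum>j=1..J. s j)"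
      by (intro tendsto_sum Slim)
    show "\<exists>N0. \<forall>N\<ge>N0. (\<Sum>j=1..J. S j N) \<le> 2 * t4 + 2 * (t3 * t5)"
    proof (intro exI[of _ J] allI impI)
      fix N assume "N \<ge> J"
      then have "(\<Sum>j=1..J. S j N) \<le> (\<Sum>j=1..N. S j N)"
        unfolding S_def by (intro sum_mono2 sum_nonneg nn) auto
      also note Stot[of N]
      finally show "(\<Sum>j=1..J. S j N) \<le> 2 * t4 + 2 * (t3 * t5)" .
    qed
  qed
  moreover have "S j N \<le> s j" for j N
    by (rule incseq_le[OF Sinc Slim])
  ultimately show ?thesis unfolding S_def by blast
qed

text \<open>The noise part of row \<open>j\<close> is bounded by \<open>truncated_inverse_bound\<close> and the bias part by
  \<open>projection_tail_bound\<close>. The sum over \<open>j\<close> of the bias parts converges because the coefficients of \<open>b\<close> decay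
  like \<open>j\<^bsup>-\<gamma>\<^esup>\<close> with \<open>\<gamma> > 1/2\<close>.\<close>

lemma loss_le:
  assumes n: "n \<ge> 1" and \<omega>: "\<omega> \<in> space M" and m: "m n \<ge> 1"
    and within: "averages_within n (m n) \<omega> t1 t2 t3 t4 t5"
    and D: "D = sqrt t1 + t2" "D \<le> (\<kappa> (m n) - \<kappa> (Suc (m n))) / 2"
  shows "(L2_norm unit_I2 (\<lambda>(s, t). err_kernel m n \<omega> s t))\<^sup>2 \<le>
     8 / \<kappa> (m n) * (2 * t4 + 2 * (t3 * t5)) +
     (1 + 1 / (2 * \<gamma> - 1)) * (2 * (\<Sum>l=1..m n. C * real l powr (-\<beta>) * (2 * D / (\<kappa> l - \<kappa> (Suc (m n)))))\<^sup>2
        + 2 * (C\<^sup>2 * (real (m n) powr (1 - 2 * \<beta>) / (2 * \<beta> - 1))))"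
proof -
  note A = within[unfolded averages_within_def, rule_format]
  note A1 = A[THEN conjunct1] and A2 = A[THEN conjunct2, THEN conjunct1]
  define mm where "mm = m n"
  define tS where "tS = 2 * t4 + 2 * (t3 * t5)"
  have mm: "mm \<ge> 1" using m by (simp add: mm_def)
  obtain Q where Q: "diagonalised_by Q \<kappa> e"
    using diagonal_form_exists[OF onb, of \<kappa>] pos decreasing less_imp_le by metis
  define Qh where "Qh x y = (\<Sum>i=1..n. (zc n \<omega> i \<bullet> x) * (zc n \<omega> i \<bullet> y)) / real n" for x y
  have Qh: "diagonalised_by Qh (\<kappa>h n \<omega>) (eh n \<omega>)"
    unfolding Qh_def[abs_def] by (rule sample_form_diagonalised[OF n \<omega>])
  have "\<bar>Q x y - Qh x y\<bar> \<le> (sqrt t1 + t2) * norm x * norm y" for x y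
    unfolding Qh_def
  proof (rule empirical_form_perturbation[OF Q n zbar_def zc_def])
    show "(\<Sum>k=1..N. \<Sum>l=1..N. ((\<Sum>i=1..n. (z \<omega> i \<bullet> e k) * (z \<omega> i \<bullet> e l)) / real n - (if k = l then \<kappa> k else 0))\<^sup>2) \<le> t1" for N
      using A1[of N] by (simp add: avg_def score_z)
    show "(\<Sum>k=1..N. (zbar n \<omega> \<bullet> e k)\<^sup>2) \<le> t2" for N
      using A2[of N] by (simp add: zbar_avg)
  qed
  then have pert: "\<bar>Q x y - Qh x y\<bar> \<le> D * norm x * norm y" for x y
    by (simp add: D(1))
  then have pertd: "\<bar>Q x x - Qh x x\<bar> \<le> D * (norm x)\<^sup>2" and pertd': "\<bar>Qh x x - Q x x\<bar> \<le> D * (norm x)\<^sup>2" for x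
    using pert[of x x] by (simp_all add: power2_eq_square mult.assoc abs_minus_commute)
  have D0: "D \<ge> 0" using A1[of 0] A2[of 0] by (simp add: D(1))
  have gap: "D \<le> (\<kappa> mm - \<kappa> (Suc mm)) / 2" using D(2) by (simp add: mm_def)
  have sgap: "\<kappa> (Suc mm) < \<kappa> mm"
  proof -
    have "0 < inverse C * real mm powr (- \<alpha> - 1)" using C mm by simp
    then show ?thesis using polynomial_eigenvalues.gap[OF polynomial_eigenvalues_axioms mm] by linarith
  qed
  have half: "D \<le> \<kappa> mm / 2" using gap pos[of "Suc mm"] by simp
  have khpos: "\<kappa>h n \<omega> k > 0" if "k \<in> {1..mm}" for k
  proof -
    have "\<kappa> mm \<le> \<kappa>h n \<omega> mm + D" by (rule eigenvalue_perturbation[OF Qh Q pertd' mm])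
    moreover have "\<kappa>h n \<omega> mm \<le> \<kappa>h n \<omega> k" using diagonalised_byD(3)[OF Qh] that by auto
    ultimately show ?thesis using half pos[OF mm] by simp
  qed
  obtain s where s: "\<And>j N. (\<Sum>k=1..N. (noise n \<omega> j \<bullet> e k)\<^sup>2 / (\<kappa> k + \<kappa> mm)) \<le> s j"
    and stot: "\<And>J. (\<Sum>j=1..J. s j) \<le> tS"
    using noise_energy[OF n mm within[folded mm_def]] unfolding tS_def[symmetric] by metis
  have variance: "(\<Sum>k=1..mm. ((noise n \<omega> j \<bullet> eh n \<omega> k) / \<kappa>h n \<omega> k)\<^sup>2) \<le> 8 / \<kappa> mm * s j" for j
    by (rule truncated_inverse_bound[OF Q Qh pertd mm pos[OF mm] half s])
  \<comment> \<open>the bias part\<close>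
  define B where "B = (\<Sum>l=1..mm. C * real l powr (-\<beta>) * (2 * D / (\<kappa> l - \<kappa> (Suc mm))))"
  define T where "T = C\<^sup>2 * (real mm powr (1 - 2 * \<beta>) / (2 * \<beta> - 1))"
  have T0: "T \<ge> 0" using \<beta>_gt by (simp add: T_def)
  have bias: "(\<Sum>k\<in>{mm<..N}. (cls (brow j) \<bullet> eh n \<omega> k)\<^sup>2) \<le> real j powr (- 2 * \<gamma>) * (2 * B\<^sup>2 + 2 * T)" if j: "j \<ge> 1" for j N
  proof -
    define a where "a l = C * real j powr (-\<gamma>) * real l powr (-\<beta>)" for l
    have jj: "(real j powr (-\<gamma>))\<^sup>2 = real j powr (- 2 * \<gamma>)"
      using j by (simp add: power2_eq_square powr_add[symmetric])
    have "(\<Sum>k\<in>{mm<..N}. (cls (brow j) \<bullet> eh n \<omega> k)\<^sup>2)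
        \<le> 2 * (\<Sum>l=1..mm. a l * (2 * D / (\<kappa> l - \<kappa> (Suc mm))))\<^sup>2 + 2 * (real j powr (- 2 * \<gamma>) * T)"
    proof (rule projection_tail_bound[OF Q Qh pert D0 gap sgap])
      show "\<bar>cls (brow j) \<bullet> e l\<bar> \<le> a l" if "l \<ge> 1" for l
        unfolding a_def by (rule brow_decay[OF j that])
      show "(\<Sum>l=Suc mm..N. (a l)\<^sup>2) \<le> real j powr (- 2 * \<gamma>) * T" for N
      proof -
        have "(\<Sum>l=Suc mm..N. (a l)\<^sup>2) = real j powr (- 2 * \<gamma>) * (C\<^sup>2 * (\<Sum>l=Suc mm..N. real l powr (- (2 * \<beta> - 1) - 1)))"
          unfolding sum_distrib_left
        proof (intro sum.cong refl)
          fix l assume "l \<in> {Suc mm..N}"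
          then have "(real l powr (-\<beta>))\<^sup>2 = real l powr (- (2 * \<beta> - 1) - 1)"
            by (simp add: power2_eq_square powr_add[symmetric])
          then show "(a l)\<^sup>2 = real j powr (- 2 * \<gamma>) * (C\<^sup>2 * real l powr (- (2 * \<beta> - 1) - 1))"
            by (simp add: a_def power_mult_distrib jj mult_ac)
        qed
        also have "\<dots> \<le> real j powr (- 2 * \<gamma>) * (C\<^sup>2 * (real mm powr (- (2 * \<beta> - 1)) / (2 * \<beta> - 1)))"
          using mm \<beta>_gt by (intro mult_left_mono sum_powr_tail) auto
        finally show ?thesis by (simp add: T_def)
      qed
    qed auto
    also have "(\<Sum>l=1..mm. a l * (2 * D / (\<kappa> l - \<kappa> (Suc mm)))) = real j powr (-\<gamma>) * B"
      unfolding a_def B_def sum_distrib_left by (intro sum.cong refl) (simp add: mult_ac)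
    also have "2 * (real j powr (-\<gamma>) * B)\<^sup>2 + 2 * (real j powr (- 2 * \<gamma>) * T) = real j powr (- 2 * \<gamma>) * (2 * B\<^sup>2 + 2 * T)"
      by (simp add: power_mult_distrib jj algebra_simps)
    finally show ?thesis .
  qed
  have "(L2_norm unit_I2 (\<lambda>(s, t). err_kernel m n \<omega> s t))\<^sup>2 \<le> 8 / \<kappa> mm * tS + (1 + 1 / (2 * \<gamma> - 1)) * (2 * B\<^sup>2 + 2 * T)"
  proof (rule L2_norm_tensor_basis_le[OF estimation_error_coefficients(1)[OF n \<omega>] basis sample_basis[OF n \<omega>]])
    fix N
    define co where "co j k = (\<integral>(s, t). err_kernel m n \<omega> s t * \<phi> j s * \<phi>h n \<omega> k t \<partial>unit_I2)" for j k
    have row: "(\<Sum>k=1..N. (co j k)\<^sup>2) \<le> 8 / \<kappa> mm * s j + real j powr (- 2 * \<gamma>) * (2 * B\<^sup>2 + 2 * T)" if j: "j \<ge> 1" for j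
    proof -
      have "(\<Sum>k=1..N. (co j k)\<^sup>2) \<le> (\<Sum>k\<in>{1..mm} \<union> {mm<..N}. (co j k)\<^sup>2)"
        by (intro sum_mono2) auto
      also have "\<dots> = (\<Sum>k=1..mm. (co j k)\<^sup>2) + (\<Sum>k\<in>{mm<..N}. (co j k)\<^sup>2)"
        by (intro sum.union_disjoint) auto
      also have "(\<Sum>k=1..mm. (co j k)\<^sup>2) = (\<Sum>k=1..mm. ((noise n \<omega> j \<bullet> eh n \<omega> k) / \<kappa>h n \<omega> k)\<^sup>2)"
      proof (intro sum.cong refl)
        fix k assume k: "k \<in> {1..mm}"
        then have "co j k = (noise n \<omega> j \<bullet> eh n \<omega> k) / \<kappa>h n \<omega> k"
          unfolding co_def using khpos[OF k] by (intro estimation_error_coefficients(2)[OF n \<omega> j]) (auto simp: mm_def)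
        then show "(co j k)\<^sup>2 = ((noise n \<omega> j \<bullet> eh n \<omega> k) / \<kappa>h n \<omega> k)\<^sup>2" by simp
      qed
      also have "(\<Sum>k\<in>{mm<..N}. (co j k)\<^sup>2) = (\<Sum>k\<in>{mm<..N}. (cls (brow j) \<bullet> eh n \<omega> k)\<^sup>2)"
      proof (intro sum.cong refl)
        fix k assume k: "k \<in> {mm<..N}"
        then have "co j k = - (cls (brow j) \<bullet> eh n \<omega> k)"
          unfolding co_def by (intro estimation_error_coefficients(3)[OF n \<omega> j]) (auto simp: mm_def)
        then show "(co j k)\<^sup>2 = (cls (brow j) \<bullet> eh n \<omega> k)\<^sup>2" by simp
      qed
      also have "(\<Sum>k=1..mm. ((noise n \<omega> j \<bullet> eh n \<omega> k) / \<kappa>h n \<omega> k)\<^sup>2) + (\<Sum>k\<in>{mm<..N}. (cls (brow j) \<bullet> eh n \<omega> k)\<^sup>2)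
          \<le> 8 / \<kappa> mm * s j + real j powr (- 2 * \<gamma>) * (2 * B\<^sup>2 + 2 * T)"
        by (intro add_mono variance bias j)
      finally show ?thesis .
    qed
    have "(\<Sum>j=1..N. \<Sum>k=1..N. (co j k)\<^sup>2) \<le> (\<Sum>j=1..N. 8 / \<kappa> mm * s j + real j powr (- 2 * \<gamma>) * (2 * B\<^sup>2 + 2 * T))"
      by (intro sum_mono row) auto
    also have "\<dots> = 8 / \<kappa> mm * (\<Sum>j=1..N. s j) + (\<Sum>j=1..N. real j powr (- (2 * \<gamma> - 1) - 1)) * (2 * B\<^sup>2 + 2 * T)"
      by (simp add: sum.distrib sum_distrib_left sum_distrib_right)
    also have "\<dots> \<le> 8 / \<kappa> mm * tS + (1 + 1 / (2 * \<gamma> - 1)) * (2 * B\<^sup>2 + 2 * T)"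
      using pos[OF mm] \<gamma> T0 by (intro add_mono mult_left_mono mult_right_mono stot sum_powr_bounded) auto
    finally show "(\<Sum>j=1..N. \<Sum>k=1..N. (\<integral>(s, t). err_kernel m n \<omega> s t * \<phi> j s * \<phi>h n \<omega> k t \<partial>unit_I2)\<^sup>2)
        \<le> 8 / \<kappa> mm * tS + (1 + 1 / (2 * \<gamma> - 1)) * (2 * B\<^sup>2 + 2 * T)"
      by (simp add: co_def)
  qed
  then show ?thesis by (simp add: tS_def B_def T_def mm_def)
qed

lemma bias_sum_le:
  assumes m: "m \<ge> 1" and D: "D \<ge> 0"
  shows "(\<Sum>l=1..m. C * real l powr (-\<beta>) * (2 * D / (\<kappa> l - \<kappa> (Suc m)))) \<le> 8 * \<alpha> * C\<^sup>2 * D * real m powr ((\<alpha> + 1) / 2)"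
proof -
  have "(\<Sum>l=1..m. C * real l powr (-\<beta>) * (2 * D / (\<kappa> l - \<kappa> (Suc m))))
      \<le> (\<Sum>l=1..m. 2 * \<alpha> * C\<^sup>2 * D * (real l powr (\<alpha> - \<beta>) * ((real m + 1) / (real m + 1 - real l))))"
  proof (rule sum_mono)
    fix l assume l: "l \<in> {1..m}"
    define q where "q = real l powr (- \<alpha>) / (\<alpha> * C) * ((real m + 1 - real l) / (real m + 1))"
    have q: "0 < q" using l \<alpha> C by (simp add: q_def)
    have "q \<le> \<kappa> l - \<kappa> (Suc m)" using l gap_lower[of l m] by (simp add: q_def)
    then have "2 * D / (\<kappa> l - \<kappa> (Suc m)) \<le> 2 * D / q"
      using q D by (intro divide_left_mono) auto
    then have "C * real l powr (-\<beta>) * (2 * D / (\<kappa> l - \<kappa> (Suc m))) \<le> C * real l powr (-\<beta>) * (2 * D / q)"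
      using C by (intro mult_left_mono) auto
    also have "2 * D / q = 2 * D * (\<alpha> * C) * real l powr \<alpha> * ((real m + 1) / (real m + 1 - real l))"
      using l by (simp add: q_def powr_minus field_simps)
    also have "C * real l powr (-\<beta>) * (2 * D * (\<alpha> * C) * real l powr \<alpha> * ((real m + 1) / (real m + 1 - real l)))
        = 2 * \<alpha> * C\<^sup>2 * D * ((real l powr (-\<beta>) * real l powr \<alpha>) * ((real m + 1) / (real m + 1 - real l)))"
      by (simp add: power2_eq_square mult_ac)
    also have "real l powr (-\<beta>) * real l powr \<alpha> = real l powr (\<alpha> - \<beta>)"
      by (simp add: powr_add[symmetric])
    finally show "C * real l powr (-\<beta>) * (2 * D / (\<kappa> l - \<kappa> (Suc m)))
        \<le> 2 * \<alpha> * C\<^sup>2 * D * (real l powr (\<alpha> - \<beta>) * ((real m + 1) / (real m + 1 - real l)))" .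
  qed
  also have "\<dots> \<le> 2 * \<alpha> * C\<^sup>2 * D * (4 * real m powr ((\<alpha> + 1) / 2))"
    unfolding sum_distrib_left[symmetric] using \<alpha> \<beta> D
    by (intro mult_left_mono weighted_reciprocal_sum) auto
  finally show ?thesis by simp
qed

section \<open>The event on which the bound applies\<close>

definition variance_total :: real where "variance_total = C * (1 + 1 / (\<alpha> - 1))"

lemma variance_total_pos: "variance_total > 0"
  using C \<alpha> by (simp add: variance_total_def add_pos_nonneg)

text \<open>All five quantities in \<open>averages_within\<close> are weighted sums of squared centred averages.\<close>

lemma avg_partial_sums_event:
  assumes I: "\<And>N. finite (I N)" "\<And>N. I N \<subseteq> I (Suc N)"
    and f: "\<And>i N. i \<in> I N \<Longrightarrow> f i \<in> borel_measurable (L2_borel \<Otimes>\<^sub>M L2_borel)"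
      "\<And>i N. i \<in> I N \<Longrightarrow> integrable M (\<lambda>\<omega>. (f i (XY \<omega>))\<^sup>2)"
      "\<And>i N. i \<in> I N \<Longrightarrow> expectation (\<lambda>\<omega>. f i (XY \<omega>)) = a i"
    and w: "\<And>i N. i \<in> I N \<Longrightarrow> 0 \<le> w i"
    and c: "\<And>N. (\<Sum>i\<in>I N. w i * expectation (\<lambda>\<omega>. (f i (XY \<omega>))\<^sup>2)) \<le> c" "c > 0"
    and n: "n \<ge> 1" and \<tau>: "\<tau> > 0"
  shows "\<exists>A\<in>events. prob A \<le> 1 / \<tau> \<and>
    (\<forall>\<omega>\<in>space M - A. \<forall>N. (\<Sum>i\<in>I N. w i * (avg n \<omega> (f i) - a i)\<^sup>2) \<le> \<tau> * (c / real n))"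
proof -
  note ms = avg_mean_square[OF f(1) f(2) n f(3)]
  have "\<exists>A\<in>events. prob A \<le> (c / real n) / (\<tau> * (c / real n)) \<and>
    (\<forall>\<omega>\<in>space M - A. \<forall>N. (\<Sum>i\<in>I N. w i * (avg n \<omega> (f i) - a i)\<^sup>2) \<le> \<tau> * (c / real n))"
  proof (rule markov_partial_sums[where I = I, OF I])
    fix N
    have "(\<Sum>i\<in>I N. expectation (\<lambda>\<omega>. w i * (avg n \<omega> (f i) - a i)\<^sup>2))
        \<le> (\<Sum>i\<in>I N. w i * expectation (\<lambda>\<omega>. (f i (XY \<omega>))\<^sup>2) / real n)"
    proof (rule sum_mono)
      fix i assume i: "i \<in> I N"
      then show "expectation (\<lambda>\<omega>. w i * (avg n \<omega> (f i) - a i)\<^sup>2) \<le> w i * expectation (\<lambda>\<omega>. (f i (XY \<omega>))\<^sup>2) / real n"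
        using mult_left_mono[OF ms(2)[OF i i i] w[OF i]] by simp
    qed
    also have "\<dots> \<le> c / real n"
      unfolding sum_divide_distrib[symmetric] by (intro divide_right_mono c) simp
    finally show "(\<Sum>i\<in>I N. expectation (\<lambda>\<omega>. w i * (avg n \<omega> (f i) - a i)\<^sup>2)) \<le> c / real n" .
  next
    fix i N assume i: "i \<in> I N"
    show "integrable M (\<lambda>\<omega>. w i * (avg n \<omega> (f i) - a i)\<^sup>2)"
      by (intro integrable_mult_right ms(1)[OF i i i])
    show "0 \<le> w i * (avg n \<omega> (f i) - a i)\<^sup>2" for \<omega>
      by (intro mult_nonneg_nonneg w[OF i]) simp
  qed (use n c \<tau> in auto)
  moreover have "(c / real n) / (\<tau> * (c / real n)) = 1 / \<tau>"
    using n c(2) \<tau> by simp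
  ultimately show ?thesis by simp
qed

lemma good_event:
  assumes n: "n \<ge> 1" and m: "m \<ge> 1" and \<tau>: "\<tau> > 0"
  shows "\<exists>A\<in>events. prob A \<le> 5 / \<tau> \<and> (\<forall>\<omega>\<in>space M - A. averages_within n m \<omega>
    (\<tau> * (C * variance_total\<^sup>2 / real n)) (\<tau> * (variance_total / real n)) (\<tau> * (C / real n))
    (\<tau> * (C * dim_const * real m / real n)) (\<tau> * (dim_const * real m / real n)))"
proof -
  have C0: "C > 0" using C by simp
  have d0: "dim_const > 0" using dim_const_ge_1 by simp
  have kk: "\<kappa> k + \<kappa> m > 0" if "k \<ge> 1" for k using pos[OF that] pos[OF m] by simp
  have trace: "(\<Sum>k=1..N. \<kappa> k) \<le> variance_total" for N unfolding variance_total_def by (rule trace_le)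
  have sc2: "expectation (\<lambda>\<omega>. (score k (XY \<omega>))\<^sup>2) = \<kappa> k" if "k \<ge> 1" for k
    using score_covariance[OF that that] by (simp add: power2_eq_square)
  have grid: "finite ({1..N} \<times> {1..N})" "{1..N} \<times> {1..N} \<subseteq> {1..Suc N} \<times> {1..Suc N}" for N :: nat by auto
  have line: "finite {1..N}" "{1..N} \<subseteq> {1..Suc N}" for N :: nat by auto
  note event = avg_partial_sums_event[OF _ _ _ _ _ _ _ _ n \<tau>]

  have E1: "\<exists>A\<in>events. prob A \<le> 1 / \<tau> \<and> (\<forall>\<omega>\<in>space M - A. \<forall>N. (\<Sum>q\<in>{1..N} \<times> {1..N}.
      1 * (avg n \<omega> (\<lambda>p. score (fst q) p * score (snd q) p) - (if fst q = snd q then \<kappa> (fst q) else 0))\<^sup>2)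
      \<le> \<tau> * ((C * variance_total\<^sup>2) / real n))"
  proof (rule event[where I = "\<lambda>N. {1..N} \<times> {1..N}"])
    fix N
    have "(\<Sum>q\<in>{1..N} \<times> {1..N}. 1 * expectation (\<lambda>\<omega>. (score (fst q) (XY \<omega>) * score (snd q) (XY \<omega>))\<^sup>2))
        \<le> (\<Sum>q\<in>{1..N} \<times> {1..N}. C * (\<kappa> (fst q) * \<kappa> (snd q)))"
      unfolding mult_1 mult.assoc[symmetric] by (intro sum_mono score_products) auto
    also have "\<dots> = C * (\<Sum>k=1..N. \<kappa> k)\<^sup>2"
    proof -
      have "(\<Sum>k=1..N. \<kappa> k)\<^sup>2 = (\<Sum>q\<in>{1..N} \<times> {1..N}. \<kappa> (fst q) * \<kappa> (snd q))"
        unfolding power2_eq_square sum_product by (simp add: sum.cartesian_product case_prod_beta')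
      then show ?thesis by (simp only: sum_distrib_left[symmetric])
    qed
    also have "\<dots> \<le> C * variance_total\<^sup>2"
      using C0 trace[of N] pos by (intro mult_left_mono power_mono sum_nonneg) (auto intro: less_imp_le)
    finally show "(\<Sum>q\<in>{1..N} \<times> {1..N}. 1 * expectation (\<lambda>\<omega>. (score (fst q) (XY \<omega>) * score (snd q) (XY \<omega>))\<^sup>2))
        \<le> C * variance_total\<^sup>2" .
  next
    fix q :: "nat \<times> nat" and N assume "q \<in> {1..N} \<times> {1..N}"
    then have q: "fst q \<ge> 1" "snd q \<ge> 1" by auto
    show "(\<lambda>p. score (fst q) p * score (snd q) p) \<in> borel_measurable (L2_borel \<Otimes>\<^sub>M L2_borel)"
      by (intro borel_measurable_times score_measurable q)
    show "integrable M (\<lambda>\<omega>. (score (fst q) (XY \<omega>) * score (snd q) (XY \<omega>))\<^sup>2)"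
      by (rule score_products(1)[OF q])
    show "expectation (\<lambda>\<omega>. score (fst q) (XY \<omega>) * score (snd q) (XY \<omega>)) = (if fst q = snd q then \<kappa> (fst q) else 0)"
      by (rule score_covariance[OF q])
  qed (use grid C0 variance_total_pos in auto)

  have E2: "\<exists>A\<in>events. prob A \<le> 1 / \<tau> \<and> (\<forall>\<omega>\<in>space M - A. \<forall>N.
      (\<Sum>k\<in>{1..N}. 1 * (avg n \<omega> (score k) - 0)\<^sup>2) \<le> \<tau> * (variance_total / real n))"
  proof (rule event[where I = "\<lambda>N. {1..N}"])
    show "(\<Sum>k=1..N. 1 * expectation (\<lambda>\<omega>. (score k (XY \<omega>))\<^sup>2)) \<le> variance_total" for N
      using trace[of N] by (simp add: sc2)
  qed (use line variance_total_pos in \<open>auto intro: score_measurable score_mean L2_square_integrable[OF score_L2]\<close>)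

  have E3: "\<exists>A\<in>events. prob A \<le> 1 / \<tau> \<and> (\<forall>\<omega>\<in>space M - A. \<forall>N.
      (\<Sum>j\<in>{1..N}. 1 * (avg n \<omega> (resid j) - 0)\<^sup>2) \<le> \<tau> * (C / real n))"
  proof (rule event[where I = "\<lambda>N. {1..N}"])
    show "(\<Sum>j=1..N. 1 * expectation (\<lambda>\<omega>. (resid j (XY \<omega>))\<^sup>2)) \<le> C" for N
      using resid_total[of N] by simp
  qed (use line C0 in \<open>auto intro: resid_measurable resid_mean L2_square_integrable[OF resid_L2]\<close>)

  have E4: "\<exists>A\<in>events. prob A \<le> 1 / \<tau> \<and> (\<forall>\<omega>\<in>space M - A. \<forall>N. (\<Sum>q\<in>{1..N} \<times> {1..N}.
      1 / (\<kappa> (snd q) + \<kappa> m) * (avg n \<omega> (\<lambda>p. resid (fst q) p * score (snd q) p) - 0)\<^sup>2)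
      \<le> \<tau> * ((C * dim_const * real m) / real n))"
  proof (rule event[where I = "\<lambda>N. {1..N} \<times> {1..N}"])
    fix N
    have "(\<Sum>q\<in>{1..N} \<times> {1..N}. 1 / (\<kappa> (snd q) + \<kappa> m) * expectation (\<lambda>\<omega>. (resid (fst q) (XY \<omega>) * score (snd q) (XY \<omega>))\<^sup>2))
        = (\<Sum>k=1..N. 1 / (\<kappa> k + \<kappa> m) * (\<Sum>j=1..N. expectation (\<lambda>\<omega>. (resid j (XY \<omega>) * score k (XY \<omega>))\<^sup>2)))"
      unfolding sum_distrib_left by (subst sum.swap) (simp add: sum.cartesian_product case_prod_beta')
    also have "\<dots> \<le> (\<Sum>k=1..N. 1 / (\<kappa> k + \<kappa> m) * (C * \<kappa> k))"
      using kk by (intro sum_mono mult_left_mono resid_score_square) (auto simp: less_imp_le)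
    also have "\<dots> = C * (\<Sum>k=1..N. \<kappa> k / (\<kappa> k + \<kappa> m))"
      by (simp add: sum_distrib_left mult.commute)
    also have "\<dots> \<le> C * (dim_const * real m)"
      using C0 by (intro mult_left_mono effective_dimension m) auto
    finally show "(\<Sum>q\<in>{1..N} \<times> {1..N}. 1 / (\<kappa> (snd q) + \<kappa> m) * expectation (\<lambda>\<omega>. (resid (fst q) (XY \<omega>) * score (snd q) (XY \<omega>))\<^sup>2))
        \<le> C * dim_const * real m" by simp
  next
    fix q :: "nat \<times> nat" and N assume "q \<in> {1..N} \<times> {1..N}"
    then have q: "fst q \<ge> 1" "snd q \<ge> 1" by auto
    show "(\<lambda>p. resid (fst q) p * score (snd q) p) \<in> borel_measurable (L2_borel \<Otimes>\<^sub>M L2_borel)"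
      by (intro borel_measurable_times score_measurable resid_measurable q)
    show "integrable M (\<lambda>\<omega>. (resid (fst q) (XY \<omega>) * score (snd q) (XY \<omega>))\<^sup>2)"
      by (rule resid_score_square(1)[OF q(2,1)])
    show "expectation (\<lambda>\<omega>. resid (fst q) (XY \<omega>) * score (snd q) (XY \<omega>)) = 0"
      by (rule resid_score[OF q])
    show "0 \<le> 1 / (\<kappa> (snd q) + \<kappa> m)"
      using kk[OF q(2)] by simp
  qed (use grid C0 d0 m in auto)

  have E5: "\<exists>A\<in>events. prob A \<le> 1 / \<tau> \<and> (\<forall>\<omega>\<in>space M - A. \<forall>N.
      (\<Sum>k\<in>{1..N}. 1 / (\<kappa> k + \<kappa> m) * (avg n \<omega> (score k) - 0)\<^sup>2) \<le> \<tau> * ((dim_const * real m) / real n))"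
  proof (rule event[where I = "\<lambda>N. {1..N}"])
    show "(\<Sum>k=1..N. 1 / (\<kappa> k + \<kappa> m) * expectation (\<lambda>\<omega>. (score k (XY \<omega>))\<^sup>2)) \<le> dim_const * real m" for N
      using effective_dimension[OF m, of N] by (simp add: sc2)
    show "0 \<le> 1 / (\<kappa> k + \<kappa> m)" if "k \<in> {1..N}" for k N
      using kk[of k] that by simp
  qed (use line d0 m in \<open>auto intro: score_measurable score_mean L2_square_integrable[OF score_L2]\<close>)

  from outside_union[OF E1 outside_union[OF E2 outside_union[OF E3 outside_union[OF E4 E5]]]]
  show ?thesis
    by (simp add: averages_within_def sum.cartesian_product case_prod_beta' all_conj_distrib)
qed

end

section \<open>Rates of convergence\<close>

lemma bounded_in_prob_mono:
  assumes Z: "bounded_in_prob M Z r" and K: "K > 0" and r: "\<forall>\<^sub>F n in sequentially. r n \<le> K * r' n"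
  shows "bounded_in_prob M Z r'"
  unfolding bounded_in_prob_def
proof (intro allI impI)
  fix \<epsilon> :: real assume "\<epsilon> > 0"
  then obtain C where C: "C > 0"
    "\<forall>\<^sub>F n in sequentially. \<exists>A\<in>sets M. {\<omega>\<in>space M. \<bar>Z n \<omega>\<bar> > C * r n} \<subseteq> A \<and> measure M A \<le> \<epsilon>"
    using Z unfolding bounded_in_prob_def by blast
  have "\<forall>\<^sub>F n in sequentially. \<exists>A\<in>sets M. {\<omega>\<in>space M. \<bar>Z n \<omega>\<bar> > (C * K) * r' n} \<subseteq> A \<and> measure M A \<le> \<epsilon>"
    using C(2) r
  proof eventually_elim
    case (elim n)
    have "C * r n \<le> (C * K) * r' n"
      using elim(2) C(1) by (simp add: mult.assoc)
    then have "{\<omega>\<in>space M. \<bar>Z n \<omega>\<bar> > (C * K) * r' n} \<subseteq> {\<omega>\<in>space M. \<bar>Z n \<omega>\<bar> > C * r n}"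
      by auto
    then show ?case using elim(1) by (meson order_trans)
  qed
  then show "\<exists>C>0. \<forall>\<^sub>F n in sequentially. \<exists>A\<in>sets M. {\<omega>\<in>space M. \<bar>Z n \<omega>\<bar> > C * r' n} \<subseteq> A \<and> measure M A \<le> \<epsilon>"
    using C(1) K by (intro exI[of _ "C * K"]) auto
qed

text \<open>On the event of \<open>good_event\<close>, of probability at least \<open>1 - 5/\<tau>\<close>, the terms of \<open>loss_le\<close> are of the
  orders \<open>m\<^sup>\<alpha> (m/n)\<close>, \<open>D\<^sup>2 m\<^bsup>\<alpha>+1\<^esup>\<close> with \<open>D\<^sup>2 = O(1/n)\<close>, and \<open>m\<^bsup>1-2\<beta>\<^esup>\<close>. The constants \<open>K1\<close>, \<open>K2\<close> and
  \<open>K3\<close> belong to these three terms in turn.\<close>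

lemma (in functional_linear_sample) loss_rate:
  assumes m: "\<And>n. m n > 0"
    and o: "(\<lambda>n. real (m n)) \<in> o(\<lambda>n. real n powr (1 / (2 * \<alpha> + 2)))"
  shows "bounded_in_prob M
    (\<lambda>n \<omega>. (L2_norm unit_I2 (\<lambda>(s, t). b_hat Xs Ys \<kappa>h \<phi>h m n \<omega> s t - b s t))\<^sup>2)
    (\<lambda>n. inverse (real n) * real (m n) powr (\<alpha> + 1) + real (m n) powr (-2 * \<beta> + 1))"
  unfolding bounded_in_prob_def err_kernel_def[symmetric]
proof (intro allI impI)
  fix \<epsilon> :: real assume \<epsilon>: "\<epsilon> > 0"
  have C0: "C > 0" using C by simp
  have a0: "\<alpha> > 0" using \<alpha> by simp
  define \<tau> where "\<tau> = 5 / \<epsilon>"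
  have \<tau>: "\<tau> > 0" using \<epsilon> by (simp add: \<tau>_def)
  define V where "V = variance_total"
  have V: "V > 0" by (simp add: V_def variance_total_pos)
  define d where "d = sqrt (\<tau> * (C * V\<^sup>2)) + \<tau> * V"
  have d0: "d \<ge> 0" using \<tau> V C0 by (simp add: d_def)
  define D where "D n = sqrt (\<tau> * (C * V\<^sup>2 / real n)) + \<tau> * (V / real n)" for n :: nat
  have D0: "D n \<ge> 0" for n using \<tau> V C0 by (simp add: D_def)
  have Dd: "D n \<le> d / sqrt (real n)" if n: "n \<ge> 1" for n
  proof -
    have "sqrt (real n) * 1 \<le> sqrt (real n) * sqrt (real n)"
      using n by (intro mult_left_mono) auto
    then have "1 / real n \<le> 1 / sqrt (real n)"
      using n by (intro divide_left_mono) auto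
    then have "\<tau> * V * (1 / real n) \<le> \<tau> * V * (1 / sqrt (real n))"
      using \<tau> V by (intro mult_left_mono) auto
    moreover have "sqrt (\<tau> * (C * V\<^sup>2 / real n)) = sqrt (\<tau> * (C * V\<^sup>2)) / sqrt (real n)"
      by (simp only: real_sqrt_divide[symmetric] times_divide_eq_right)
    ultimately show ?thesis by (simp add: D_def d_def add_divide_distrib)
  qed
  define \<Gamma> where "\<Gamma> = 1 + 1 / (2 * \<gamma> - 1)"
  have \<Gamma>: "\<Gamma> > 0" using \<gamma> by (simp add: \<Gamma>_def add_pos_nonneg)
  define K1 where "K1 = 2 * \<alpha> * C * 8 * (2 * \<tau> * C * dim_const + 2 * \<tau>\<^sup>2 * C * dim_const)"
  define K2 where "K2 = \<Gamma> * (2 * (8 * \<alpha> * C\<^sup>2 * d)\<^sup>2)"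
  define K3 where "K3 = \<Gamma> * (2 * (C\<^sup>2 / (2 * \<beta> - 1)))"
  have K1: "K1 > 0" using a0 C0 \<tau> dim_const_ge_1 by (simp add: K1_def add_pos_pos)
  have K2: "K2 \<ge> 0" using \<Gamma> by (simp add: K2_def)
  have K3: "K3 \<ge> 0" using \<Gamma> \<beta>_gt by (simp add: K3_def)
  define r where "r n = inverse (real n) * real (m n) powr (\<alpha> + 1) + real (m n) powr (-2 * \<beta> + 1)" for n
  \<comment> \<open>\<open>c\<close> is chosen so that \<open>m n \<le> c * n powr (1 / (2 * \<alpha> + 2))\<close> keeps \<open>D n\<close> below half of the gap at \<open>m n\<close>\<close>
  define c where "c = (1 / (2 * C * (d + 1))) powr (1 / (\<alpha> + 1))"
  have c0: "c > 0" using C0 d0 by (simp add: c_def)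
  have cp: "c powr (\<alpha> + 1) = 1 / (2 * C * (d + 1))"
    using C0 d0 a0 by (simp add: c_def powr_powr)
  have small: "D n \<le> (\<kappa> (m n) - \<kappa> (Suc (m n))) / 2"
    if n: "n \<ge> 1" and mn: "norm (real (m n)) \<le> c * norm (real n powr (1 / (2 * \<alpha> + 2)))" for n
  proof -
    have "real (m n) powr (\<alpha> + 1) \<le> (c * real n powr (1 / (2 * \<alpha> + 2))) powr (\<alpha> + 1)"
      using mn a0 by (intro powr_mono2) auto
    also have "\<dots> = 1 / (2 * C * (d + 1)) * real n powr (1 / (2 * \<alpha> + 2) * (\<alpha> + 1))"
      using c0 cp by (simp add: powr_mult powr_powr)
    also have "1 / (2 * \<alpha> + 2) * (\<alpha> + 1) = 1 / 2"
      using a0 by (simp add: field_simps)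
    finally have le: "real (m n) powr (\<alpha> + 1) \<le> 1 / (2 * C * (d + 1)) * sqrt (real n)"
      by (simp add: powr_half_sqrt)
    have mp: "real (m n) powr (\<alpha> + 1) > 0" and sn: "sqrt (real n) > 0" using m[of n] n by auto
    have "D n \<le> (d + 1) / sqrt (real n)"
    proof -
      have "d / sqrt (real n) \<le> (d + 1) / sqrt (real n)"
        using sn by (intro divide_right_mono) auto
      then show ?thesis using Dd[OF n] by linarith
    qed
    also have "\<dots> \<le> inverse C / 2 / real (m n) powr (\<alpha> + 1)"
    proof -
      have "real (m n) powr (\<alpha> + 1) * (2 * C * (d + 1)) \<le> sqrt (real n)"
        using le C0 d0 by (simp add: pos_le_divide_eq)
      then have "real (m n) powr (\<alpha> + 1) * (2 * C * (d + 1)) / (2 * C * real (m n) powr (\<alpha> + 1))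
          \<le> sqrt (real n) / (2 * C * real (m n) powr (\<alpha> + 1))"
        using C0 mp by (intro divide_right_mono) auto
      then have "d + 1 \<le> sqrt (real n) / (2 * C * real (m n) powr (\<alpha> + 1))"
        using C0 mp by simp
      then show ?thesis
        unfolding pos_divide_le_eq[OF sn] by (simp add: field_simps)
    qed
    also have "\<dots> = inverse C * real (m n) powr (- \<alpha> - 1) / 2"
    proof -
      have "real (m n) powr (- \<alpha> - 1) = inverse (real (m n) powr (\<alpha> + 1))"
        by (subst powr_minus[symmetric]) simp
      then show ?thesis by (simp only: divide_inverse mult_ac)
    qed
    also have "\<dots> \<le> (\<kappa> (m n) - \<kappa> (Suc (m n))) / 2"
      using polynomial_eigenvalues.gap[OF polynomial_eigenvalues_axioms, of "m n"] m[of n] by simp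
    finally show ?thesis .
  qed
  have ev: "\<forall>\<^sub>F n in sequentially. n \<ge> 1 \<and> norm (real (m n)) \<le> c * norm (real n powr (1 / (2 * \<alpha> + 2)))"
    using landau_o.smallD[OF o c0] eventually_ge_at_top[of 1] by eventually_elim simp
  have "\<forall>\<^sub>F n in sequentially. \<exists>A\<in>events.
      {\<omega>\<in>space M. \<bar>(L2_norm unit_I2 (\<lambda>(s, t). err_kernel m n \<omega> s t))\<^sup>2\<bar> > (K1 + K2 + K3) * r n} \<subseteq> A \<and> prob A \<le> \<epsilon>"
    using ev
  proof eventually_elim
    case (elim n)
    then have n: "n \<ge> 1" by simp
    have n0: "real n > 0" "1 / real n \<le> 1" using n by auto
    have mn: "m n \<ge> 1" using m[of n] by simp
    define \<mu> where "\<mu> = real (m n)"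
    have \<mu>: "\<mu> \<ge> 1" using mn by (simp add: \<mu>_def)
    define R where "R = inverse (real n) * \<mu> powr (\<alpha> + 1)"
    have R0: "R \<ge> 0" by (simp add: R_def)
    have sm: "D n \<le> (\<kappa> (m n) - \<kappa> (Suc (m n))) / 2" using small elim by blast
    obtain A where A: "A \<in> events" "prob A \<le> 5 / \<tau>"
      and g: "\<And>\<omega>. \<omega> \<in> space M - A \<Longrightarrow> averages_within n (m n) \<omega>
        (\<tau> * (C * V\<^sup>2 / real n)) (\<tau> * (V / real n)) (\<tau> * (C / real n))
        (\<tau> * (C * dim_const * real (m n) / real n)) (\<tau> * (dim_const * real (m n) / real n))"
      using good_event[OF n mn \<tau>] unfolding V_def by blast
    have "(L2_norm unit_I2 (\<lambda>(s, t). err_kernel m n \<omega> s t))\<^sup>2 \<le> (K1 + K2 + K3) * r n" if \<omega>: "\<omega> \<in> space M - A" for \<omega>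
    proof -
      let ?t4 = "\<tau> * (C * dim_const * real (m n) / real n)" and ?t3 = "\<tau> * (C / real n)" and ?t5 = "\<tau> * (dim_const * real (m n) / real n)"
      let ?B = "\<Sum>l=1..m n. C * real l powr (-\<beta>) * (2 * D n / (\<kappa> l - \<kappa> (Suc (m n))))"
      have "(L2_norm unit_I2 (\<lambda>(s, t). err_kernel m n \<omega> s t))\<^sup>2 \<le>
         8 / \<kappa> (m n) * (2 * ?t4 + 2 * (?t3 * ?t5)) +
         (1 + 1 / (2 * \<gamma> - 1)) * (2 * ?B\<^sup>2 + 2 * (C\<^sup>2 * (real (m n) powr (1 - 2 * \<beta>) / (2 * \<beta> - 1))))"
        by (rule loss_le[where m = m, OF n _ mn g[OF \<omega>] D_def[of n] sm]) (use \<omega> in simp)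
      also have "8 / \<kappa> (m n) * (2 * ?t4 + 2 * (?t3 * ?t5)) \<le> K1 * R"
      proof -
        have "?t3 * ?t5 = \<tau>\<^sup>2 * C * dim_const * (\<mu> / real n) * (1 / real n)"
          by (simp add: \<mu>_def power2_eq_square)
        also have "\<dots> \<le> \<tau>\<^sup>2 * C * dim_const * (\<mu> / real n) * 1"
          using C0 dim_const_ge_1 \<mu> n0 by (intro mult_left_mono mult_nonneg_nonneg) auto
        finally have "?t3 * ?t5 \<le> \<tau>\<^sup>2 * C * dim_const * (\<mu> / real n)" by simp
        moreover have "?t4 = \<tau> * C * dim_const * (\<mu> / real n)" by (simp add: \<mu>_def)
        ultimately have "2 * ?t4 + 2 * (?t3 * ?t5) \<le> 2 * (\<tau> * C * dim_const * (\<mu> / real n)) + 2 * (\<tau>\<^sup>2 * C * dim_const * (\<mu> / real n))"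
          by linarith
        then have t35: "2 * ?t4 + 2 * (?t3 * ?t5) \<le> (2 * \<tau> * C * dim_const + 2 * \<tau>\<^sup>2 * C * dim_const) * (\<mu> / real n)"
          by (simp only: distrib_right mult.assoc)
        have "8 / \<kappa> (m n) * (2 * ?t4 + 2 * (?t3 * ?t5)) = 8 * (1 / \<kappa> (m n)) * (2 * ?t4 + 2 * (?t3 * ?t5))" by simp
        also have "\<dots> \<le> 8 * (2 * \<alpha> * C * \<mu> powr \<alpha>) * ((2 * \<tau> * C * dim_const + 2 * \<tau>\<^sup>2 * C * dim_const) * (\<mu> / real n))"
        proof (intro mult_mono t35)
          show "1 / \<kappa> (m n) \<le> 2 * \<alpha> * C * \<mu> powr \<alpha>" unfolding \<mu>_def by (rule inverse_le[OF mn])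
          show "0 \<le> 2 * ?t4 + 2 * (?t3 * ?t5)"
            using C0 \<tau> dim_const_ge_1 by simp
          show "0 \<le> 1 / \<kappa> (m n)" using pos[OF mn] by simp
          show "0 \<le> 8 * (2 * \<alpha> * C * \<mu> powr \<alpha>)" using a0 C0 by simp
        qed simp_all
        also have "\<dots> = K1 * (inverse (real n) * (\<mu> powr \<alpha> * \<mu>))"
          unfolding K1_def by (simp add: divide_inverse)
        also have "\<mu> powr \<alpha> * \<mu> = \<mu> powr (\<alpha> + 1)" using \<mu> by (simp add: powr_add)
        finally show ?thesis by (simp add: R_def)
      qed
      also have "(1 + 1 / (2 * \<gamma> - 1)) * (2 * ?B\<^sup>2 + 2 * (C\<^sup>2 * (real (m n) powr (1 - 2 * \<beta>) / (2 * \<beta> - 1)))) \<le> K2 * R + K3 * \<mu> powr (-2 * \<beta> + 1)"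
      proof -
        have B0: "0 \<le> ?B"
        proof (intro sum_nonneg mult_nonneg_nonneg divide_nonneg_nonneg)
          fix l assume "l \<in> {1..m n}"
          then show "0 \<le> \<kappa> l - \<kappa> (Suc (m n))" using decreasing[of l "Suc (m n)"] by simp
        qed (use C0 D0 in auto)
        have "?B \<le> 8 * \<alpha> * C\<^sup>2 * D n * \<mu> powr ((\<alpha> + 1) / 2)"
          unfolding \<mu>_def by (rule bias_sum_le[OF mn D0])
        also have "\<dots> \<le> 8 * \<alpha> * C\<^sup>2 * (d / sqrt (real n)) * \<mu> powr ((\<alpha> + 1) / 2)"
          using a0 Dd[OF n] by (intro mult_right_mono mult_left_mono) auto
        finally have "?B\<^sup>2 \<le> (8 * \<alpha> * C\<^sup>2 * (d / sqrt (real n)) * \<mu> powr ((\<alpha> + 1) / 2))\<^sup>2"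
          by (intro power_mono B0)
        also have "\<dots> = (8 * \<alpha> * C\<^sup>2 * d)\<^sup>2 * (1 / (sqrt (real n))\<^sup>2) * (\<mu> powr ((\<alpha> + 1) / 2))\<^sup>2"
          by (simp add: power_mult_distrib power_divide)
        also have "(\<mu> powr ((\<alpha> + 1) / 2))\<^sup>2 = \<mu> powr (\<alpha> + 1)"
          by (simp add: power2_eq_square powr_add[symmetric])
        finally have "2 * ?B\<^sup>2 \<le> 2 * (8 * \<alpha> * C\<^sup>2 * d)\<^sup>2 * R"
          by (simp add: R_def divide_inverse mult_ac)
        then have "\<Gamma> * (2 * ?B\<^sup>2) \<le> \<Gamma> * (2 * (8 * \<alpha> * C\<^sup>2 * d)\<^sup>2 * R)"
          by (rule mult_left_mono) (use \<Gamma> in simp)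
        then have "\<Gamma> * (2 * ?B\<^sup>2) \<le> K2 * R"
          unfolding K2_def by (simp only: mult.assoc)
        then show ?thesis
          unfolding \<Gamma>_def[symmetric] K3_def \<mu>_def distrib_left by (simp add: algebra_simps)
      qed
      also have "K1 * R + (K2 * R + K3 * \<mu> powr (-2 * \<beta> + 1)) \<le> (K1 + K2 + K3) * (R + \<mu> powr (-2 * \<beta> + 1))"
      proof -
        have "K1 * R + (K2 * R + K3 * P) \<le> (K1 + K2 + K3) * (R + P)" if "P \<ge> 0" for P
        proof -
          have "0 \<le> K1 * P" "0 \<le> K2 * P" "0 \<le> K3 * R" using K1 K2 K3 R0 that by simp_all
          then show ?thesis unfolding distrib_left distrib_right by linarith
        qed
        then show ?thesis by simp
      qed
      finally show ?thesis by (simp add: r_def R_def \<mu>_def)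
    qed
    then have "{\<omega>\<in>space M. \<bar>(L2_norm unit_I2 (\<lambda>(s, t). err_kernel m n \<omega> s t))\<^sup>2\<bar> > (K1 + K2 + K3) * r n} \<subseteq> A"
      by (auto simp: not_le[symmetric])
    moreover have "prob A \<le> \<epsilon>" using A(2) \<epsilon> by (simp add: \<tau>_def)
    ultimately show ?case using A(1) by blast
  qed
  then show "\<exists>C>0. \<forall>\<^sub>F n in sequentially. \<exists>A\<in>events.
      {\<omega>\<in>space M. \<bar>(L2_norm unit_I2 (\<lambda>(s, t). err_kernel m n \<omega> s t))\<^sup>2\<bar>
          > C * (inverse (real n) * real (m n) powr (\<alpha> + 1) + real (m n) powr (-2 * \<beta> + 1))} \<subseteq> A \<and> prob A \<le> \<epsilon>"
    using K1 K2 K3 unfolding r_def by (intro exI[of _ "K1 + K2 + K3"]) auto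
qed

text \<open>With \<open>m\<close> of the order \<open>n\<^bsup>1/(\<alpha>+2\<beta>)\<^esup>\<close> the two terms of the rate balance. This choice is admissible since
  \<open>\<alpha> + 2\<beta> > 2\<alpha> + 2\<close>.\<close>

lemma optimal_rate:
  fixes \<alpha> \<beta> :: real and m :: "nat \<Rightarrow> nat"
  assumes \<alpha>: "\<alpha> > 1" and \<beta>: "\<beta> > \<alpha> / 2 + 1"
    and m: "(\<lambda>n. real (m n)) \<in> \<Theta>(\<lambda>n. real n powr (1 / (\<alpha> + 2 * \<beta>)))"
  shows "(\<lambda>n. real (m n)) \<in> o(\<lambda>n. real n powr (1 / (2 * \<alpha> + 2)))"
    and "\<exists>K>0. \<forall>\<^sub>F n in sequentially.
      inverse (real n) * real (m n) powr (\<alpha> + 1) + real (m n) powr (-2 * \<beta> + 1)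
        \<le> K * real n powr (- (2 * \<beta> - 1) / (\<alpha> + 2 * \<beta>))"
proof -
  define p where "p = 1 / (\<alpha> + 2 * \<beta>)"
  have ab: "\<alpha> + 2 * \<beta> > 0" using \<alpha> \<beta> by simp
  have p: "p < 1 / (2 * \<alpha> + 2)"
    unfolding p_def using \<alpha> \<beta> by (intro divide_strict_left_mono mult_pos_pos) auto
  have big: "(\<lambda>n. real (m n)) \<in> O(\<lambda>n. real n powr p)" and om: "(\<lambda>n. real (m n)) \<in> \<Omega>(\<lambda>n. real n powr p)"
    using m unfolding p_def by (auto dest: bigthetaD1 bigthetaD2)
  have "(\<lambda>n. real n powr p) \<in> o(\<lambda>n. real n powr (1 / (2 * \<alpha> + 2)))"
    using p by (subst powr_smallo_iff[OF filterlim_real_sequentially]) auto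
  with big show "(\<lambda>n. real (m n)) \<in> o(\<lambda>n. real n powr (1 / (2 * \<alpha> + 2)))"
    by (rule landau_o.big_small_trans)
  obtain c where c: "c > 0" "\<forall>\<^sub>F n in sequentially. norm (real (m n)) \<le> c * norm (real n powr p)"
    using big by (rule landau_o.bigE)
  obtain c' where c': "c' > 0" "\<forall>\<^sub>F n in sequentially. norm (real (m n)) \<ge> c' * norm (real n powr p)"
    using om by (rule landau_omega.bigE)
  have e1: "p * (\<alpha> + 1) - 1 = - (2 * \<beta> - 1) / (\<alpha> + 2 * \<beta>)"
    using ab by (simp add: p_def field_simps)
  have e2: "p * (-2 * \<beta> + 1) = - (2 * \<beta> - 1) / (\<alpha> + 2 * \<beta>)"
    by (simp add: p_def)
  have "\<forall>\<^sub>F n in sequentially.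
      inverse (real n) * real (m n) powr (\<alpha> + 1) + real (m n) powr (-2 * \<beta> + 1)
        \<le> (c powr (\<alpha> + 1) + c' powr (-2 * \<beta> + 1)) * real n powr (- (2 * \<beta> - 1) / (\<alpha> + 2 * \<beta>))"
    using c(2) c'(2) eventually_ge_at_top[of 1]
  proof eventually_elim
    case (elim n)
    have "real (m n) powr (\<alpha> + 1) \<le> (c * real n powr p) powr (\<alpha> + 1)"
      using elim \<alpha> by (intro powr_mono2) auto
    also have "\<dots> = c powr (\<alpha> + 1) * real n powr (p * (\<alpha> + 1))"
      using c by (simp add: powr_mult powr_powr)
    finally have "inverse (real n) * real (m n) powr (\<alpha> + 1) \<le> inverse (real n) * (c powr (\<alpha> + 1) * real n powr (p * (\<alpha> + 1)))"
      by (intro mult_left_mono) auto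
    also have "\<dots> = c powr (\<alpha> + 1) * real n powr (p * (\<alpha> + 1) - 1)"
      using elim by (simp add: powr_diff divide_inverse)
    finally have 1: "inverse (real n) * real (m n) powr (\<alpha> + 1) \<le> c powr (\<alpha> + 1) * real n powr (- (2 * \<beta> - 1) / (\<alpha> + 2 * \<beta>))"
      unfolding e1 .
    have "real (m n) powr (-2 * \<beta> + 1) \<le> (c' * real n powr p) powr (-2 * \<beta> + 1)"
      using elim c' \<alpha> \<beta> by (intro powr_mono2') auto
    also have "\<dots> = c' powr (-2 * \<beta> + 1) * real n powr (p * (-2 * \<beta> + 1))"
      using c' by (simp add: powr_mult powr_powr)
    finally have 2: "real (m n) powr (-2 * \<beta> + 1) \<le> c' powr (-2 * \<beta> + 1) * real n powr (- (2 * \<beta> - 1) / (\<alpha> + 2 * \<beta>))"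
      unfolding e2 .
    show ?case using 1 2 by (simp only: distrib_right)
  qed
  moreover have "c powr (\<alpha> + 1) + c' powr (-2 * \<beta> + 1) > 0"
    using c(1) by (simp add: add_pos_nonneg)
  ultimately show "\<exists>K>0. \<forall>\<^sub>F n in sequentially.
      inverse (real n) * real (m n) powr (\<alpha> + 1) + real (m n) powr (-2 * \<beta> + 1)
        \<le> K * real n powr (- (2 * \<beta> - 1) / (\<alpha> + 2 * \<beta>))"
    by blast
qed

theorem theorem1:
  fixes M :: "'w measure"
    and X Y EYX :: "'w \<Rightarrow> real \<Rightarrow> real"
    and b :: "real \<Rightarrow> real \<Rightarrow> real"
    and \<kappa> :: "nat \<Rightarrow> real" and \<phi> :: "nat \<Rightarrow> real \<Rightarrow> real"
    and Xs Ys :: "nat \<Rightarrow> 'w \<Rightarrow> real \<Rightarrow> real"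
    and \<kappa>h :: "nat \<Rightarrow> 'w \<Rightarrow> nat \<Rightarrow> real" and \<phi>h :: "nat \<Rightarrow> 'w \<Rightarrow> nat \<Rightarrow> real \<Rightarrow> real"
    and \<alpha> \<beta> \<gamma> C\<^sub>1 :: real
  defines "\<xi> \<equiv> \<lambda>k \<omega>. \<integral>t. (X \<omega> t - mean_fun M X t) * \<phi> k t \<partial>unit_I"
    and "bc \<equiv> \<lambda>j k. \<integral>(s, t). b s t * \<phi> j s * \<phi> k t \<partial>unit_I2"
    and "err \<equiv> \<lambda>\<omega> s. Y \<omega> s - EYX \<omega> s"
    and "loss \<equiv> \<lambda>m n \<omega>.
           (L2_norm unit_I2 (\<lambda>(s, t). b_hat Xs Ys \<kappa>h \<phi>h m n \<omega> s t - b s t))\<^sup>2"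
  assumes "prob_space M"
    and "L2_random M X" and "L2_random M Y"
    and "(\<lambda>(s, t). b s t) \<in> L2 unit_I2"
    and "L2_cond_exp M (sigma_gen M X) Y EYX"
    and "AE \<omega> in M. AE s in unit_I.
           EYX \<omega> s = mean_fun M Y s + (\<integral>t. b s t * (X \<omega> t - mean_fun M X t) \<partial>unit_I)"
    and "injective_int_op (cov_kernel M X)"
    and "spectral_expansion (cov_kernel M X) \<kappa> \<phi>"
    and "\<forall>k\<ge>1. \<kappa> k > 0"
    and "indep_copies M X Y Xs Ys"
    and "\<forall>n\<ge>1. \<forall>\<omega>\<in>space M. spectral_expansion (sample_cov Xs n \<omega>) (\<kappa>h n \<omega>) (\<phi>h n \<omega>)"
    and "\<alpha> > 1" and "\<beta> > \<alpha> / 2 + 1" and "\<gamma> > 1 / 2" and "C\<^sub>1 > 1"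
    and "integrable M (\<lambda>\<omega>. (L2_norm unit_I (Y \<omega>))\<^sup>2)"
    and "integrable M (\<lambda>\<omega>. (L2_norm unit_I (X \<omega>))\<^sup>2)"
    and "AE \<omega> in M. real_cond_exp M (sigma_gen M X) (\<lambda>\<omega>'. (L2_norm unit_I (err \<omega>'))\<^sup>2) \<omega> \<le> C\<^sub>1"
    and "\<forall>k\<ge>1. integrable M (\<lambda>\<omega>. \<xi> k \<omega> ^ 4) \<and> (\<integral>\<omega>. \<xi> k \<omega> ^ 4 \<partial>M) \<le> C\<^sub>1 * (\<kappa> k)\<^sup>2"
    and "\<forall>k\<ge>1. \<kappa> k \<le> C\<^sub>1 * real k powr (-\<alpha>) \<and>
               \<kappa> k - \<kappa> (Suc k) \<ge> inverse C\<^sub>1 * real k powr (-\<alpha> - 1)"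
    and "\<forall>j\<ge>1. \<forall>k\<ge>1. \<bar>bc j k\<bar> \<le> C\<^sub>1 * real j powr (-\<gamma>) * real k powr (-\<beta>)"
  shows "(\<forall>m :: nat \<Rightarrow> nat. (\<forall>n. m n > 0) \<and> filterlim m at_top sequentially \<and>
            (\<lambda>n. real (m n)) \<in> o(\<lambda>n. real n powr (1 / (2 * \<alpha> + 2))) \<longrightarrow>
            bounded_in_prob M (loss m)
              (\<lambda>n. inverse (real n) * real (m n) powr (\<alpha> + 1) + real (m n) powr (-2 * \<beta> + 1))) \<and>
         (\<forall>m :: nat \<Rightarrow> nat. (\<forall>n. m n > 0) \<and>
            (\<lambda>n. real (m n)) \<in> \<Theta>(\<lambda>n. real n powr (1 / (\<alpha> + 2 * \<beta>))) \<longrightarrow>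
            bounded_in_prob M (loss m)
              (\<lambda>n. real n powr (- (2 * \<beta> - 1) / (\<alpha> + 2 * \<beta>))))"
proof -
  interpret functional_linear_sample M X Y EYX b \<kappa> \<phi> C\<^sub>1 \<alpha> Xs Ys \<kappa>h \<phi>h \<beta> \<gamma>
  proof (intro functional_linear_sample.intro functional_linear_model.intro functional_linear_model_axioms.intro
      polynomial_eigenvalues.intro functional_linear_sample_axioms.intro)
    show "prob_space M" "L2_random M X" "L2_random M Y" "(\<lambda>(s, t). b s t) \<in> L2 unit_I2"
      "L2_cond_exp M (sigma_gen M X) Y EYX" "indep_copies M X Y Xs Ys"
      "integrable M (\<lambda>\<omega>. (L2_norm unit_I (Y \<omega>))\<^sup>2)" "integrable M (\<lambda>\<omega>. (L2_norm unit_I (X \<omega>))\<^sup>2)"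
      "\<alpha> > 1" "\<beta> > \<alpha> / 2 + 1" "\<gamma> > 1 / 2" "C\<^sub>1 > 1"
      by fact+
    show "AE \<omega> in M. AE s in unit_I.
           EYX \<omega> s = mean_fun M Y s + (\<integral>t. b s t * (X \<omega> t - mean_fun M X t) \<partial>unit_I)"
      by fact
    show "L2_basis \<phi>"
      using assms(12) by (simp add: spectral_expansion_def)
    show "AE s in unit_I. int_op (cov_kernel M X) (\<phi> k) s = \<kappa> k * \<phi> k s" if "k \<ge> 1" for k
      using assms(12) that by (simp add: spectral_expansion_def)
    show "C\<^sub>1 > 0" using \<open>C\<^sub>1 > 1\<close> by simp
    show "AE \<omega> in M. real_cond_exp M (sigma_gen M X)
        (\<lambda>\<omega>'. (L2_norm unit_I (\<lambda>s. Y \<omega>' s - EYX \<omega>' s))\<^sup>2) \<omega> \<le> C\<^sub>1"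
      using assms(22) by (simp add: err_def)
    show "integrable M (\<lambda>\<omega>. (\<integral>t. (X \<omega> t - mean_fun M X t) * \<phi> k t \<partial>unit_I) ^ 4) \<and>
        (\<integral>\<omega>. (\<integral>t. (X \<omega> t - mean_fun M X t) * \<phi> k t \<partial>unit_I) ^ 4 \<partial>M) \<le> C\<^sub>1 * (\<kappa> k)\<^sup>2" if "k \<ge> 1" for k
      using assms(23) that by (simp add: \<xi>_def)
    show "\<kappa> k > 0" if "k \<ge> 1" for k using assms(13) that by simp
    show "\<kappa> k \<le> C\<^sub>1 * real k powr (- \<alpha>)" "inverse C\<^sub>1 * real k powr (- \<alpha> - 1) \<le> \<kappa> k - \<kappa> (Suc k)" if "k \<ge> 1" for k
      using assms(24) that by auto
    show "spectral_expansion (sample_cov Xs n \<omega>) (\<kappa>h n \<omega>) (\<phi>h n \<omega>)" if "n \<ge> 1" "\<omega> \<in> space M" for n \<omega>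
      using assms(15) that by blast
    show "\<bar>\<integral>(s, t). b s t * \<phi> j s * \<phi> k t \<partial>unit_I2\<bar> \<le> C\<^sub>1 * real j powr (-\<gamma>) * real k powr (-\<beta>)" if "j \<ge> 1" "k \<ge> 1" for j k
      using assms(25) that by (simp add: bc_def)
  qed
  have rate: "bounded_in_prob M (loss m)
      (\<lambda>n. inverse (real n) * real (m n) powr (\<alpha> + 1) + real (m n) powr (-2 * \<beta> + 1))"
    if "\<forall>n. m n > 0" "(\<lambda>n. real (m n)) \<in> o(\<lambda>n. real n powr (1 / (2 * \<alpha> + 2)))" for m
    using loss_rate[of m] that by (simp add: loss_def)
  have "bounded_in_prob M (loss m) (\<lambda>n. real n powr (- (2 * \<beta> - 1) / (\<alpha> + 2 * \<beta>)))"
    if m: "\<forall>n. m n > 0" and th: "(\<lambda>n. real (m n)) \<in> \<Theta>(\<lambda>n. real n powr (1 / (\<alpha> + 2 * \<beta>)))" for m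
  proof -
    note opt = optimal_rate[OF \<open>\<alpha> > 1\<close> \<open>\<beta> > \<alpha> / 2 + 1\<close> th]
    obtain K where "K > 0" and "\<forall>\<^sub>F n in sequentially.
      inverse (real n) * real (m n) powr (\<alpha> + 1) + real (m n) powr (-2 * \<beta> + 1)
        \<le> K * real n powr (- (2 * \<beta> - 1) / (\<alpha> + 2 * \<beta>))"
      using opt(2) by blast
    then show ?thesis
      by (rule bounded_in_prob_mono[OF rate[OF m opt(1)]])
  qed
  with rate show ?thesis by blast
qed

end
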